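(* Let $1<p<2$, let $q$ be the Hölder conjugate of $p$, and let $X=\{f\in\mathscr{SC}_{p,m}:\operatorname{supp}(f)\subset\Omega\}$, $\Omega=[0,1]^2$, with norm $\|f\|_X=\|\mathrm{SH}_\psi f\|_{\ell^p_m}$. Let $R(f)=\frac1p\|\mathrm{SH}_\psi f\|_{\ell^p_m}^p$ and $\widetilde R(f)=R(f)+\iota_+(f)$. Suppose that the forward operator satisfies (A1) and (A2), that $f^\dagger\in X$ satisfies $f^\dagger\ge0$ a.e., and that the following hold: (S1) there exists $w\in Z$ such that $r^\dagger=A_\mu^*w$, where $r^\dagger=\nabla R(f^\dagger)$; (S2) $\sum_{j=1}^\infty m_j^{-q}\|A\,\mathrm{SH}_\psi^\dagger e_j\|_\infty^q<\infty$, where $\{e_j\}_{j\in\mathbb N}$ is the canonical basis of $\ell^p$, $[e_j]_i=\delta_{ij}$. Let $f^\delta_{\alpha,N}$ be the minimizer over $X$ of $f\mapsto\frac12\|A_{\mathbf u}f-\mathbf g_N^\delta\|_{V_N}^2+\alpha R(f)+\iota_+(f)$. Then, as $N\to\infty$ (with $\delta=\delta(N)>0$): - if $\delta N\to\infty$ and $\delta^2/N\to0$, then $\mathbb E\big[D_{\widetilde R}(f^\delta_{\alpha,N},f^\dagger)\big]\lesssim\left(\frac{\delta^2}N\right)^{1/3}$ for $\alpha\simeq\left(\frac{\delta^2}N\right)^{1/3}$; - if $\delta N$ is bounded, then $\mathbb E\big[D_{\widetilde R}(f^\delta_{\alpha,N},f^\dagger)\big]\lesssim N^{-1}$ for $\alpha\simeq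 N^{-1}$.
   Context: Shearlets ($d=2$; all functions and sequences in $X$, $\ell^p_m$ are real-valued). For $a\in\mathbb R\setminus\{0\}$, $s\in\mathbb R^{d-1}$, $t\in\mathbb R^d$ let $A_a=\begin{pmatrix}a&0^T\\0&\operatorname{sign}(a)|a|^{1/d}I_{d-1}\end{pmatrix}$, $S_s=\begin{pmatrix}1&s^T\\0&I_{d-1}\end{pmatrix}$ and $\pi(a,s,t)f(x)=|\det A_a|^{-1/2}f(A_a^{-1}S_s^{-1}(x-t))$. $\mathbb S$ is the shearlet group, i.e. $(\mathbb R\setminus\{0\})\times\mathbb R^{d-1}\times\mathbb R^d$ with the product $(a,s,t)(a',s',t')=(aa',\,s+|a|^{1-1/d}s',\,t+S_sA_at')$ for which $\pi$ is a unitary representation on $L^2(\mathbb R^d)$. For an admissible ($\int|\hat\psi(\xi)|^2|\xi_1|^{-d}d\xi<\infty$), compactly supported $\psi\in L^2(\mathbb R^d)$, $\mathscr{SH}_\psi f(a,s,t)=\langle f,\pi(a,s,t)\psi\rangle$. Given a locally integrable weight $\omega=\omega(a,s)$, $\mathscr H_{1,\omega}=\{f\in L^2(\mathbb R^d):\mathscr{SH}_\psi f\in L^1_\omega(\mathbb S)\}$, $\mathscr H_{1,\omega}^\sim$ is its anti-dual, the $L^2$ pairing extends to $\mathscr H_{1,\omega}^\sim\times\mathscr H_{1,\omega}$, and $\psi\in\mathscr H_{1,\omega}$. $m$ is an $\omega$-moderate weight on $\mathbb S$ ($m(xyz)\le\omega(x)m(y)\omega(z)$), $L^p_m(\mathbb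 S)=\{F:Fm\in L^p(\mathbb S)\}$ and $\mathscr{SC}_{p,m}=\{f\in\mathscr H_{1,\omega}^\sim:\mathscr{SH}_\psi f\in L^p_m(\mathbb S)\}$ with norm $\|\mathscr{SH}_\psi f\|_{L^p_m(\mathbb S)}$. For a discrete set $\Lambda$ of parameters (identified with $\mathbb N$ by enumeration), $\psi_\lambda=\pi((a,s,t)_\lambda)\psi$, $m_\lambda=m((a,s,t)_\lambda)$, $\|c\|_{\ell^p_m}=(\sum_\lambda m_\lambda^p|c_\lambda|^p)^{1/p}$ and $\mathrm{SH}_\psi f=\{\langle f,\psi_\lambda\rangle\}_{\lambda\in\Lambda}$. Standing assumption: $\psi,\Lambda$ are such that $\{\psi_\lambda\}$ is a Banach frame for $\mathscr{SC}_{p,m}$: (i) $f\in\mathscr{SC}_{p,m}$ iff $\mathrm{SH}_\psi f\in\ell^p_m$; (ii) $D\|f\|_{\mathscr{SC}_{p,m}}\le\|\mathrm{SH}_\psi f\|_{\ell^p_m}\le D'\|f\|_{\mathscr{SC}_{p,m}}$ for constants $0<D\le D'<\infty$; (iii) there is a bounded linear reconstruction operator $\mathrm{SH}_\psi^\dagger$ from $\ell^p_m$ to the coorbit space with $\mathrm{SH}_\psi^\dagger\mathrm{SH}_\psi f=f$. On $X$, $\mathrm{SH}^\dagger_\psi$ is regarded as a bounded operator $\ell^p_m\to X$ with $\mathrm{SH}_\psi^\dagger\mathrm{SH}_\psi f=f$ for $f\in X$. Forward operator. $U\subset\mathbb R^{d_U}$, $V$ is a Hilbert space, $Y=L^2(U;V)$,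 and $A:X\to Y$ is a bounded linear operator whose range lies in a Banach space $Z\subset Y$ with $Z\subset\mathcal C(U;V)$ continuously, and $A:X\to Z$ is continuous. $\|g\|_\infty=\sup_{u\in U}\|g(u)\|_V$. For $u\in U$, $A_uf=(Af)(u)$. (A1): there is $\kappa\le1$ with $\|A_uf\|_V\le\kappa\|f\|_X$ for all $u\in U$, $f\in X$. (A2): $u\mapsto(Af)(u)$ is measurable for every $f\in X$. Sampling. $V_N=\bigoplus_{n=1}^NV$ has inner product $\langle\mathbf v,\tilde{\mathbf v}\rangle_{V_N}=\frac1N\sum_{n=1}^N\langle v_n,\tilde v_n\rangle_V$. For $\mathbf u=(u_n)_{n=1}^N\in U^N$, $A_{\mathbf u}f=((Af)(u_n))_{n=1}^N\in V_N$. The points $u_n$ are i.i.d. with law a probability measure $\mu$ on $U$. $Y_\mu=L^2(U,\mu;V)$ and $A_\mu:X\to Y_\mu$ is given by $\langle A_\mu f,g\rangle_{Y_\mu}=\int_U\langle(Af)(u),g(u)\rangle_V\,\mu(du)$ for all $g\in Y_\mu$; $A_\mu^*:Y_\mu\to X^*$ is its adjoint (and $Z\subset\mathcal C(U;V)\subset Y_\mu$). Data. $\mathbf g_N^\delta=A_{\mathbf u}f^\dagger+\delta\epsilon_N$, where $\delta>0$ and $\epsilon_N=(\epsilon_N^n)_{n=1}^N$ has i.i.d. entries distributed as a zero-mean $V$-valued random variable $\epsilon$, independent of the $u_n$, with $\mathbb E[\|\epsilon\|_V^l]<\frac{l!}2\Sigma^{l-2}$ for all $l\ge2$ and some constant $\Sigma>0$.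 Constraint and Bregman distance. $\iota_+(f)=0$ if $f\ge0$ a.e. and $\iota_+(f)=\infty$ otherwise. For $f,\tilde f\in X$ with $f,\tilde f\ge0$ a.e., $D_{\widetilde R}(f,\tilde f)=\langle\nabla R(f)-\nabla R(\tilde f),f-\tilde f\rangle_{X^*\times X}$. $a\lesssim b$ means $a\le Cb$ with $C>0$ independent of $N$, $\delta$ and $\alpha$; $a\simeq b$ means $a$ equals $b$ up to multiplicative constants bounded above and below by positive constants independent of $N$ and $\delta$. The expectation is over $\mathbf u$ and $\epsilon_N$. *)

theory Defs
  imports "HOL-Probability.Probability"
begin

section \<open>The shearlet group and its representation, for dimension two\<close>

type_synonym plane = "real ^ 2"
type_synonym shear_param = "real \<times> real \<times> plane"

definition dilation_mat :: "real \<Rightarrow> real ^ 2 ^ 2" where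
  "dilation_mat a = vector [vector [a, 0], vector [0, sgn a * \<bar>a\<bar> powr (1/2)]]"

definition shear_mat :: "real \<Rightarrow> real ^ 2 ^ 2" where
  "shear_mat s = vector [vector [1, s], vector [0, 1]]"

definition shear_group :: "shear_param set" where
  "shear_group = {(a, s, t). a \<noteq> 0}"

fun shear_mult :: "shear_param \<Rightarrow> shear_param \<Rightarrow> shear_param" where
  "shear_mult (a, s, t) (a', s', t') =
     (a * a', s + \<bar>a\<bar> powr (1 - 1/2) * s', t + shear_mat s *v (dilation_mat a *v t'))"

fun shear_rep :: "shear_param \<Rightarrow> (plane \<Rightarrow> real) \<Rightarrow> plane \<Rightarrow> real" where
  "shear_rep (a, s, t) f x =
     \<bar>det (dilation_mat a)\<bar> powr (-1/2)
       * f (matrix_inv (dilation_mat a) *v (matrix_inv (shear_mat s) *v (x - t)))"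

text \<open>Left Haar measure: left translation by \<open>(a, s, t)\<close> has Jacobian
  \<open>\<bar>a\<bar> * \<bar>a\<bar> powr (1/2) * \<bar>a\<bar> powr (3/2) = \<bar>a\<bar> ^ 3\<close> with respect to Lebesgue measure.\<close>

definition shear_haar :: "shear_param measure" where
  "shear_haar = density (restrict_space lborel shear_group) (\<lambda>(a, s, t). ennreal (\<bar>a\<bar> powr (-3)))"

text \<open>\<open>L\<^sup>p\<close> on the group with weight \<open>w\<close>; its elements are functions, not classes modulo null sets.\<close>

definition Lp_group :: "real \<Rightarrow> (shear_param \<Rightarrow> real) \<Rightarrow> (shear_param \<Rightarrow> real) set" where
  "Lp_group p w = {F. (\<lambda>g. F g * w g) \<in> borel_measurable shear_haar
                     \<and> integrable shear_haar (\<lambda>g. \<bar>F g * w g\<bar> powr p)}"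

definition Lp_group_norm :: "real \<Rightarrow> (shear_param \<Rightarrow> real) \<Rightarrow> (shear_param \<Rightarrow> real) \<Rightarrow> real" where
  "Lp_group_norm p w F = (\<integral>g. \<bar>F g * w g\<bar> powr p \<partial>shear_haar) powr (1/p)"

definition is_weight :: "(shear_param \<Rightarrow> real) \<Rightarrow> bool" where
  "is_weight w \<longleftrightarrow> w \<in> borel_measurable shear_haar \<and> (\<forall>g\<in>shear_group. 0 < w g)"

definition locally_integrable_weight :: "(shear_param \<Rightarrow> real) \<Rightarrow> bool" where
  "locally_integrable_weight w \<longleftrightarrow>
     is_weight w \<and> (\<forall>K. compact K \<and> K \<subseteq> shear_group \<longrightarrow> set_integrable shear_haar K w)"

definition moderate_weight :: "(shear_param \<Rightarrow> real) \<Rightarrow> (shear_param \<Rightarrow> real) \<Rightarrow> bool" where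
  "moderate_weight w m \<longleftrightarrow> is_weight m \<and>
     (\<forall>x\<in>shear_group. \<forall>y\<in>shear_group. \<forall>z\<in>shear_group.
        m (shear_mult (shear_mult x y) z) \<le> w x * m y * w z)"

section \<open>Shearlet transform and coorbit spaces\<close>

text \<open>Elements of \<open>L\<^sup>2\<close> are represented by Borel functions.\<close>

definition L2_plane :: "(plane \<Rightarrow> real) set" where
  "L2_plane = {f. f \<in> borel_measurable lborel \<and> integrable lborel (\<lambda>x. (f x)\<^sup>2)}"

definition L2_inner :: "(plane \<Rightarrow> real) \<Rightarrow> (plane \<Rightarrow> real) \<Rightarrow> real" where
  "L2_inner f h = (\<integral>x. f x * h x \<partial>lborel)"

text \<open>This integral formula is meant for integrable functions, in particular for compactly
  supported elements of \<open>L\<^sup>2\<close>.\<close>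

definition fourier :: "(plane \<Rightarrow> real) \<Rightarrow> plane \<Rightarrow> complex" where
  "fourier f \<xi> = (\<integral>x. complex_of_real (f x) * cis (- (2 * pi * (x \<bullet> \<xi>))) \<partial>lborel)"

definition admissible_shearlet :: "(plane \<Rightarrow> real) \<Rightarrow> bool" where
  "admissible_shearlet \<psi> \<longleftrightarrow>
     (\<integral>\<^sup>+\<xi>. ennreal ((cmod (fourier \<psi> \<xi>))\<^sup>2 * \<bar>\<xi> $ 1\<bar> powr (-2)) \<partial>lborel) < \<infinity>"

definition compactly_supported :: "(plane \<Rightarrow> real) \<Rightarrow> bool" where
  "compactly_supported f \<longleftrightarrow> (\<exists>K. compact K \<and> (AE x in lborel. x \<notin> K \<longrightarrow> f x = 0))"

definition shear_transform_L2 :: "(plane \<Rightarrow> real) \<Rightarrow> (plane \<Rightarrow> real) \<Rightarrow> shear_param \<Rightarrow> real" where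
  "shear_transform_L2 \<psi> f g = L2_inner f (shear_rep g \<psi>)"

definition H1 :: "(plane \<Rightarrow> real) \<Rightarrow> (shear_param \<Rightarrow> real) \<Rightarrow> (plane \<Rightarrow> real) set" where
  "H1 \<psi> w = {f \<in> L2_plane. shear_transform_L2 \<psi> f \<in> Lp_group 1 w}"

definition H1_norm :: "(plane \<Rightarrow> real) \<Rightarrow> (shear_param \<Rightarrow> real) \<Rightarrow> (plane \<Rightarrow> real) \<Rightarrow> real" where
  "H1_norm \<psi> w f = Lp_group_norm 1 w (shear_transform_L2 \<psi> f)"

type_synonym functional = "(plane \<Rightarrow> real) \<Rightarrow> real"

text \<open>Over the reals the anti-dual is the space of bounded linear functionals.  The value outside
  \<open>H1\<close> is fixed to \<open>0\<close> so that functionals that agree on \<open>H1\<close> are equal.  Boundedness makes them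
  insensitive to changes on null sets.  The extended pairing of \<open>F\<close> with \<open>h\<close> is \<open>F h\<close>.\<close>

definition H1_dual :: "(plane \<Rightarrow> real) \<Rightarrow> (shear_param \<Rightarrow> real) \<Rightarrow> functional set" where
  "H1_dual \<psi> w = {F.
     (\<forall>h\<in>H1 \<psi> w. \<forall>k\<in>H1 \<psi> w. F (\<lambda>x. h x + k x) = F h + F k)
   \<and> (\<forall>c. \<forall>h\<in>H1 \<psi> w. F (\<lambda>x. c * h x) = c * F h)
   \<and> (\<exists>C. \<forall>h\<in>H1 \<psi> w. \<bar>F h\<bar> \<le> C * H1_norm \<psi> w h)
   \<and> (\<forall>h. h \<notin> H1 \<psi> w \<longrightarrow> F h = 0)}"

definition shear_transform :: "(plane \<Rightarrow> real) \<Rightarrow> functional \<Rightarrow> shear_param \<Rightarrow> real" where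
  "shear_transform \<psi> F g = F (shear_rep g \<psi>)"

definition coorbit ::
  "(plane \<Rightarrow> real) \<Rightarrow> (shear_param \<Rightarrow> real) \<Rightarrow> real \<Rightarrow> (shear_param \<Rightarrow> real) \<Rightarrow> functional set" where
  "coorbit \<psi> w p m = {F \<in> H1_dual \<psi> w. shear_transform \<psi> F \<in> Lp_group p m}"

definition coorbit_norm ::
  "(plane \<Rightarrow> real) \<Rightarrow> real \<Rightarrow> (shear_param \<Rightarrow> real) \<Rightarrow> functional \<Rightarrow> real" where
  "coorbit_norm \<psi> p m F = Lp_group_norm p m (shear_transform \<psi> F)"

definition fadd :: "functional \<Rightarrow> functional \<Rightarrow> functional" where
  "fadd F G = (\<lambda>h. F h + G h)"

definition fscale :: "real \<Rightarrow> functional \<Rightarrow> functional" where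
  "fscale c F = (\<lambda>h. c * F h)"

definition fdiff :: "functional \<Rightarrow> functional \<Rightarrow> functional" where
  "fdiff F G = (\<lambda>h. F h - G h)"

text \<open>Support in the sense of distributions, with test space \<open>H1\<close>: the complement of the union of
  the open sets on which \<open>F\<close> vanishes.\<close>

definition vanishes_on ::
  "(plane \<Rightarrow> real) \<Rightarrow> (shear_param \<Rightarrow> real) \<Rightarrow> functional \<Rightarrow> plane set \<Rightarrow> bool" where
  "vanishes_on \<psi> w F W \<longleftrightarrow>
     (\<forall>h\<in>H1 \<psi> w. \<forall>K. compact K \<and> K \<subseteq> W \<and> (AE x in lborel. x \<notin> K \<longrightarrow> h x = 0) \<longrightarrow> F h = 0)"

definition fsupport ::
  "(plane \<Rightarrow> real) \<Rightarrow> (shear_param \<Rightarrow> real) \<Rightarrow> functional \<Rightarrow> plane set" where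
  "fsupport \<psi> w F = - \<Union>{W. open W \<and> vanishes_on \<psi> w F W}"

text \<open>A function is identified with the functional it induces through the \<open>L\<^sup>2\<close> pairing.  Hence
  ``\<open>F \<ge> 0\<close> a.e.'' says that \<open>F\<close> is induced by an a.e. nonnegative function.\<close>

definition represents ::
  "(plane \<Rightarrow> real) \<Rightarrow> (shear_param \<Rightarrow> real) \<Rightarrow> (plane \<Rightarrow> real) \<Rightarrow> functional \<Rightarrow> bool" where
  "represents \<psi> w f F \<longleftrightarrow> f \<in> borel_measurable lborel \<and>
     (\<forall>h\<in>H1 \<psi> w. integrable lborel (\<lambda>x. f x * h x) \<and> F h = L2_inner f h)"

definition nonneg_ae ::
  "(plane \<Rightarrow> real) \<Rightarrow> (shear_param \<Rightarrow> real) \<Rightarrow> functional \<Rightarrow> bool" where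
  "nonneg_ae \<psi> w F \<longleftrightarrow> (\<exists>f. represents \<psi> w f F \<and> (AE x in lborel. 0 \<le> f x))"

definition iota_plus ::
  "(plane \<Rightarrow> real) \<Rightarrow> (shear_param \<Rightarrow> real) \<Rightarrow> functional \<Rightarrow> ereal" where
  "iota_plus \<psi> w F = (if nonneg_ae \<psi> w F then 0 else \<infinity>)"

section \<open>Sequence spaces and the Banach frame property\<close>

definition lp :: "real \<Rightarrow> (nat \<Rightarrow> real) \<Rightarrow> (nat \<Rightarrow> real) set" where
  "lp p mw = {c. summable (\<lambda>j. mw j powr p * \<bar>c j\<bar> powr p)}"

definition lp_norm :: "real \<Rightarrow> (nat \<Rightarrow> real) \<Rightarrow> (nat \<Rightarrow> real) \<Rightarrow> real" where
  "lp_norm p mw c = (\<Sum>j. mw j powr p * \<bar>c j\<bar> powr p) powr (1/p)"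

definition unit_seq :: "nat \<Rightarrow> nat \<Rightarrow> real" where
  "unit_seq j i = (if i = j then 1 else 0)"

text \<open>The discrete parameter set is given by its enumeration \<open>\<Lambda>\<close>; the associated sequence weight
  is \<open>m \<circ> \<Lambda>\<close>.\<close>

definition shear_coeffs :: "(plane \<Rightarrow> real) \<Rightarrow> (nat \<Rightarrow> shear_param) \<Rightarrow> functional \<Rightarrow> nat \<Rightarrow> real" where
  "shear_coeffs \<psi> \<Lambda> F j = shear_transform \<psi> F (\<Lambda> j)"

definition bounded_linear_from_lp ::
  "real \<Rightarrow> (nat \<Rightarrow> real) \<Rightarrow> functional set \<Rightarrow> (functional \<Rightarrow> real)
     \<Rightarrow> ((nat \<Rightarrow> real) \<Rightarrow> functional) \<Rightarrow> bool" where
  "bounded_linear_from_lp p mw E nrm T \<longleftrightarrow>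
     (\<forall>c\<in>lp p mw. T c \<in> E)
   \<and> (\<forall>c\<in>lp p mw. \<forall>d\<in>lp p mw. T (\<lambda>j. c j + d j) = fadd (T c) (T d))
   \<and> (\<forall>r. \<forall>c\<in>lp p mw. T (\<lambda>j. r * c j) = fscale r (T c))
   \<and> (\<exists>C. \<forall>c\<in>lp p mw. nrm (T c) \<le> C * lp_norm p mw c)"

definition banach_frame ::
  "(plane \<Rightarrow> real) \<Rightarrow> (shear_param \<Rightarrow> real) \<Rightarrow> real \<Rightarrow> (shear_param \<Rightarrow> real)
     \<Rightarrow> (nat \<Rightarrow> shear_param) \<Rightarrow> bool" where
  "banach_frame \<psi> w p m \<Lambda> \<longleftrightarrow>
     (\<forall>F\<in>H1_dual \<psi> w. F \<in> coorbit \<psi> w p m \<longleftrightarrow> shear_coeffs \<psi> \<Lambda> F \<in> lp p (m \<circ> \<Lambda>))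
   \<and> (\<exists>D D'. 0 < D \<and> D \<le> D' \<and>
        (\<forall>F\<in>coorbit \<psi> w p m.
            D * coorbit_norm \<psi> p m F \<le> lp_norm p (m \<circ> \<Lambda>) (shear_coeffs \<psi> \<Lambda> F)
          \<and> lp_norm p (m \<circ> \<Lambda>) (shear_coeffs \<psi> \<Lambda> F) \<le> D' * coorbit_norm \<psi> p m F))
   \<and> (\<exists>S. bounded_linear_from_lp p (m \<circ> \<Lambda>) (coorbit \<psi> w p m) (coorbit_norm \<psi> p m) S \<and>
        (\<forall>F\<in>coorbit \<psi> w p m. S (shear_coeffs \<psi> \<Lambda> F) = F))"

section \<open>The space \<open>X\<close>, the regularizer and the Bregman distance\<close>

definition Omega :: "plane set" where
  "Omega = {x. \<forall>i. 0 \<le> x $ i \<and> x $ i \<le> 1}"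

definition X_space ::
  "(plane \<Rightarrow> real) \<Rightarrow> (shear_param \<Rightarrow> real) \<Rightarrow> real \<Rightarrow> (shear_param \<Rightarrow> real) \<Rightarrow> functional set" where
  "X_space \<psi> w p m = {F \<in> coorbit \<psi> w p m. fsupport \<psi> w F \<subseteq> Omega}"

definition X_norm ::
  "(plane \<Rightarrow> real) \<Rightarrow> real \<Rightarrow> (shear_param \<Rightarrow> real) \<Rightarrow> (nat \<Rightarrow> shear_param) \<Rightarrow> functional \<Rightarrow> real" where
  "X_norm \<psi> p m \<Lambda> F = lp_norm p (m \<circ> \<Lambda>) (shear_coeffs \<psi> \<Lambda> F)"

definition R_reg ::
  "(plane \<Rightarrow> real) \<Rightarrow> real \<Rightarrow> (shear_param \<Rightarrow> real) \<Rightarrow> (nat \<Rightarrow> shear_param) \<Rightarrow> functional \<Rightarrow> real" where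
  "R_reg \<psi> p m \<Lambda> F = 1/p * lp_norm p (m \<circ> \<Lambda>) (shear_coeffs \<psi> \<Lambda> F) powr p"

text \<open>\<open>grad_R \<psi> p m \<Lambda> F H\<close> is the gradient of \<open>R\<close> at \<open>F\<close>, an element of the dual of \<open>X\<close>, applied
  to \<open>H\<close>.\<close>

definition grad_R ::
  "(plane \<Rightarrow> real) \<Rightarrow> real \<Rightarrow> (shear_param \<Rightarrow> real) \<Rightarrow> (nat \<Rightarrow> shear_param)
     \<Rightarrow> functional \<Rightarrow> functional \<Rightarrow> real" where
  "grad_R \<psi> p m \<Lambda> F H = deriv (\<lambda>\<tau>. R_reg \<psi> p m \<Lambda> (fadd F (fscale \<tau> H))) 0"

definition bregman ::
  "(plane \<Rightarrow> real) \<Rightarrow> real \<Rightarrow> (shear_param \<Rightarrow> real) \<Rightarrow> (nat \<Rightarrow> shear_param)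
     \<Rightarrow> functional \<Rightarrow> functional \<Rightarrow> real" where
  "bregman \<psi> p m \<Lambda> F G =
     grad_R \<psi> p m \<Lambda> F (fdiff F G) - grad_R \<psi> p m \<Lambda> G (fdiff F G)"

section \<open>Forward operator and sampling\<close>

text \<open>The Banach space \<open>Z\<close> is a type \<open>'z\<close>; its inclusion into the functions on \<open>U\<close> is \<open>J\<close>.
  Continuous functions on \<open>U\<close> have separable range, so that they are strongly measurable for any
  Hilbert space \<open>'v\<close>.\<close>

definition sup_norm :: "'u set \<Rightarrow> ('u \<Rightarrow> 'v::real_normed_vector) \<Rightarrow> real" where
  "sup_norm U g = (SUP u\<in>U. norm (g u))"

definition embedded_in_L2_and_C ::
  "('u::euclidean_space) set \<Rightarrow> ('z::banach \<Rightarrow> 'u \<Rightarrow> 'v::{real_inner,complete_space}) \<Rightarrow> bool" where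
  "embedded_in_L2_and_C U J \<longleftrightarrow>
     (\<forall>z z'. \<forall>u\<in>U. J (z + z') u = J z u + J z' u)
   \<and> (\<forall>c z. \<forall>u\<in>U. J (c *\<^sub>R z) u = c *\<^sub>R J z u)
   \<and> (\<forall>z. continuous_on U (J z))
   \<and> (\<exists>C. \<forall>z. \<forall>u\<in>U. norm (J z u) \<le> C * norm z)
   \<and> (\<forall>z. (\<integral>\<^sup>+u. ennreal ((norm (J z u))\<^sup>2) \<partial>lebesgue_on U) < \<infinity>)
   \<and> (\<forall>z. (AE u in lebesgue_on U. J z u = 0) \<longrightarrow> z = 0)"

definition forward_operator ::
  "functional set \<Rightarrow> (functional \<Rightarrow> real) \<Rightarrow> ('u::euclidean_space) set
     \<Rightarrow> ('z::banach \<Rightarrow> 'u \<Rightarrow> 'v::{real_inner,complete_space}) \<Rightarrow> (functional \<Rightarrow> 'z) \<Rightarrow> bool" where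
  "forward_operator E nrm U J A \<longleftrightarrow>
     (\<forall>F\<in>E. \<forall>G\<in>E. A (fadd F G) = A F + A G)
   \<and> (\<forall>c. \<forall>F\<in>E. A (fscale c F) = c *\<^sub>R A F)
   \<and> (\<exists>C. \<forall>F\<in>E. norm (A F) \<le> C * nrm F)
   \<and> (\<exists>C\<ge>0. \<forall>F\<in>E.
        (\<integral>\<^sup>+u. ennreal ((norm (J (A F) u))\<^sup>2) \<partial>lebesgue_on U) \<le> ennreal ((C * nrm F)\<^sup>2))"

text \<open>The adjoint of \<open>A\<^sub>\<mu>\<close> at \<open>g\<close>, applied to \<open>F\<close>; the operator \<open>A\<^sub>\<mu>\<close> maps \<open>F\<close> to
  \<open>J (A F)\<close>, seen as an element of \<open>L\<^sup>2(U, \<mu>; V)\<close>.\<close>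

definition A_mu_adjoint ::
  "'u measure \<Rightarrow> ('z \<Rightarrow> 'u \<Rightarrow> 'v::real_inner) \<Rightarrow> (functional \<Rightarrow> 'z) \<Rightarrow> ('u \<Rightarrow> 'v) \<Rightarrow> functional \<Rightarrow> real" where
  "A_mu_adjoint \<mu> J A g F = (\<integral>u. J (A F) u \<bullet> g u \<partial>\<mu>)"

definition VN_inner :: "nat \<Rightarrow> (nat \<Rightarrow> 'v::real_inner) \<Rightarrow> (nat \<Rightarrow> 'v) \<Rightarrow> real" where
  "VN_inner N v v' = 1 / real N * (\<Sum>n=1..N. v n \<bullet> v' n)"

definition VN_norm :: "nat \<Rightarrow> (nat \<Rightarrow> 'v::real_inner) \<Rightarrow> real" where
  "VN_norm N v = sqrt (VN_inner N v v)"

definition sampled :: "('z \<Rightarrow> 'u \<Rightarrow> 'v) \<Rightarrow> (functional \<Rightarrow> 'z) \<Rightarrow> (nat \<Rightarrow> 'u) \<Rightarrow> functional \<Rightarrow> nat \<Rightarrow> 'v" where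
  "sampled J A us F = (\<lambda>n. J (A F) (us n))"

definition objective ::
  "(plane \<Rightarrow> real) \<Rightarrow> (shear_param \<Rightarrow> real) \<Rightarrow> real \<Rightarrow> (shear_param \<Rightarrow> real) \<Rightarrow> (nat \<Rightarrow> shear_param)
     \<Rightarrow> ('z \<Rightarrow> 'u \<Rightarrow> 'v::real_inner) \<Rightarrow> (functional \<Rightarrow> 'z)
     \<Rightarrow> real \<Rightarrow> nat \<Rightarrow> (nat \<Rightarrow> 'u) \<Rightarrow> (nat \<Rightarrow> 'v) \<Rightarrow> functional \<Rightarrow> ereal" where
  "objective \<psi> w p m \<Lambda> J A \<alpha> N us g F =
     ereal (1/2 * (VN_norm N (\<lambda>n. sampled J A us F n - g n))\<^sup>2 + \<alpha> * R_reg \<psi> p m \<Lambda> F)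
       + iota_plus \<psi> w F"

text \<open>The law \<open>\<nu>\<close> of the noise.  The mean in a Hilbert space, which need not be separable here, is
  determined by its inner products.\<close>

definition noise_law :: "'v::real_inner measure \<Rightarrow> bool" where
  "noise_law \<nu> \<longleftrightarrow> prob_space \<nu> \<and> sets \<nu> = sets borel
   \<and> (\<forall>v. integrable \<nu> (\<lambda>e. e \<bullet> v) \<and> (\<integral>e. e \<bullet> v \<partial>\<nu>) = 0)
   \<and> (\<exists>\<Sigma>>0. \<forall>l\<ge>2. (\<integral>\<^sup>+e. ennreal (norm e ^ l) \<partial>\<nu>) < ennreal (fact l / 2 * \<Sigma> ^ (l - 2)))"

text \<open>Sample points \<open>u n\<close> and noise \<open>\<epsilon> N n\<close>, where \<open>1 \<le> n \<le> N\<close>.  The \<open>indep_set\<close>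
  condition is independence of the two vectors (\<open>indep_var\<close> requires a common value type).\<close>

definition sampling_model ::
  "'w measure \<Rightarrow> 'u measure \<Rightarrow> 'v::real_inner measure
     \<Rightarrow> (nat \<Rightarrow> 'w \<Rightarrow> 'u) \<Rightarrow> (nat \<Rightarrow> nat \<Rightarrow> 'w \<Rightarrow> 'v) \<Rightarrow> bool" where
  "sampling_model M \<mu> \<nu> u \<epsilon> \<longleftrightarrow> prob_space M
   \<and> prob_space.indep_vars M (\<lambda>_. \<mu>) u {1..}
   \<and> (\<forall>n\<ge>1. distr M \<mu> (u n) = \<mu>)
   \<and> (\<forall>N\<ge>1. prob_space.indep_vars M (\<lambda>_. borel) (\<epsilon> N) {1..N}
        \<and> (\<forall>n\<in>{1..N}. distr M borel (\<epsilon> N n) = \<nu>)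
        \<and> prob_space.indep_set M
             {(\<lambda>x. \<lambda>n\<in>{1..N}. u n x) -` S \<inter> space M | S. S \<in> sets (\<Pi>\<^sub>M n\<in>{1..N}. \<mu>)}
             {(\<lambda>x. \<lambda>n\<in>{1..N}. \<epsilon> N n x) -` S \<inter> space M | S. S \<in> sets (\<Pi>\<^sub>M n\<in>{1..N}. borel)})"

definition is_estimator ::
  "(plane \<Rightarrow> real) \<Rightarrow> (shear_param \<Rightarrow> real) \<Rightarrow> real \<Rightarrow> (shear_param \<Rightarrow> real) \<Rightarrow> (nat \<Rightarrow> shear_param)
     \<Rightarrow> ('z \<Rightarrow> 'u \<Rightarrow> 'v::real_inner) \<Rightarrow> (functional \<Rightarrow> 'z) \<Rightarrow> functional
     \<Rightarrow> 'w measure \<Rightarrow> (nat \<Rightarrow> 'w \<Rightarrow> 'u) \<Rightarrow> (nat \<Rightarrow> nat \<Rightarrow> 'w \<Rightarrow> 'v)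
     \<Rightarrow> real \<Rightarrow> real \<Rightarrow> nat \<Rightarrow> ('w \<Rightarrow> functional) \<Rightarrow> bool" where
  "is_estimator \<psi> w p m \<Lambda> J A f_dag M u \<epsilon> \<delta> \<alpha> N f \<longleftrightarrow>
     (AE x in M. is_arg_min
        (objective \<psi> w p m \<Lambda> J A \<alpha> N (\<lambda>n. u n x)
           (\<lambda>n. sampled J A (\<lambda>n. u n x) f_dag n + \<delta> *\<^sub>R \<epsilon> N n x))
        (\<lambda>F. F \<in> X_space \<psi> w p m) (f x))"

end

theory Submission
  imports Defs
begin

text \<open>Write \<open>e = f - f\<^sup>\<dagger>\<close>.  The first-order condition at the minimizer and the source condition
  (S1) give \<open>D \<le> T e + O(\<alpha>)\<close>, where \<open>D\<close> is the Bregman distance and \<open>T\<close> is the random linear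
  functional
  \<open>T F = \<delta>/\<alpha> \<langle>\<epsilon>, A\<^sub>u F\<rangle> + \<langle>A\<^sub>u F, z\<rangle> - \<langle>A\<^sub>\<mu> F, z\<rangle>\<close>,
  with \<open>z\<close> the element of (S1).  If \<open>d = SH e\<close>, then \<open>T e = \<Sum> d\<^sub>j T(SH\<^sup>\<dagger> e\<^sub>j)\<close>.  Young's inequality, applied to each
  summand together with the local strong monotonicity of \<open>t \<mapsto> \<bar>t\<bar>\<^sup>p\<^sup>-\<^sup>1 sgn t\<close>, absorbs half of \<open>D\<close>
  and leaves \<open>D \<lesssim> \<rho> + \<rho>\<^sup>1\<^sup>-\<^sup>q\<^sup>/\<^sup>2 H + \<alpha>\<close> for every \<open>\<rho> \<in> (0, 1]\<close>, with
  \<open>H = \<Sum> m\<^sub>j\<^sup>-\<^sup>q \<bar>T(SH\<^sup>\<dagger> e\<^sub>j)\<bar>\<^sup>q\<close>.  Exponential moments bound the \<open>q\<close>-th moments of the empirical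
  averages, so that (S2) yields \<open>E H \<lesssim> N\<^sup>-\<^sup>q\<^sup>/\<^sup>2 ((\<delta>/\<alpha>)\<^sup>q + 1)\<close>.  It remains to take for \<open>\<rho>\<close> the
  claimed rate.\<close>

section \<open>Scalar inequalities\<close>

text \<open>The direction e depends on the same points and noise as T, so T e is not an average of
  centred independent terms. Expanding in the fixed elements \<open>SHdag (unit_seq j)\<close>
  separates the two: the randomness of e is absorbed into D, and moments of T are needed only at
  nonrandom arguments. For p < 2 the monotonicity of \<open>spow p\<close> has only the size |a -
  b|^2 (|a| + |b|)^(p - 2), which degenerates for large coefficients, so D alone does not dominate
  the p-th power of the norm of e. The parameter \<theta> = sqrt \<rho> repairs this at the price of
  \<theta>^2 times the p-th power of the norm of \<open>f_dag\<close>, a deterministic quantity. The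
  coefficient \<rho>^(1 - q/2) is compensated once E H is of order \<rho>^(q/2), that is, once 1/N
  and (\<delta>/\<alpha>)^2/N are at most of order \<rho>. With \<alpha> of order \<rho> the second
  condition bounds \<delta>^2/N by \<rho>^3, whence the cube root; the size of \<delta> N decides
  which condition is binding.\<close>

definition spow :: "real \<Rightarrow> real \<Rightarrow> real" where
  "spow p t = sgn t * \<bar>t\<bar> powr (p - 1)"

lemma spow_minus: "spow p (- t) = - spow p t"
  by (simp add: spow_def)

text \<open>Identifies \<open>spow p\<close> as the scalar duality map. Only t = 0 needs an
  argument: there the difference quotient is bounded by |h|^(p - 1), which tends to 0 because p >
  1.\<close>

lemma has_real_derivative_abs_powr:
  assumes "1 < p"
  shows "((\<lambda>t. \<bar>t\<bar> powr p) has_real_derivative p * spow p t) (at t)"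
proof -
  consider "t > 0" | "t < 0" | "t = 0" by linarith
  then show ?thesis
  proof cases
    case 1
    have "((\<lambda>t. t powr p) has_real_derivative p * t powr (p - 1)) (at t)"
      using 1 by (rule has_real_derivative_powr)
    moreover have "\<forall>\<^sub>F s in nhds t. \<bar>s\<bar> powr p = s powr p"
      using eventually_nhds_in_open[of "{0<..}" t] 1 by (auto elim!: eventually_mono)
    ultimately show ?thesis
      using 1 DERIV_cong_ev[OF refl, of "\<lambda>t. \<bar>t\<bar> powr p" "\<lambda>t. t powr p" t] by (simp add: spow_def)
  next
    case 2
    have "((\<lambda>t. (- t) powr p) has_real_derivative - (p * (- t) powr (p - 1))) (at t)"
      using 2 by (auto intro!: derivative_eq_intros)
    moreover have "\<forall>\<^sub>F s in nhds t. \<bar>s\<bar> powr p = (- s) powr p"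
      using eventually_nhds_in_open[of "{..<0}" t] 2 by (auto elim!: eventually_mono)
    ultimately show ?thesis
      using 2 DERIV_cong_ev[OF refl, of "\<lambda>t. \<bar>t\<bar> powr p" "\<lambda>t. (- t) powr p" t] by (simp add: spow_def)
  next
    case 3
    have "(\<lambda>h::real. \<bar>h\<bar> powr (p - 1)) \<midarrow>0\<rightarrow> \<bar>0\<bar> powr (p - 1)"
      using assms by (intro tendsto_intros) (auto intro: always_eventually)
    then have "(\<lambda>h::real. \<bar>h\<bar> powr (p - 1)) \<midarrow>0\<rightarrow> 0"
      by simp
    moreover have "\<bar>\<bar>h\<bar> powr p / h\<bar> \<le> \<bar>h\<bar> powr (p - 1)" for h :: real
      by (cases "h = 0") (simp_all add: powr_diff)
    ultimately have "(\<lambda>h::real. \<bar>h\<bar> powr p / h) \<midarrow>0\<rightarrow> 0"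
      using Lim_null_comparison[of "\<lambda>h. \<bar>h\<bar> powr p / h" "\<lambda>h. \<bar>h\<bar> powr (p - 1)" "at (0::real)"]
      by (simp add: always_eventually)
    then show ?thesis
      using 3 by (simp add: DERIV_def spow_def)
  qed
qed

text \<open>A mean value bound; it supplies the dominating constants when the modular of
  \<open>lp\<close> is differentiated term by term.\<close>

lemma abs_powr_lipschitz:
  fixes a b r :: real
  assumes "1 < p" "\<bar>a\<bar> \<le> r" "\<bar>b\<bar> \<le> r"
  shows "\<bar>\<bar>a\<bar> powr p - \<bar>b\<bar> powr p\<bar> \<le> p * r powr (p - 1) * \<bar>a - b\<bar>"
proof -
  have "norm (\<bar>a\<bar> powr p - \<bar>b\<bar> powr p) \<le> p * r powr (p - 1) * norm (a - b)"
  proof (rule field_differentiable_bound[where S = "{-r..r}" and f' = "\<lambda>t. p * spow p t"])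
    show "((\<lambda>t. \<bar>t\<bar> powr p) has_field_derivative p * spow p t) (at t within {-r..r})" for t
      using has_real_derivative_abs_powr[OF assms(1)] by (rule has_field_derivative_at_within)
    show "norm (p * spow p t) \<le> p * r powr (p - 1)" if "t \<in> {-r..r}" for t
    proof -
      have "\<bar>t\<bar> powr (p - 1) \<le> r powr (p - 1)"
        using that assms(1) by (intro powr_mono2) auto
      then show ?thesis
        using assms(1) by (cases "t = 0") (auto simp: spow_def abs_mult abs_sgn_eq)
    qed
  qed (use assms in auto)
  then show ?thesis by simp
qed

text \<open>The concave function t powr (p - 1) lies below its tangent at \<open>a\<close>.
  Concavity enters as the weighted arithmetic-geometric mean inequality with weights p - 1 and 2 -
  p.\<close>

lemma spow_diff_nonneg_aux:
  assumes "1 < p" "p < 2" "0 \<le> b" "b < a"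
  shows "(p - 1) * (a - b) * a powr (p - 2) \<le> spow p a - spow p b"
proof (cases "b = 0")
  case True
  have "a * a powr (p - 2) = a powr (p - 1)"
    using assms by (simp add: powr_mult_base)
  moreover have "(p - 1) * (a * a powr (p - 2)) \<le> 1 * (a * a powr (p - 2))"
    using assms by (intro mult_right_mono) auto
  ultimately show ?thesis
    using True assms by (simp add: spow_def mult.assoc)
next
  case False
  have "b powr (p - 1) * a powr (2 - p) \<le> (p - 1) * b + (2 - p) * a"
    using Youngs_inequality_0[of "p - 1" "2 - p" b a] assms False by simp
  then have "b powr (p - 1) * a powr (2 - p) * a powr (p - 2)
      \<le> ((p - 1) * b + (2 - p) * a) * a powr (p - 2)"
    by (intro mult_right_mono) auto
  moreover have "a powr (2 - p) * a powr (p - 2) = 1"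
    using assms by (simp flip: powr_add)
  moreover have "a * a powr (p - 2) = a powr (p - 1)"
    using assms by (simp add: powr_mult_base)
  ultimately have "b powr (p - 1) \<le> a powr (p - 1) - (p - 1) * (a - b) * a powr (p - 2)"
    by (simp add: algebra_simps mult.assoc)
  then show ?thesis
    using False assms by (simp add: spow_def)
qed

text \<open>Both sides are invariant under swapping \<open>a\<close> and \<open>b\<close> and under
  negating both, so \<open>a\<close> may be taken positive and of larger modulus. For equal signs
  the tangent bound applies; for opposite signs |a| + |b| equals a - b and each of the two summands
  is estimated separately.\<close>

lemma spow_monotone_lower_bound:
  assumes p: "1 < p" "p < 2" and "a \<noteq> b"
  shows "(p - 1) * (a - b)\<^sup>2 * (\<bar>a\<bar> + \<bar>b\<bar>) powr (p - 2) \<le> (spow p a - spow p b) * (a - b)"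
proof -
  have main: "(p - 1) * (a - b)\<^sup>2 * (\<bar>a\<bar> + \<bar>b\<bar>) powr (p - 2) \<le> (spow p a - spow p b) * (a - b)"
    if ab: "b < a" "\<bar>b\<bar> \<le> a" for a b :: real
  proof (cases "0 \<le> b")
    case True
    have "(a + b) powr (p - 2) \<le> a powr (p - 2)"
      using ab True p by (intro powr_mono2') auto
    then have "(p - 1) * (a - b) * (a + b) powr (p - 2) \<le> (p - 1) * (a - b) * a powr (p - 2)"
      using ab p by (intro mult_left_mono) auto
    also have "\<dots> \<le> spow p a - spow p b"
      using spow_diff_nonneg_aux[OF p True ab(1)] .
    finally have "(p - 1) * (a - b) * (a + b) powr (p - 2) * (a - b) \<le> (spow p a - spow p b) * (a - b)"
      using ab by (intro mult_right_mono) auto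
    then show ?thesis
      using True ab by (simp add: power2_eq_square ac_simps)
  next
    case False
    define s where "s = a - b"
    have s: "0 < s" "\<bar>a\<bar> + \<bar>b\<bar> = s" "a \<le> s" "- b \<le> s" "0 < a" "0 < - b"
      using False ab by (auto simp: s_def)
    \<comment> \<open>To be used for \<open>a\<close> and for \<open>- b\<close>, whose sum is
      \<open>s\<close>. As p - 2 < 0, enlarging the base to \<open>s\<close> lowers the
      power.\<close>
    have ge: "t * s powr (p - 2) \<le> t powr (p - 1)" if "0 < t" "t \<le> s" for t
    proof -
      have "s powr (p - 2) \<le> t powr (p - 2)"
        using that p by (intro powr_mono2') auto
      then have "t * s powr (p - 2) \<le> t * t powr (p - 2)"
        using that by (intro mult_left_mono) auto
      then show ?thesis
        using that by (simp add: powr_mult_base)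
    qed
    have "s * s powr (p - 2) = a * s powr (p - 2) + (- b) * s powr (p - 2)"
      by (simp add: s_def algebra_simps)
    also have "\<dots> \<le> spow p a - spow p b"
      using ge[of a] ge[of "- b"] s by (simp add: spow_def)
    finally have "s * s powr (p - 2) * s \<le> (spow p a - spow p b) * s"
      using s by (intro mult_right_mono) auto
    moreover have "(p - 1) * (s * s powr (p - 2) * s) \<le> 1 * (s * s powr (p - 2) * s)"
      using s p by (intro mult_right_mono) auto
    ultimately have "(p - 1) * (s * s powr (p - 2) * s) \<le> (spow p a - spow p b) * s"
      by linarith
    then show ?thesis
      unfolding s(2) s_def[symmetric] by (simp only: power2_eq_square ac_simps)
  qed
  consider "b < a" "\<bar>b\<bar> \<le> a" | "a < b" "\<bar>a\<bar> \<le> b" | "- a < - b" "\<bar>a\<bar> \<le> - b" | "- b < - a" "\<bar>b\<bar> \<le> - a"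
    using \<open>a \<noteq> b\<close> by linarith
  then show ?thesis
  proof cases
    case 1 then show ?thesis by (rule main)
  next
    case 2 from main[OF this] show ?thesis by (simp add: algebra_simps power2_eq_square)
  next
    case 3 then have "- a < - b" "\<bar>- a\<bar> \<le> - b" by auto
    from main[OF this] show ?thesis by (simp add: spow_minus algebra_simps power2_eq_square)
  next
    case 4 then have "- b < - a" "\<bar>- b\<bar> \<le> - a" by auto
    from main[OF this] show ?thesis by (simp add: spow_minus algebra_simps power2_eq_square)
  qed
qed

text \<open>The free parameter \<open>\<theta>\<close> replaces the Hoelder argument by which \<open>p\<close>-convexity of the norm is
  usually deduced from the pointwise bound.\<close>

lemma abs_diff_powr_le_spow:
  assumes p: "1 < p" "p < 2" and \<theta>: "0 < \<theta>" "\<theta> \<le> 1"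
  shows "\<bar>a - b\<bar> powr p
     \<le> 4 powr (2 - p) / (p - 1) * \<theta> powr (p - 2) * ((spow p a - spow p b) * (a - b))
        + \<theta> powr p * \<bar>b\<bar> powr p"
proof (cases "a = b")
  case True
  then show ?thesis by simp
next
  case False
  define d s where "d = \<bar>a - b\<bar>" and "s = \<bar>a\<bar> + \<bar>b\<bar>"
  have d: "0 < d" and s: "0 < s"
    using False by (auto simp: d_def s_def)
  have x: "(p - 1) * d\<^sup>2 * s powr (p - 2) \<le> (spow p a - spow p b) * (a - b)"
    using spow_monotone_lower_bound[OF p False] by (simp add: d_def s_def)
  have x0: "0 \<le> (spow p a - spow p b) * (a - b)"
    using x p by (meson order.trans mult_nonneg_nonneg diff_ge_0_iff_ge less_imp_le powr_ge_zero zero_le_power2)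
  show ?thesis
  \<comment> \<open>If s \<le> 4 d / \<theta>, the quadratic lower bound turns into a multiple of
    d^p. Otherwise 4 d < \<theta> s \<le> d + 2 \<theta> |b|, hence d \<le> \<theta> |b|, and the
    residual term alone suffices.\<close>
  proof (cases "\<theta> * s \<le> 4 * d")
    case True
    have "(4 * d / \<theta>) powr (p - 2) \<le> s powr (p - 2)"
      using True \<theta> p s by (intro powr_mono2') (auto simp: field_simps)
    then have "(p - 1) * d\<^sup>2 * (4 * d / \<theta>) powr (p - 2) \<le> (spow p a - spow p b) * (a - b)"
      using x p by (smt (verit) mult_left_mono mult_nonneg_nonneg zero_le_power2)
    moreover have "(4 * d / \<theta>) powr (p - 2) = d powr (p - 2) / (4 powr (2 - p) * \<theta> powr (p - 2))"
    proof -
      have "4 powr (p - 2) = 1 / (4::real) powr (2 - p)"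
        using powr_minus_divide[of 4 "2 - p"] by simp
      then show ?thesis
        using \<theta> d by (simp add: powr_divide powr_mult)
    qed
    moreover have "d\<^sup>2 * d powr (p - 2) = d powr p"
      using d by (simp flip: powr_add powr_numeral)
    ultimately have "d powr p * (p - 1) / (4 powr (2 - p) * \<theta> powr (p - 2)) \<le> (spow p a - spow p b) * (a - b)"
      by (simp add: ac_simps)
    then have "d powr p \<le> 4 powr (2 - p) / (p - 1) * \<theta> powr (p - 2) * ((spow p a - spow p b) * (a - b))"
      using p \<theta> by (simp add: field_simps)
    then show ?thesis
      unfolding d_def[symmetric] by (smt (verit) mult_nonneg_nonneg powr_ge_zero)
  next
    case False
    have "s \<le> d + 2 * \<bar>b\<bar>"
      by (auto simp: s_def d_def)
    then have "\<theta> * s \<le> \<theta> * d + 2 * (\<theta> * \<bar>b\<bar>)"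
      using \<theta> by (metis distrib_left less_imp_le mult.left_commute mult_left_mono)
    moreover have "\<theta> * d \<le> 1 * d"
      using \<theta> d by (intro mult_right_mono) auto
    moreover have "0 \<le> \<theta> * \<bar>b\<bar>"
      using \<theta> by simp
    ultimately have "d \<le> \<theta> * \<bar>b\<bar>"
      using False by linarith
    then have "d powr p \<le> (\<theta> * \<bar>b\<bar>) powr p"
      using d p by (intro powr_mono2) auto
    then show ?thesis
      using x0 \<theta> p unfolding d_def[symmetric]
      by (simp add: powr_mult add_increasing)
  qed
qed

lemma powr_add_le:
  fixes a b :: real
  assumes "0 \<le> a" "0 \<le> b" "0 \<le> r"
  shows "(a + b) powr r \<le> 2 powr r * (a powr r + b powr r)"
proof -
  have "(a + b) powr r \<le> (2 * max a b) powr r"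
    using assms by (intro powr_mono2) auto
  also have "\<dots> = 2 powr r * max a b powr r"
    using assms by (simp add: powr_mult)
  also have "\<dots> \<le> 2 powr r * (a powr r + b powr r)"
    by (intro mult_left_mono) (auto simp: max_def)
  finally show ?thesis .
qed

section \<open>Weighted sequence spaces\<close>

lemma lp_add:
  assumes "0 \<le> p" "c \<in> lp p mw" "d \<in> lp p mw"
  shows "(\<lambda>j. c j + d j) \<in> lp p mw"
proof -
  have "summable (\<lambda>j. 2 powr p * (mw j powr p * \<bar>c j\<bar> powr p + mw j powr p * \<bar>d j\<bar> powr p))"
    using assms by (auto simp: lp_def intro!: summable_mult summable_add)
  then show ?thesis
    unfolding lp_def mem_Collect_eq
  proof (rule summable_comparison_test'[where N = 0])
    fix j
    have "\<bar>c j + d j\<bar> powr p \<le> (\<bar>c j\<bar> + \<bar>d j\<bar>) powr p"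
      using assms by (intro powr_mono2) auto
    also have "\<dots> \<le> 2 powr p * (\<bar>c j\<bar> powr p + \<bar>d j\<bar> powr p)"
      using assms by (intro powr_add_le) auto
    finally have "mw j powr p * \<bar>c j + d j\<bar> powr p \<le> mw j powr p * \<dots>"
      by (intro mult_left_mono) auto
    then show "norm (mw j powr p * \<bar>c j + d j\<bar> powr p)
        \<le> 2 powr p * (mw j powr p * \<bar>c j\<bar> powr p + mw j powr p * \<bar>d j\<bar> powr p)"
      by (simp add: algebra_simps)
  qed
qed

lemma lp_scale:
  assumes "c \<in> lp p mw"
  shows "(\<lambda>j. r * c j) \<in> lp p mw"
  using assms summable_mult[of "\<lambda>j. mw j powr p * \<bar>c j\<bar> powr p" "\<bar>r\<bar> powr p"]
  by (simp add: lp_def abs_mult powr_mult ac_simps)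

lemma lp_diff:
  assumes "0 \<le> p" "c \<in> lp p mw" "d \<in> lp p mw"
  shows "(\<lambda>j. c j - d j) \<in> lp p mw"
  using lp_add[OF assms(1,2) lp_scale[OF assms(3), of "-1"]] by simp

lemma lp_abs:
  assumes "c \<in> lp p mw"
  shows "(\<lambda>j. \<bar>c j\<bar>) \<in> lp p mw"
  using assms by (simp add: lp_def)

lemma finite_support_in_lp:
  assumes "finite {j. c j \<noteq> 0}"
  shows "c \<in> lp p mw"
  unfolding lp_def mem_Collect_eq by (rule summable_finite[OF assms]) auto

lemma unit_seq_in_lp: "unit_seq j \<in> lp p mw"
  by (rule finite_support_in_lp) (auto simp: unit_seq_def intro: finite_subset[of _ "{j}"])

lemma lp_norm_nonneg: "0 \<le> lp_norm p mw c"
  by (simp add: lp_norm_def)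

lemma lp_norm_powr:
  assumes "0 < p" "c \<in> lp p mw"
  shows "lp_norm p mw c powr p = (\<Sum>j. mw j powr p * \<bar>c j\<bar> powr p)"
  using assms by (simp add: lp_norm_def lp_def powr_powr suminf_nonneg)

lemma lp_norm_tail_tendsto_0:
  assumes "0 < p" "c \<in> lp p mw"
  shows "(\<lambda>n. lp_norm p mw (\<lambda>j. if j < n then 0 else c j)) \<longlonglongrightarrow> 0"
proof -
  let ?g = "\<lambda>j. mw j powr p * \<bar>c j\<bar> powr p"
  have s: "summable ?g" using assms by (simp add: lp_def)
  have eq: "(\<Sum>j. mw j powr p * \<bar>if j < n then 0 else c j\<bar> powr p) = suminf ?g - sum ?g {..<n}" for n
  proof -
    have "(\<lambda>j. if j \<in> {..<n} then ?g j else 0) sums sum ?g {..<n}"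
      by (rule sums_If_finite_set) auto
    then have "(\<lambda>j. ?g j - (if j \<in> {..<n} then ?g j else 0)) sums (suminf ?g - sum ?g {..<n})"
      by (intro sums_diff summable_sums s)
    moreover have "(\<lambda>j. ?g j - (if j \<in> {..<n} then ?g j else 0))
        = (\<lambda>j. mw j powr p * \<bar>if j < n then 0 else c j\<bar> powr p)"
      using assms by auto
    ultimately show ?thesis
      by (simp add: sums_iff)
  qed
  have "(\<lambda>n. (suminf ?g - sum ?g {..<n}) powr (1 / p)) \<longlonglongrightarrow> (suminf ?g - suminf ?g) powr (1 / p)"
    using assms sum_le_suminf[OF s]
    by (intro tendsto_powr' tendsto_intros summable_LIMSEQ s) (auto intro!: always_eventually)
  then show ?thesis
    by (simp add: lp_norm_def eq)
qed

text \<open>The difference between L c and the n-th partial sum is L applied to the tail of c, whose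
  norm tends to 0. This makes the expansion over unit sequences valid for any bounded functional,
  and it is what later replaces a random argument by fixed ones.\<close>

lemma lp_linear_functional_sums:
  assumes p: "0 < p"
    and add: "\<And>c d. c \<in> lp p mw \<Longrightarrow> d \<in> lp p mw \<Longrightarrow> L (\<lambda>j. c j + d j) = L c + L d"
    and scale: "\<And>r c. c \<in> lp p mw \<Longrightarrow> L (\<lambda>j. r * c j) = r * L c"
    and bound: "\<And>c. c \<in> lp p mw \<Longrightarrow> \<bar>L c\<bar> \<le> K * lp_norm p mw c"
    and c: "c \<in> lp p mw"
  shows "(\<lambda>j. c j * L (unit_seq j)) sums L c"
proof -
  have trunc: "(\<lambda>j. if j < n then c j else 0) \<in> lp p mw" for n
    by (rule finite_support_in_lp) (auto intro: finite_subset[of _ "{..<n}"])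
  have tail: "(\<lambda>j. if j < n then 0 else c j) \<in> lp p mw" for n
  proof -
    have "(\<lambda>j. if j < n then 0 else c j) = (\<lambda>j. c j - (if j < n then c j else 0))"
      by auto
    then show ?thesis
      using lp_diff[OF _ c trunc, of n] p by simp
  qed
  have zero: "L (\<lambda>_. 0) = 0"
    using scale[OF c, of 0] by simp
  have "L (\<lambda>j. if j < n then c j else 0) = (\<Sum>j<n. c j * L (unit_seq j))" for n
  proof (induction n)
    case (Suc n)
    have "L (\<lambda>j. (if j < n then c j else 0) + c n * unit_seq n j)
        = L (\<lambda>j. if j < n then c j else 0) + c n * L (unit_seq n)"
      using add[OF trunc lp_scale[OF unit_seq_in_lp]] scale[OF unit_seq_in_lp] by simp
    moreover have "(\<lambda>j. (if j < n then c j else 0) + c n * unit_seq n j) = (\<lambda>j. if j < Suc n then c j else 0)"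
      by (auto simp: unit_seq_def less_Suc_eq)
    ultimately show ?case
      using Suc by simp
  qed (simp add: zero)
  moreover have "L c = L (\<lambda>j. if j < n then c j else 0) + L (\<lambda>j. if j < n then 0 else c j)" for n
  proof -
    have "c = (\<lambda>j. (if j < n then c j else 0) + (if j < n then 0 else c j))"
      by auto
    then show ?thesis
      using add[OF trunc[of n] tail[of n]] by simp
  qed
  ultimately have eq: "L c - (\<Sum>j<n. c j * L (unit_seq j)) = L (\<lambda>j. if j < n then 0 else c j)" for n
    by (metis add_diff_cancel_left')
  have "(\<lambda>n. L c - (\<Sum>j<n. c j * L (unit_seq j))) \<longlonglongrightarrow> 0"
  proof (rule Lim_null_comparison)
    show "\<forall>\<^sub>F n in sequentially. norm (L c - (\<Sum>j<n. c j * L (unit_seq j)))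
        \<le> K * lp_norm p mw (\<lambda>j. if j < n then 0 else c j)"
      unfolding eq using bound[OF tail] by auto
    show "(\<lambda>n. K * lp_norm p mw (\<lambda>j. if j < n then 0 else c j)) \<longlonglongrightarrow> 0"
      using tendsto_mult_right_zero[OF lp_norm_tail_tendsto_0[OF p c]] by simp
  qed
  then have "(\<lambda>n. L c - (L c - (\<Sum>j<n. c j * L (unit_seq j)))) \<longlonglongrightarrow> L c - 0"
    by (intro tendsto_diff tendsto_const)
  then show ?thesis
    by (simp add: sums_def)
qed

text \<open>Hoelder's inequality is bypassed: both terms are dominated by (|c| + |d|)^p, which is
  summable because \<open>lp\<close> is closed under sums. The first series also serves as the
  dominating series for differentiation.\<close>

lemma summable_weighted_spow:
  assumes p: "1 < p" and c: "c \<in> lp p mw" and d: "d \<in> lp p mw"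
  shows "summable (\<lambda>j. mw j powr p * ((\<bar>c j\<bar> + \<bar>d j\<bar>) powr (p - 1) * \<bar>d j\<bar>))"
    and "summable (\<lambda>j. mw j powr p * (spow p (c j) * d j))"
proof -
  have "(\<lambda>j. \<bar>c j\<bar> + \<bar>d j\<bar>) \<in> lp p mw"
    using p by (intro lp_add lp_abs c d) auto
  then have s: "summable (\<lambda>j. mw j powr p * (\<bar>c j\<bar> + \<bar>d j\<bar>) powr p)"
    by (simp add: lp_def)
  have le: "(\<bar>c j\<bar> + \<bar>d j\<bar>) powr (p - 1) * \<bar>d j\<bar> \<le> (\<bar>c j\<bar> + \<bar>d j\<bar>) powr p" for j
  proof -
    have "(\<bar>c j\<bar> + \<bar>d j\<bar>) powr (p - 1) * \<bar>d j\<bar> \<le> (\<bar>c j\<bar> + \<bar>d j\<bar>) powr (p - 1) * (\<bar>c j\<bar> + \<bar>d j\<bar>)"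
      by (intro mult_left_mono) auto
    also have "\<dots> = (\<bar>c j\<bar> + \<bar>d j\<bar>) powr p"
      using powr_mult_base[of "\<bar>c j\<bar> + \<bar>d j\<bar>" "p - 1"] by (simp add: mult.commute)
    finally show ?thesis .
  qed
  show s1: "summable (\<lambda>j. mw j powr p * ((\<bar>c j\<bar> + \<bar>d j\<bar>) powr (p - 1) * \<bar>d j\<bar>))"
    by (rule summable_comparison_test'[OF s, of 0]) (auto intro!: mult_left_mono le simp: abs_mult)
  show "summable (\<lambda>j. mw j powr p * (spow p (c j) * d j))"
  proof (rule summable_comparison_test'[OF s1, of 0])
    fix j
    have "\<bar>spow p (c j)\<bar> \<le> (\<bar>c j\<bar> + \<bar>d j\<bar>) powr (p - 1)"
      using p by (cases "c j = 0") (auto simp: spow_def abs_mult abs_sgn_eq intro!: powr_mono2)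
    then show "norm (mw j powr p * (spow p (c j) * d j))
        \<le> mw j powr p * ((\<bar>c j\<bar> + \<bar>d j\<bar>) powr (p - 1) * \<bar>d j\<bar>)"
      by (auto simp: abs_mult intro!: mult_left_mono mult_right_mono)
  qed
qed

text \<open>For t in (-1, 1) the modulus |c j + t d j| stays below |c j| + |d j|, so the j-th term
  has a Lipschitz constant independent of t, and these constants are summable. That justifies
  differentiation under the sum.\<close>

lemma has_real_derivative_lp_modular:
  assumes p: "1 < p" and c: "c \<in> lp p mw" and d: "d \<in> lp p mw"
  shows "((\<lambda>\<tau>. \<Sum>j. mw j powr p * \<bar>c j + \<tau> * d j\<bar> powr p) has_real_derivative
           p * (\<Sum>j. mw j powr p * (spow p (c j) * d j))) (at 0)"
proof -
  have "((\<lambda>\<tau>. \<Sum>j. mw j powr p * \<bar>c j + \<tau> * d j\<bar> powr p) has_real_derivative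
           (\<Sum>j. mw j powr p * (p * spow p (c j + 0 * d j) * d j))) (at 0)"
  proof (rule DERIV_series'[where a = "-1" and b = 1 and L = "\<lambda>j. p * (mw j powr p * ((\<bar>c j\<bar> + \<bar>d j\<bar>) powr (p - 1) * \<bar>d j\<bar>))"
        and f = "\<lambda>\<tau> j. mw j powr p * \<bar>c j + \<tau> * d j\<bar> powr p" and f' = "\<lambda>\<tau> j. mw j powr p * (p * spow p (c j + \<tau> * d j) * d j)"])
    show "((\<lambda>\<tau>. mw j powr p * \<bar>c j + \<tau> * d j\<bar> powr p) has_real_derivative
        mw j powr p * (p * spow p (c j + 0 * d j) * d j)) (at 0)" for j
    proof -
      have "((\<lambda>\<tau>. c j + \<tau> * d j) has_real_derivative d j) (at 0)"
        by (auto intro!: derivative_eq_intros)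
      from DERIV_chain2[OF has_real_derivative_abs_powr[OF p] this] show ?thesis
        by (intro DERIV_cmult)
    qed
    show "summable (\<lambda>j. mw j powr p * \<bar>c j + \<tau> * d j\<bar> powr p)" for \<tau>
      using lp_add[OF _ c lp_scale[OF d, of \<tau>]] p by (simp add: lp_def)
    show "summable (\<lambda>j. mw j powr p * (p * spow p (c j + 0 * d j) * d j))"
      using summable_mult[OF summable_weighted_spow(2)[OF p c d], of p] by (simp add: ac_simps)
    show "summable (\<lambda>j. p * (mw j powr p * ((\<bar>c j\<bar> + \<bar>d j\<bar>) powr (p - 1) * \<bar>d j\<bar>)))"
      by (intro summable_mult summable_weighted_spow[OF p c d])
    fix j and x y :: real
    assume xy: "x \<in> {-1<..<1}" "y \<in> {-1<..<1}"
    have le: "\<bar>c j + t * d j\<bar> \<le> \<bar>c j\<bar> + \<bar>d j\<bar>" if "t \<in> {-1<..<1}" for t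
    proof -
      have "\<bar>t\<bar> * \<bar>d j\<bar> \<le> 1 * \<bar>d j\<bar>"
        using that by (intro mult_right_mono) auto
      then show ?thesis
        using abs_triangle_ineq[of "c j" "t * d j"] by (simp add: abs_mult)
    qed
    have "\<bar>\<bar>c j + x * d j\<bar> powr p - \<bar>c j + y * d j\<bar> powr p\<bar>
        \<le> p * (\<bar>c j\<bar> + \<bar>d j\<bar>) powr (p - 1) * \<bar>(c j + x * d j) - (c j + y * d j)\<bar>"
      by (intro abs_powr_lipschitz p le xy)
    also have "\<bar>(c j + x * d j) - (c j + y * d j)\<bar> = \<bar>d j\<bar> * \<bar>x - y\<bar>"
      by (simp flip: abs_mult) (simp add: algebra_simps)
    finally have "mw j powr p * \<bar>\<bar>c j + x * d j\<bar> powr p - \<bar>c j + y * d j\<bar> powr p\<bar>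
        \<le> mw j powr p * (p * (\<bar>c j\<bar> + \<bar>d j\<bar>) powr (p - 1) * (\<bar>d j\<bar> * \<bar>x - y\<bar>))"
      by (intro mult_left_mono) auto
    moreover have "\<bar>mw j powr p * \<bar>c j + x * d j\<bar> powr p - mw j powr p * \<bar>c j + y * d j\<bar> powr p\<bar>
        = mw j powr p * \<bar>\<bar>c j + x * d j\<bar> powr p - \<bar>c j + y * d j\<bar> powr p\<bar>"
      by (simp only: right_diff_distrib[symmetric] abs_mult) simp
    ultimately show "\<bar>mw j powr p * \<bar>c j + x * d j\<bar> powr p - mw j powr p * \<bar>c j + y * d j\<bar> powr p\<bar>
        \<le> p * (mw j powr p * ((\<bar>c j\<bar> + \<bar>d j\<bar>) powr (p - 1) * \<bar>d j\<bar>)) * \<bar>x - y\<bar>"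
      by (simp add: ac_simps)
  qed auto
  moreover have "(\<Sum>j. mw j powr p * (p * spow p (c j + 0 * d j) * d j))
      = p * (\<Sum>j. mw j powr p * (spow p (c j) * d j))"
    by (subst suminf_mult[OF summable_weighted_spow(2)[OF p c d], symmetric]) (simp add: ac_simps)
  ultimately show ?thesis
    by simp
qed

lemma summable_spow_bregman:
  assumes p: "1 < p" and c: "c \<in> lp p mw" and d: "d \<in> lp p mw"
  shows "summable (\<lambda>j. mw j powr p * ((spow p (c j) - spow p (d j)) * (c j - d j)))"
proof -
  have "(\<lambda>j. c j - d j) \<in> lp p mw"
    using p c d by (intro lp_diff) auto
  then show ?thesis
    using summable_diff[OF summable_weighted_spow(2)[OF p c, of "\<lambda>j. c j - d j"]
        summable_weighted_spow(2)[OF p d, of "\<lambda>j. c j - d j"]]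
    by (simp flip: right_diff_distrib left_diff_distrib)
qed

text \<open>Coordinatewise absorption: Young's inequality splits the product, and
  \<open>abs_diff_powr_le_spow\<close> converts |a - b|^p into half of the Bregman summand plus a
  residual in \<open>b\<close> only.\<close>

lemma weighted_young_spow:
  assumes p: "1 < p" "p < 2" and q: "1 / p + 1 / q = 1" and w: "0 < w"
    and \<theta>: "0 < \<theta>" "\<theta> \<le> 1" and K_def: "K = 4 powr (2 - p) / (p - 1)"
  shows "\<bar>(a - b) * k\<bar> \<le> 1 / 2 * (w powr p * ((spow p a - spow p b) * (a - b)))
     + \<theta>\<^sup>2 / 2 * (w powr p * \<bar>b\<bar> powr p)
     + (2 * K) powr (q / p) * \<theta> powr (2 - q) * (w powr (- q) * \<bar>k\<bar> powr q)"
proof -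
  have "q \<noteq> 0"
    using p q by auto
  then have q_eq: "q = p / (p - 1)"
    using p q by (simp add: field_simps)
  have q1: "1 < q"
    using p by (simp add: q_eq field_simps)
  have K: "1 \<le> K"
  proof -
    have "1 * 1 \<le> (4::real) powr (2 - p)"
      using p by (simp add: ge_one_powr_ge_zero)
    then show ?thesis
      using p by (simp add: K_def field_simps)
  qed
  \<comment> \<open>The split parameter of Young's inequality, chosen to make l^p K \<theta>^(p - 2)
    = 1/2, so that precisely half of the Bregman summand is spent.\<close>
  define l where "l = (\<theta> powr (2 - p) / (2 * K)) powr (1 / p)"
  have l: "0 < l"
    using \<theta> K by (simp add: l_def)
  have lp: "l powr p = \<theta> powr (2 - p) / (2 * K)"
    using p \<theta> K by (simp add: l_def powr_powr)
  have lq: "l powr (- q) = (2 * K) powr (q / p) * \<theta> powr (2 - q)"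
  proof -
    have "l powr (- q) = (\<theta> powr (2 - p) / (2 * K)) powr (- (q / p))"
      by (simp add: l_def powr_powr)
    also have "\<dots> = \<theta> powr (- ((2 - p) * (q / p))) * (2 * K) powr (q / p)"
      using \<theta> K by (simp add: powr_divide powr_powr powr_minus field_simps)
    \<comment> \<open>By conjugacy q / p = 1 / (p - 1), hence (2 - p) q / p = q - 2.\<close>
    also have "- ((2 - p) * (q / p)) = 2 - q"
      using p by (simp add: q_eq field_simps)
    finally show ?thesis
      by (simp add: mult.commute)
  qed
  define x where "x = (spow p a - spow p b) * (a - b)"
  have "\<bar>(a - b) * k\<bar> = (l * (w * \<bar>a - b\<bar>)) * (\<bar>k\<bar> / w / l)"
    using l w by (simp add: abs_mult)
  also have "\<dots> \<le> (l * (w * \<bar>a - b\<bar>)) powr p / p + (\<bar>k\<bar> / w / l) powr q / q"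
    using p q q1 l w by (intro Youngs_inequality) auto
  \<comment> \<open>The factors 1/p and 1/q of Young's inequality are simply replaced by 1.\<close>
  also have "\<dots> \<le> (l * (w * \<bar>a - b\<bar>)) powr p / 1 + (\<bar>k\<bar> / w / l) powr q / 1"
    using p q1 by (intro add_mono divide_left_mono) auto
  also have "(\<bar>k\<bar> / w / l) powr q / 1 = l powr (- q) * (w powr (- q) * \<bar>k\<bar> powr q)"
    using l w by (simp add: powr_divide powr_mult powr_minus field_simps)
  also have "(l * (w * \<bar>a - b\<bar>)) powr p / 1 = w powr p * (l powr p * \<bar>a - b\<bar> powr p)"
    using l w by (simp add: powr_mult ac_simps)
  finally have young: "\<bar>(a - b) * k\<bar> \<le> w powr p * (l powr p * \<bar>a - b\<bar> powr p)
      + l powr (- q) * (w powr (- q) * \<bar>k\<bar> powr q)" .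
  have "l powr p * \<bar>a - b\<bar> powr p \<le> x / 2 + \<theta>\<^sup>2 / 2 * \<bar>b\<bar> powr p"
  proof -
    have "l powr p * \<bar>a - b\<bar> powr p
        \<le> l powr p * (K * \<theta> powr (p - 2) * x + \<theta> powr p * \<bar>b\<bar> powr p)"
      unfolding x_def K_def by (intro mult_left_mono abs_diff_powr_le_spow p \<theta>) auto
    also have "\<dots> = (\<theta> powr (2 - p) * \<theta> powr (p - 2)) * x / 2 + (\<theta> powr (2 - p) * \<theta> powr p) / (2 * K) * \<bar>b\<bar> powr p"
      using K by (simp add: lp field_simps)
    also have "\<theta> powr (2 - p) * \<theta> powr (p - 2) = 1"
      using \<theta> by (simp flip: powr_add)
    also have "\<theta> powr (2 - p) * \<theta> powr p = \<theta>\<^sup>2"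
      using \<theta> by (simp flip: powr_add powr_numeral)
    also have "\<theta>\<^sup>2 / (2 * K) \<le> \<theta>\<^sup>2 / 2"
      using K by (intro divide_left_mono) auto
    finally show ?thesis
      by (simp add: mult_right_mono)
  qed
  then have "w powr p * (l powr p * \<bar>a - b\<bar> powr p)
      \<le> w powr p * (x / 2 + \<theta>\<^sup>2 / 2 * \<bar>b\<bar> powr p)"
    by (intro mult_left_mono) auto
  also have "\<dots> = 1 / 2 * (w powr p * x) + \<theta>\<^sup>2 / 2 * (w powr p * \<bar>b\<bar> powr p)"
    by (simp add: algebra_simps)
  finally show ?thesis
    using young unfolding lq x_def by linarith
qed

text \<open>Summation of the coordinate inequalities bounds T by D / 2 plus remainders. The series
  for D converges, so D / 2 can be moved to the left; doubling produces the factors 2.\<close>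

lemma bregman_young_bound:
  assumes p: "1 < p" "p < 2" and q: "1 / p + 1 / q = 1" and mw: "\<And>j. 0 < mw j"
    and c: "c \<in> lp p mw" and b: "b \<in> lp p mw"
    and \<theta>: "0 < \<theta>" "\<theta> \<le> 1" and K_def: "K = 4 powr (2 - p) / (p - 1)"
    and k: "summable (\<lambda>j. mw j powr (- q) * \<bar>k j\<bar> powr q)"
    and T: "(\<lambda>j. (c j - b j) * k j) sums T"
    and D_def: "D = (\<Sum>j. mw j powr p * ((spow p (c j) - spow p (b j)) * (c j - b j)))"
    and le: "D \<le> T + E"
  shows "D \<le> \<theta>\<^sup>2 * (\<Sum>j. mw j powr p * \<bar>b j\<bar> powr p)
     + 2 * (2 * K) powr (q / p) * \<theta> powr (2 - q) * (\<Sum>j. mw j powr (- q) * \<bar>k j\<bar> powr q) + 2 * E"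
proof -
  have s: "(\<lambda>j. 1 / 2 * (mw j powr p * ((spow p (c j) - spow p (b j)) * (c j - b j)))
     + \<theta>\<^sup>2 / 2 * (mw j powr p * \<bar>b j\<bar> powr p)
     + (2 * K) powr (q / p) * \<theta> powr (2 - q) * (mw j powr (- q) * \<bar>k j\<bar> powr q))
     sums (1 / 2 * D + \<theta>\<^sup>2 / 2 * (\<Sum>j. mw j powr p * \<bar>b j\<bar> powr p)
     + (2 * K) powr (q / p) * \<theta> powr (2 - q) * (\<Sum>j. mw j powr (- q) * \<bar>k j\<bar> powr q))"
    unfolding D_def using b p
    by (intro sums_add sums_mult summable_sums summable_spow_bregman k c) (auto simp: lp_def)
  have "T \<le> 1 / 2 * D + \<theta>\<^sup>2 / 2 * (\<Sum>j. mw j powr p * \<bar>b j\<bar> powr p)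
     + (2 * K) powr (q / p) * \<theta> powr (2 - q) * (\<Sum>j. mw j powr (- q) * \<bar>k j\<bar> powr q)"
    by (rule sums_le[OF _ T s])
      (rule order.trans[OF abs_ge_self weighted_young_spow[OF p q mw \<theta> K_def]])
  then show ?thesis
    using le by linarith
qed

section \<open>The space \<open>X\<close> and the gradient of the regularizer\<close>

lemma fdiff_eq_fadd: "fdiff F G = fadd F (fscale (-1) G)"
  by (simp add: fdiff_def fadd_def fscale_def)

lemma shear_coeffs_simps:
  "shear_coeffs \<psi> \<Lambda> (fadd F G) = (\<lambda>j. shear_coeffs \<psi> \<Lambda> F j + shear_coeffs \<psi> \<Lambda> G j)"
  "shear_coeffs \<psi> \<Lambda> (fscale r F) = (\<lambda>j. r * shear_coeffs \<psi> \<Lambda> F j)"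
  "shear_coeffs \<psi> \<Lambda> (fdiff F G) = (\<lambda>j. shear_coeffs \<psi> \<Lambda> F j - shear_coeffs \<psi> \<Lambda> G j)"
  by (simp_all add: fun_eq_iff shear_coeffs_def shear_transform_def fadd_def fscale_def fdiff_def)

lemma H1_dual_fadd:
  assumes F: "F \<in> H1_dual \<psi> w" and G: "G \<in> H1_dual \<psi> w"
  shows "fadd F G \<in> H1_dual \<psi> w"
proof -
  obtain C where C: "\<forall>h\<in>H1 \<psi> w. \<bar>F h\<bar> \<le> C * H1_norm \<psi> w h"
    using F by (auto simp: H1_dual_def)
  obtain C' where C': "\<forall>h\<in>H1 \<psi> w. \<bar>G h\<bar> \<le> C' * H1_norm \<psi> w h"
    using G by (auto simp: H1_dual_def)
  have "\<bar>F h + G h\<bar> \<le> (C + C') * H1_norm \<psi> w h" if "h \<in> H1 \<psi> w" for h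
    using bspec[OF C that] bspec[OF C' that] by (simp add: distrib_right)
  then have "\<exists>C. \<forall>h\<in>H1 \<psi> w. \<bar>F h + G h\<bar> \<le> C * H1_norm \<psi> w h"
    by blast
  then show ?thesis
    using F G by (simp add: H1_dual_def fadd_def algebra_simps)
qed

lemma H1_dual_fscale:
  assumes F: "F \<in> H1_dual \<psi> w"
  shows "fscale r F \<in> H1_dual \<psi> w"
proof -
  obtain C where C: "\<forall>h\<in>H1 \<psi> w. \<bar>F h\<bar> \<le> C * H1_norm \<psi> w h"
    using F by (auto simp: H1_dual_def)
  have "\<bar>r * F h\<bar> \<le> (\<bar>r\<bar> * C) * H1_norm \<psi> w h" if "h \<in> H1 \<psi> w" for h
    using mult_left_mono[OF bspec[OF C that], of "\<bar>r\<bar>"] by (simp add: abs_mult mult.assoc)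
  then have "\<exists>C. \<forall>h\<in>H1 \<psi> w. \<bar>r * F h\<bar> \<le> C * H1_norm \<psi> w h"
    by blast
  then show ?thesis
    using F by (simp add: H1_dual_def fscale_def algebra_simps)
qed

text \<open>A point outside both supports has open neighbourhoods on which F and G vanish
  respectively; the sum vanishes on their intersection. This is needed for \<open>X_space\<close> to
  be closed under addition.\<close>

lemma fsupport_fadd_subset:
  "fsupport \<psi> w (fadd F G) \<subseteq> fsupport \<psi> w F \<union> fsupport \<psi> w G"
proof
  fix x
  assume x: "x \<in> fsupport \<psi> w (fadd F G)"
  show "x \<in> fsupport \<psi> w F \<union> fsupport \<psi> w G"
  proof (rule ccontr)
    assume "x \<notin> fsupport \<psi> w F \<union> fsupport \<psi> w G"
    then have "x \<notin> fsupport \<psi> w F" "x \<notin> fsupport \<psi> w G"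
      by auto
    then obtain V W where V: "open V" "vanishes_on \<psi> w F V" "x \<in> V"
      and W: "open W" "vanishes_on \<psi> w G W" "x \<in> W"
      unfolding fsupport_def by blast
    have "fadd F G h = 0"
      if "h \<in> H1 \<psi> w" "compact K" "K \<subseteq> V \<inter> W" "AE x in lborel. x \<notin> K \<longrightarrow> h x = 0" for h K
    proof -
      have "F h = 0" "G h = 0"
        using V(2) W(2) that unfolding vanishes_on_def by (meson le_inf_iff)+
      then show ?thesis
        by (simp add: fadd_def)
    qed
    then have "vanishes_on \<psi> w (fadd F G) (V \<inter> W)"
      unfolding vanishes_on_def by blast
    then show False
      using x V W unfolding fsupport_def by blast
  qed
qed

lemma fsupport_fscale_subset: "fsupport \<psi> w (fscale r F) \<subseteq> fsupport \<psi> w F"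
proof -
  have "vanishes_on \<psi> w (fscale r F) W" if "vanishes_on \<psi> w F W" for W
    using that by (simp add: vanishes_on_def fscale_def)
  then show ?thesis
    by (auto simp: fsupport_def)
qed

text \<open>The frame property lets membership be tested on coefficients, so closure of the coorbit
  space under linear operations is inherited from \<open>lp\<close> instead of being proved for
  functions on the group.\<close>

lemma mem_coorbit_iff:
  assumes "banach_frame \<psi> w p m \<Lambda>"
  shows "F \<in> coorbit \<psi> w p m \<longleftrightarrow> F \<in> H1_dual \<psi> w \<and> shear_coeffs \<psi> \<Lambda> F \<in> lp p (m \<circ> \<Lambda>)"
proof -
  have "F \<in> coorbit \<psi> w p m \<Longrightarrow> F \<in> H1_dual \<psi> w"
    by (simp add: coorbit_def)
  then show ?thesis
    using assms unfolding banach_frame_def by blast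
qed

text \<open>Convexity of the constraint set: convex combinations of the representing functions
  represent the points of the segment. It makes the direction towards another feasible point
  admissible at the minimizer.\<close>

lemma nonneg_ae_segment:
  assumes F: "nonneg_ae \<psi> w F" and G: "nonneg_ae \<psi> w G" and t: "0 \<le> t" "t \<le> 1"
  shows "nonneg_ae \<psi> w (fadd F (fscale t (fdiff G F)))"
proof -
  obtain f where f: "f \<in> borel_measurable lborel" "AE x in lborel. 0 \<le> f x"
    "\<And>h. h \<in> H1 \<psi> w \<Longrightarrow> integrable lborel (\<lambda>x. f x * h x)" "\<And>h. h \<in> H1 \<psi> w \<Longrightarrow> F h = L2_inner f h"
    using F by (auto simp: nonneg_ae_def represents_def)
  obtain g where g: "g \<in> borel_measurable lborel" "AE x in lborel. 0 \<le> g x"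
    "\<And>h. h \<in> H1 \<psi> w \<Longrightarrow> integrable lborel (\<lambda>x. g x * h x)" "\<And>h. h \<in> H1 \<psi> w \<Longrightarrow> G h = L2_inner g h"
    using G by (auto simp: nonneg_ae_def represents_def)
  let ?k = "\<lambda>x. (1 - t) * f x + t * g x"
  have eq: "?k x * h x = (1 - t) * (f x * h x) + t * (g x * h x)" for h :: "plane \<Rightarrow> real" and x
    by (simp add: algebra_simps)
  have "represents \<psi> w ?k (fadd F (fscale t (fdiff G F)))"
    unfolding represents_def
  proof (intro conjI ballI)
    show "?k \<in> borel_measurable lborel"
      using f(1) g(1) by measurable
    fix h assume h: "h \<in> H1 \<psi> w"
    show "integrable lborel (\<lambda>x. ?k x * h x)"
      unfolding eq using f(3)[OF h] g(3)[OF h] by simp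
    show "fadd F (fscale t (fdiff G F)) h = L2_inner ?k h"
      unfolding L2_inner_def eq using f(3,4)[OF h] g(3,4)[OF h]
      by (simp add: fadd_def fscale_def fdiff_def L2_inner_def algebra_simps)
  qed
  moreover have "AE x in lborel. 0 \<le> ?k x"
    using f(2) g(2) by eventually_elim (use t in auto)
  ultimately show ?thesis
    by (auto simp: nonneg_ae_def)
qed

lemma R_reg_eq:
  assumes "1 < p" "shear_coeffs \<psi> \<Lambda> F \<in> lp p (m \<circ> \<Lambda>)"
  shows "R_reg \<psi> p m \<Lambda> F = 1 / p * (\<Sum>j. m (\<Lambda> j) powr p * \<bar>shear_coeffs \<psi> \<Lambda> F j\<bar> powr p)"
  using assms lp_norm_powr[of p "shear_coeffs \<psi> \<Lambda> F" "m \<circ> \<Lambda>"] by (simp add: R_reg_def)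

lemma has_real_derivative_R_reg:
  assumes p: "1 < p" and F: "shear_coeffs \<psi> \<Lambda> F \<in> lp p (m \<circ> \<Lambda>)" and H: "shear_coeffs \<psi> \<Lambda> H \<in> lp p (m \<circ> \<Lambda>)"
  shows "((\<lambda>\<tau>. R_reg \<psi> p m \<Lambda> (fadd F (fscale \<tau> H))) has_real_derivative
     (\<Sum>j. m (\<Lambda> j) powr p * (spow p (shear_coeffs \<psi> \<Lambda> F j) * shear_coeffs \<psi> \<Lambda> H j))) (at 0)"
proof -
  have mem: "shear_coeffs \<psi> \<Lambda> (fadd F (fscale \<tau> H)) \<in> lp p (m \<circ> \<Lambda>)" for \<tau>
    using lp_add[OF _ F lp_scale[OF H]] p by (simp add: shear_coeffs_simps)
  have "((\<lambda>\<tau>. 1 / p * (\<Sum>j. m (\<Lambda> j) powr p * \<bar>shear_coeffs \<psi> \<Lambda> F j + \<tau> * shear_coeffs \<psi> \<Lambda> H j\<bar> powr p))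
      has_real_derivative
      1 / p * (p * (\<Sum>j. m (\<Lambda> j) powr p * (spow p (shear_coeffs \<psi> \<Lambda> F j) * shear_coeffs \<psi> \<Lambda> H j)))) (at 0)"
    using has_real_derivative_lp_modular[OF p F H] by (intro DERIV_cmult) simp
  then show ?thesis
    using p by (simp add: R_reg_eq[OF p mem] shear_coeffs_simps)
qed

lemma grad_R_eq:
  assumes "1 < p" "shear_coeffs \<psi> \<Lambda> F \<in> lp p (m \<circ> \<Lambda>)" "shear_coeffs \<psi> \<Lambda> H \<in> lp p (m \<circ> \<Lambda>)"
  shows "grad_R \<psi> p m \<Lambda> F H
     = (\<Sum>j. m (\<Lambda> j) powr p * (spow p (shear_coeffs \<psi> \<Lambda> F j) * shear_coeffs \<psi> \<Lambda> H j))"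
  unfolding grad_R_def by (rule DERIV_imp_deriv[OF has_real_derivative_R_reg[OF assms]])

lemma bregman_eq:
  assumes p: "1 < p" and F: "shear_coeffs \<psi> \<Lambda> F \<in> lp p (m \<circ> \<Lambda>)" and G: "shear_coeffs \<psi> \<Lambda> G \<in> lp p (m \<circ> \<Lambda>)"
  shows "bregman \<psi> p m \<Lambda> F G
     = (\<Sum>j. (m \<circ> \<Lambda>) j powr p * ((spow p (shear_coeffs \<psi> \<Lambda> F j) - spow p (shear_coeffs \<psi> \<Lambda> G j))
          * (shear_coeffs \<psi> \<Lambda> F j - shear_coeffs \<psi> \<Lambda> G j)))"
proof -
  have d: "shear_coeffs \<psi> \<Lambda> (fdiff F G) \<in> lp p (m \<circ> \<Lambda>)"
    using lp_diff[OF _ F G] p by (simp add: shear_coeffs_simps)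
  show ?thesis
    using suminf_diff[OF summable_weighted_spow(2)[OF p F d] summable_weighted_spow(2)[OF p G d]]
    by (simp add: bregman_def grad_R_eq[OF p F d] grad_R_eq[OF p G d] shear_coeffs_simps
        flip: right_diff_distrib left_diff_distrib)
qed

section \<open>The deterministic error estimate\<close>

locale regularized_sampling =
  fixes p q :: real
    and \<psi> :: "plane \<Rightarrow> real"
    and w m :: "shear_param \<Rightarrow> real"
    and \<Lambda> :: "nat \<Rightarrow> shear_param"
    and SHdag :: "(nat \<Rightarrow> real) \<Rightarrow> functional"
    and U :: "'u::euclidean_space set"
    and J :: "'z::banach \<Rightarrow> 'u \<Rightarrow> 'v::{real_inner,complete_space}"
    and A :: "functional \<Rightarrow> 'z"
    and \<mu> :: "'u measure"
  assumes p: "1 < p" "p < 2" and q: "1 / p + 1 / q = 1"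
    and weight_pos: "\<And>j. 0 < m (\<Lambda> j)"
    and frame: "banach_frame \<psi> w p m \<Lambda>"
    and SHdag: "bounded_linear_from_lp p (m \<circ> \<Lambda>) (X_space \<psi> w p m) (X_norm \<psi> p m \<Lambda>) SHdag"
    and SHdag_inverse: "\<And>F. F \<in> X_space \<psi> w p m \<Longrightarrow> SHdag (shear_coeffs \<psi> \<Lambda> F) = F"
    and Z: "embedded_in_L2_and_C U J"
    and A: "forward_operator (X_space \<psi> w p m) (X_norm \<psi> p m \<Lambda>) U J A"
    and mu: "prob_space \<mu>" "sets \<mu> = sets (restrict_space borel U)"
begin

abbreviation "X \<equiv> X_space \<psi> w p m"
abbreviation "SH \<equiv> shear_coeffs \<psi> \<Lambda>"
abbreviation "atom j \<equiv> J (A (SHdag (unit_seq j)))"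

lemma space_mu: "space \<mu> = U"
  using sets_eq_imp_space_eq[OF mu(2)] by (simp add: space_restrict_space)

lemma q_gt_2: "2 < q"
proof -
  have "q \<noteq> 0"
    using p q by auto
  then have q_eq: "q = p / (p - 1)"
    using p q by (simp add: field_simps)
  show ?thesis
    unfolding q_eq using p by (simp add: less_divide_eq)
qed

section \<open>Vector space structure of \<open>X\<close> and linearity of point sampling\<close>

lemma SH_in_lp: "F \<in> X \<Longrightarrow> SH F \<in> lp p (m \<circ> \<Lambda>)"
  using mem_coorbit_iff[OF frame] by (simp add: X_space_def)

lemma X_fadd: "F \<in> X \<Longrightarrow> G \<in> X \<Longrightarrow> fadd F G \<in> X"
  using fsupport_fadd_subset[of \<psi> w F G] p lp_add[of p]
  by (auto simp: X_space_def mem_coorbit_iff[OF frame] H1_dual_fadd shear_coeffs_simps)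

lemma X_fscale: "F \<in> X \<Longrightarrow> fscale r F \<in> X"
  using fsupport_fscale_subset[of \<psi> w r F]
  by (auto simp: X_space_def mem_coorbit_iff[OF frame] H1_dual_fscale shear_coeffs_simps lp_scale)

lemma X_fdiff: "F \<in> X \<Longrightarrow> G \<in> X \<Longrightarrow> fdiff F G \<in> X"
  unfolding fdiff_eq_fadd by (intro X_fadd X_fscale)

lemma J_A_fadd:
  "F \<in> X \<Longrightarrow> G \<in> X \<Longrightarrow> v \<in> U \<Longrightarrow> J (A (fadd F G)) v = J (A F) v + J (A G) v"
  using A Z by (simp add: forward_operator_def embedded_in_L2_and_C_def)

lemma J_A_fscale: "F \<in> X \<Longrightarrow> v \<in> U \<Longrightarrow> J (A (fscale r F)) v = r *\<^sub>R J (A F) v"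
  using A Z by (simp add: forward_operator_def embedded_in_L2_and_C_def)

lemma J_A_fdiff:
  "F \<in> X \<Longrightarrow> G \<in> X \<Longrightarrow> v \<in> U \<Longrightarrow> J (A (fdiff F G)) v = J (A F) v - J (A G) v"
  unfolding fdiff_eq_fadd by (simp add: J_A_fadd J_A_fscale X_fscale)

lemma continuous_on_J: "continuous_on U (J z)"
  using Z by (simp add: embedded_in_L2_and_C_def)

lemma norm_J_le: "\<exists>C. \<forall>z. \<forall>v\<in>U. norm (J z v) \<le> C * norm z"
  using Z by (simp add: embedded_in_L2_and_C_def)

lemma J_bounded: "\<exists>C. \<forall>v\<in>U. norm (J z v) \<le> C"
  using norm_J_le by (elim exE) (rule exI, erule spec)

lemma norm_J_le_sup_norm: "v \<in> U \<Longrightarrow> norm (J z v) \<le> sup_norm U (J z)"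
  using J_bounded[of z] unfolding sup_norm_def by (auto intro!: cSUP_upper simp: bdd_above_def)

lemma U_nonempty: "U \<noteq> {}"
  using prob_space.not_empty[OF mu(1)] by (simp add: space_mu)

text \<open>The supremum over the empty set is unspecified; \<open>U\<close> is nonempty because it
  carries a probability measure.\<close>

lemma sup_norm_J_nonneg: "0 \<le> sup_norm U (J z)"
  using U_nonempty norm_J_le_sup_norm by (meson all_not_in_conv norm_ge_zero order.trans)

lemma J_A_bounded: "\<exists>C\<ge>0. \<forall>F\<in>X. \<forall>v\<in>U. norm (J (A F) v) \<le> C * X_norm \<psi> p m \<Lambda> F"
proof -
  obtain C where C: "\<And>F. F \<in> X \<Longrightarrow> norm (A F) \<le> C * X_norm \<psi> p m \<Lambda> F"
    using A unfolding forward_operator_def by (elim conjE exE) blast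
  obtain C' where "\<forall>z. \<forall>v\<in>U. norm (J z v) \<le> C' * norm z"
    using norm_J_le by (rule exE)
  then have C': "v \<in> U \<Longrightarrow> norm (J z v) \<le> C' * norm z" for z v
    by simp
  have "norm (J (A F) v) \<le> (\<bar>C'\<bar> * \<bar>C\<bar>) * X_norm \<psi> p m \<Lambda> F" if F: "F \<in> X" and v: "v \<in> U" for F v
  proof -
    have "norm (J (A F) v) \<le> C' * norm (A F)"
      using C'[OF v] .
    also have "\<dots> \<le> \<bar>C'\<bar> * norm (A F)"
      by (intro mult_right_mono) auto
    also have "norm (A F) \<le> \<bar>C\<bar> * X_norm \<psi> p m \<Lambda> F"
      using C[OF F] mult_right_mono[OF abs_ge_self[of C] lp_norm_nonneg] unfolding X_norm_def
      by (rule order.trans)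
    finally show ?thesis
      by (simp add: mult_left_mono mult.assoc)
  qed
  then show ?thesis
    by (intro exI[of _ "\<bar>C'\<bar> * \<bar>C\<bar>"]) auto
qed

section \<open>Pairings of elements of \<open>Z\<close> and the random error functional\<close>

lemma borel_measurable_inner_J: "(\<lambda>v. J z v \<bullet> J z' v) \<in> borel_measurable \<mu>"
  unfolding measurable_cong_sets[OF mu(2) refl]
  by (intro borel_measurable_continuous_on_restrict continuous_on_inner continuous_on_J)

lemma abs_inner_J_le:
  assumes "v \<in> U" "norm (J z v) \<le> b" "norm (J z' v) \<le> b'"
  shows "\<bar>J z v \<bullet> J z' v\<bar> \<le> b * b'"
  using Cauchy_Schwarz_ineq2[of "J z v" "J z' v"] mult_mono[OF assms(2,3)] assms(2)
  by (smt (verit) norm_ge_zero)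

lemma integrable_inner_J: "integrable \<mu> (\<lambda>v. J z v \<bullet> J z' v)"
proof -
  interpret prob_space \<mu> by (rule mu)
  show ?thesis
    using borel_measurable_inner_J
    by (intro integrable_const_bound[where B = "sup_norm U (J z) * sup_norm U (J z')"])
      (auto simp: space_mu intro!: abs_inner_J_le norm_J_le_sup_norm)
qed

text \<open>The functional T of the overview with r = \<delta>/\<alpha>. The first line is the noise
  paired with the sampled values; the second is the Monte Carlo quadrature error for the integral
  that defines \<open>A_mu_adjoint\<close>.\<close>

definition error_functional ::
  "nat \<Rightarrow> real \<Rightarrow> (nat \<Rightarrow> 'u) \<Rightarrow> (nat \<Rightarrow> 'v) \<Rightarrow> 'z \<Rightarrow> functional \<Rightarrow> real" where
  "error_functional N r us e z F =
     r * (1 / real N * (\<Sum>n=1..N. e n \<bullet> J (A F) (us n)))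
     + (1 / real N * (\<Sum>n=1..N. J (A F) (us n) \<bullet> J z (us n)) - (\<integral>v. J (A F) v \<bullet> J z v \<partial>\<mu>))"

context
  fixes N :: nat and us :: "nat \<Rightarrow> 'u"
  assumes N: "1 \<le> N" and us: "\<And>n. n \<in> {1..N} \<Longrightarrow> us n \<in> U"
begin

lemma error_functional_fadd:
  assumes "F \<in> X" "G \<in> X"
  shows "error_functional N r us e z (fadd F G) = error_functional N r us e z F + error_functional N r us e z G"
proof -
  have "(\<integral>v. J (A (fadd F G)) v \<bullet> J z v \<partial>\<mu>) = (\<integral>v. J (A F) v \<bullet> J z v + J (A G) v \<bullet> J z v \<partial>\<mu>)"
    using assms by (intro Bochner_Integration.integral_cong) (simp_all add: space_mu J_A_fadd inner_add_left)
  moreover have "(\<Sum>n=1..N. e n \<bullet> J (A (fadd F G)) (us n))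
      = (\<Sum>n=1..N. e n \<bullet> J (A F) (us n)) + (\<Sum>n=1..N. e n \<bullet> J (A G) (us n))"
    unfolding sum.distrib[symmetric] using assms us
    by (intro sum.cong refl) (simp add: J_A_fadd inner_add_right)
  moreover have "(\<Sum>n=1..N. J (A (fadd F G)) (us n) \<bullet> J z (us n))
      = (\<Sum>n=1..N. J (A F) (us n) \<bullet> J z (us n)) + (\<Sum>n=1..N. J (A G) (us n) \<bullet> J z (us n))"
    unfolding sum.distrib[symmetric] using assms us
    by (intro sum.cong refl) (simp add: J_A_fadd inner_add_left)
  ultimately show ?thesis
    by (simp add: error_functional_def integrable_inner_J distrib_left)
qed

lemma error_functional_fscale:
  assumes "F \<in> X"
  shows "error_functional N r us e z (fscale c F) = c * error_functional N r us e z F"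
proof -
  have "(\<integral>v. J (A (fscale c F)) v \<bullet> J z v \<partial>\<mu>) = (\<integral>v. c * (J (A F) v \<bullet> J z v) \<partial>\<mu>)"
    using assms by (intro Bochner_Integration.integral_cong) (simp_all add: space_mu J_A_fscale)
  moreover have "(\<Sum>n=1..N. e n \<bullet> J (A (fscale c F)) (us n)) = c * (\<Sum>n=1..N. e n \<bullet> J (A F) (us n))"
    unfolding sum_distrib_left using assms us by (intro sum.cong refl) (simp add: J_A_fscale)
  moreover have "(\<Sum>n=1..N. J (A (fscale c F)) (us n) \<bullet> J z (us n)) = c * (\<Sum>n=1..N. J (A F) (us n) \<bullet> J z (us n))"
    unfolding sum_distrib_left using assms us by (intro sum.cong refl) (simp add: J_A_fscale)
  ultimately show ?thesis
    by (simp add: error_functional_def right_diff_distrib distrib_left)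
qed

text \<open>A bound without any cancellation, valid for each fixed realization of points and noise.
  It only serves to show boundedness and convergence; the rates come from the moment
  estimates.\<close>

lemma abs_error_functional_le:
  assumes b: "\<And>v. v \<in> U \<Longrightarrow> norm (J (A F) v) \<le> b"
  shows "\<bar>error_functional N r us e z F\<bar>
     \<le> (\<bar>r\<bar> * (1 / real N * (\<Sum>n=1..N. norm (e n))) + 2 * sup_norm U (J z)) * b"
proof -
  interpret prob_space \<mu> by (rule mu)
  have N0: "0 < real N" using N by simp
  have e: "\<bar>\<Sum>n=1..N. e n \<bullet> J (A F) (us n)\<bar> \<le> (\<Sum>n=1..N. norm (e n)) * b"
    unfolding sum_distrib_right
  proof (rule order.trans[OF sum_abs sum_mono])
    fix n assume n: "n \<in> {1..N}"
    show "\<bar>e n \<bullet> J (A F) (us n)\<bar> \<le> norm (e n) * b"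
      using Cauchy_Schwarz_ineq2[of "e n" "J (A F) (us n)"] mult_left_mono[OF b[OF us[OF n]] norm_ge_zero[of "e n"]]
      by linarith
  qed
  have inner: "\<bar>J (A F) v \<bullet> J z v\<bar> \<le> b * sup_norm U (J z)" if "v \<in> U" for v
    using that b by (intro abs_inner_J_le norm_J_le_sup_norm)
  have s: "\<bar>\<Sum>n=1..N. J (A F) (us n) \<bullet> J z (us n)\<bar> \<le> real N * (b * sup_norm U (J z))"
    using order.trans[OF sum_abs sum_bounded_above[of "{1..N}" "\<lambda>n. \<bar>J (A F) (us n) \<bullet> J z (us n)\<bar>"]]
      inner us by fastforce
  have i: "\<bar>\<integral>v. J (A F) v \<bullet> J z v \<partial>\<mu>\<bar> \<le> b * sup_norm U (J z)"
    unfolding abs_le_iff using inner integrable_inner_J[of "A F" z]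
    by (auto simp: abs_le_iff space_mu intro!: integral_le_const simp flip: integral_minus)
  have "\<bar>r * (1 / real N * (\<Sum>n=1..N. e n \<bullet> J (A F) (us n)))\<bar> \<le> \<bar>r\<bar> * (1 / real N * ((\<Sum>n=1..N. norm (e n)) * b))"
    using e N0 by (simp add: abs_mult mult_left_mono divide_right_mono)
  moreover have "\<bar>1 / real N * (\<Sum>n=1..N. J (A F) (us n) \<bullet> J z (us n))\<bar> \<le> b * sup_norm U (J z)"
    using s N0 by (simp add: abs_mult divide_le_eq mult.commute)
  moreover note i
  ultimately have "\<bar>error_functional N r us e z F\<bar>
      \<le> \<bar>r\<bar> * (1 / real N * ((\<Sum>n=1..N. norm (e n)) * b)) + (b * sup_norm U (J z) + b * sup_norm U (J z))"
  proof -
    have tri: "\<bar>x + (y - v)\<bar> \<le> a + (c + c)" if "\<bar>x\<bar> \<le> a" "\<bar>y\<bar> \<le> c" "\<bar>v\<bar> \<le> c" for x y v a c :: real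
      using that by linarith
    show ?thesis
      unfolding error_functional_def by (rule tri) fact+
  qed
  then show ?thesis
    by (simp add: algebra_simps)
qed

text \<open>Composition with \<open>SHdag\<close> gives a bounded linear functional on
  \<open>lp\<close>, which is the sum of its values at unit sequences. Evaluating at
  \<open>SH F\<close> and using \<open>SHdag (SH F) = F\<close> returns the value at F.\<close>

lemma error_functional_sums:
  assumes F: "F \<in> X"
  shows "(\<lambda>j. SH F j * error_functional N r us e z (SHdag (unit_seq j))) sums error_functional N r us e z F"
proof -
  obtain C where C: "0 \<le> C" "\<And>F v. F \<in> X \<Longrightarrow> v \<in> U \<Longrightarrow> norm (J (A F) v) \<le> C * X_norm \<psi> p m \<Lambda> F"
    using J_A_bounded by blast
  obtain C' where S: "\<And>c. c \<in> lp p (m \<circ> \<Lambda>) \<Longrightarrow> SHdag c \<in> X"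
    "\<And>c d. c \<in> lp p (m \<circ> \<Lambda>) \<Longrightarrow> d \<in> lp p (m \<circ> \<Lambda>) \<Longrightarrow> SHdag (\<lambda>j. c j + d j) = fadd (SHdag c) (SHdag d)"
    "\<And>r c. c \<in> lp p (m \<circ> \<Lambda>) \<Longrightarrow> SHdag (\<lambda>j. r * c j) = fscale r (SHdag c)"
    "\<And>c. c \<in> lp p (m \<circ> \<Lambda>) \<Longrightarrow> X_norm \<psi> p m \<Lambda> (SHdag c) \<le> C' * lp_norm p (m \<circ> \<Lambda>) c"
    using SHdag unfolding bounded_linear_from_lp_def by (elim conjE exE) blast
  define K where "K = \<bar>r\<bar> * (1 / real N * (\<Sum>n=1..N. norm (e n))) + 2 * sup_norm U (J z)"
  have K: "0 \<le> K"
    unfolding K_def using sup_norm_J_nonneg by (intro add_nonneg_nonneg mult_nonneg_nonneg sum_nonneg) auto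
  have "(\<lambda>j. SH F j * error_functional N r us e z (SHdag (unit_seq j))) sums error_functional N r us e z (SHdag (SH F))"
  proof (rule lp_linear_functional_sums[where p = p and mw = "m \<circ> \<Lambda>" and K = "K * (C * C')"])
    fix c assume c: "c \<in> lp p (m \<circ> \<Lambda>)"
    have "\<bar>error_functional N r us e z (SHdag c)\<bar> \<le> K * (C * X_norm \<psi> p m \<Lambda> (SHdag c))"
      unfolding K_def by (intro abs_error_functional_le C(2) S(1) c)
    also have "\<dots> \<le> K * (C * (C' * lp_norm p (m \<circ> \<Lambda>) c))"
      by (intro mult_left_mono S(4) c K C)
    finally show "\<bar>error_functional N r us e z (SHdag c)\<bar> \<le> K * (C * C') * lp_norm p (m \<circ> \<Lambda>) c"
      by (simp add: mult.assoc)
  qed (use p in \<open>auto simp: S error_functional_fadd error_functional_fscale intro: SH_in_lp[OF F]\<close>)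
  then show ?thesis
    by (simp add: SHdag_inverse[OF F])
qed

text \<open>Along the segment from the minimizer to a feasible \<open>G\<close> the objective is
  smooth and minimal at the left end, so its derivative there is nonnegative.\<close>

lemma minimizer_variational_inequality:
  assumes f: "is_arg_min (objective \<psi> w p m \<Lambda> J A \<alpha> N us g) (\<lambda>F. F \<in> X) f"
    and G: "G \<in> X" "nonneg_ae \<psi> w G"
  shows "f \<in> X"
    and "0 \<le> VN_inner N (\<lambda>n. J (A f) (us n) - g n) (\<lambda>n. J (A (fdiff G f)) (us n))
       + \<alpha> * grad_R \<psi> p m \<Lambda> f (fdiff G f)"
proof -
  show fX: "f \<in> X"
    using f by (simp add: is_arg_min_def)
  have opt: "objective \<psi> w p m \<Lambda> J A \<alpha> N us g f \<le> objective \<psi> w p m \<Lambda> J A \<alpha> N us g H" if "H \<in> X" for H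
    using f that by (auto simp: is_arg_min_def)
  \<comment> \<open>The objective is finite at \<open>G\<close>, hence finite at the minimizer,
    which rules out the value infinity of \<open>iota_plus\<close>.\<close>
  have f_nonneg: "nonneg_ae \<psi> w f"
    using opt[OF G(1)] G(2) by (auto simp: objective_def iota_plus_def split: if_splits)
  define E where "E = fdiff G f"
  have EX: "E \<in> X"
    unfolding E_def by (intro X_fdiff G fX)
  define r d where "r = (\<lambda>n. J (A f) (us n) - g n)" and "d = (\<lambda>n. J (A E) (us n))"
  \<comment> \<open>The objective at the point with parameter t of the segment, with the data term
    expanded as a quadratic polynomial in t and the constraint term dropped, since it vanishes for t
    in [0, 1].\<close>
  define \<phi> where "\<phi> t = 1 / 2 * (VN_inner N r r + 2 * t * VN_inner N r d + t\<^sup>2 * VN_inner N d d)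
      + \<alpha> * R_reg \<psi> p m \<Lambda> (fadd f (fscale t E))" for t
  have data: "(VN_norm N (\<lambda>n. sampled J A us (fadd f (fscale t E)) n - g n))\<^sup>2
      = VN_inner N r r + 2 * t * VN_inner N r d + t\<^sup>2 * VN_inner N d d" for t
  proof -
    have "(VN_norm N (\<lambda>n. sampled J A us (fadd f (fscale t E)) n - g n))\<^sup>2
        = 1 / real N * (\<Sum>n=1..N. (sampled J A us (fadd f (fscale t E)) n - g n) \<bullet> (sampled J A us (fadd f (fscale t E)) n - g n))"
      unfolding VN_norm_def VN_inner_def by (rule real_sqrt_pow2) (auto intro!: divide_nonneg_nonneg sum_nonneg)
    also have "(\<Sum>n=1..N. (sampled J A us (fadd f (fscale t E)) n - g n) \<bullet> (sampled J A us (fadd f (fscale t E)) n - g n))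
        = (\<Sum>n=1..N. r n \<bullet> r n + 2 * t * (r n \<bullet> d n) + t\<^sup>2 * (d n \<bullet> d n))"
    proof (rule sum.cong[OF refl])
      fix n assume n: "n \<in> {1..N}"
      have "sampled J A us (fadd f (fscale t E)) n - g n = r n + t *\<^sub>R d n"
        using us[OF n] by (simp add: sampled_def r_def d_def J_A_fadd J_A_fscale fX EX X_fscale)
      then show "(sampled J A us (fadd f (fscale t E)) n - g n) \<bullet> (sampled J A us (fadd f (fscale t E)) n - g n)
          = r n \<bullet> r n + 2 * t * (r n \<bullet> d n) + t\<^sup>2 * (d n \<bullet> d n)"
        by (simp add: inner_add_left inner_add_right inner_commute power2_eq_square algebra_simps)
    qed
    also have "\<dots> = (\<Sum>n=1..N. r n \<bullet> r n) + 2 * t * (\<Sum>n=1..N. r n \<bullet> d n) + t\<^sup>2 * (\<Sum>n=1..N. d n \<bullet> d n)"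
      by (simp add: sum.distrib sum_distrib_left)
    finally show ?thesis
      by (simp add: VN_inner_def algebra_simps)
  qed
  have min: "\<phi> 0 \<le> \<phi> t" if t: "0 \<le> t" "t \<le> 1" for t
  proof -
    have obj: "objective \<psi> w p m \<Lambda> J A \<alpha> N us g (fadd f (fscale s E)) = ereal (\<phi> s)" if "0 \<le> s" "s \<le> 1" for s
      unfolding objective_def data using nonneg_ae_segment[OF f_nonneg G(2) that]
      by (simp add: iota_plus_def \<phi>_def E_def)
    have "fadd f (fscale 0 E) = f"
      by (simp add: fadd_def fscale_def)
    then have "ereal (\<phi> 0) \<le> ereal (\<phi> t)"
      using opt[OF X_fadd[OF fX X_fscale[OF EX]], of t] obj[of 0] obj[OF t] by simp
    then show ?thesis by simp
  qed
  have "(\<phi> has_real_derivative VN_inner N r d + \<alpha> * grad_R \<psi> p m \<Lambda> f E) (at 0)"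
  proof -
    have "((\<lambda>t. R_reg \<psi> p m \<Lambda> (fadd f (fscale t E))) has_real_derivative grad_R \<psi> p m \<Lambda> f E) (at 0)"
      unfolding grad_R_eq[OF p(1) SH_in_lp[OF fX] SH_in_lp[OF EX]]
      by (rule has_real_derivative_R_reg[OF p(1) SH_in_lp[OF fX] SH_in_lp[OF EX]])
    then show ?thesis
      unfolding \<phi>_def by (auto intro!: derivative_eq_intros)
  qed
  then have "0 \<le> VN_inner N r d + \<alpha> * grad_R \<psi> p m \<Lambda> f E"
  proof (rule contrapos_pp)
    assume "\<not> 0 \<le> VN_inner N r d + \<alpha> * grad_R \<psi> p m \<Lambda> f E"
    then show "\<not> (\<phi> has_real_derivative VN_inner N r d + \<alpha> * grad_R \<psi> p m \<Lambda> f E) (at 0)"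
    proof (intro notI)
      assume "(\<phi> has_real_derivative VN_inner N r d + \<alpha> * grad_R \<psi> p m \<Lambda> f E) (at 0)"
        "\<not> 0 \<le> VN_inner N r d + \<alpha> * grad_R \<psi> p m \<Lambda> f E"
      then obtain s where s: "0 < s" "\<And>h. 0 < h \<Longrightarrow> h < s \<Longrightarrow> \<phi> h < \<phi> 0"
        using DERIV_neg_dec_right[of \<phi> _ 0] by (metis add_0 not_le)
      \<comment> \<open>This parameter lies both in (0, s), where a negative derivative would force
        a strict decrease, and in [0, 1], where 0 is optimal.\<close>
      have "\<phi> 0 \<le> \<phi> (min s 1 / 2)"
        using s(1) by (intro min) auto
      moreover have "\<phi> (min s 1 / 2) < \<phi> 0"
        using s(1) by (intro s(2)) auto
      ultimately show False
        by simp
    qed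
  qed
  then show "0 \<le> VN_inner N (\<lambda>n. J (A f) (us n) - g n) (\<lambda>n. J (A (fdiff G f)) (us n))
       + \<alpha> * grad_R \<psi> p m \<Lambda> f (fdiff G f)"
    by (simp add: r_def d_def E_def)
qed

text \<open>The variational inequality is taken at \<open>f_dag\<close>. Its data term contains
  minus the squared empirical norm of the sampled values a of E; completing the square trades this
  for \<alpha> times the empirical pairing of a with z. Together with the integral from the source
  condition the pairing becomes the quadrature error.\<close>

lemma bregman_le_error_functional:
  assumes \<alpha>: "0 < \<alpha>"
    and f: "is_arg_min (objective \<psi> w p m \<Lambda> J A \<alpha> N us (\<lambda>n. sampled J A us f_dag n + \<delta> *\<^sub>R e n)) (\<lambda>F. F \<in> X) f"
    and truth: "f_dag \<in> X" "nonneg_ae \<psi> w f_dag"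
    and source: "\<And>F. F \<in> X \<Longrightarrow> grad_R \<psi> p m \<Lambda> f_dag F = A_mu_adjoint \<mu> J A (J z) F"
  shows "bregman \<psi> p m \<Lambda> f f_dag
     \<le> error_functional N (\<delta> / \<alpha>) us e z (fdiff f f_dag) + \<alpha> * (sup_norm U (J z))\<^sup>2 / 4"
proof -
  have N0: "0 < real N" using N by simp
  note fX = minimizer_variational_inequality(1)[OF f truth]
  define E where "E = fdiff f f_dag"
  have EX: "E \<in> X"
    unfolding E_def by (intro X_fdiff truth fX)
  define a where "a n = J (A E) (us n)" for n
  have "VN_inner N (\<lambda>n. J (A f) (us n) - (sampled J A us f_dag n + \<delta> *\<^sub>R e n)) (\<lambda>n. J (A (fdiff f_dag f)) (us n))
      = 1 / real N * (\<Sum>n=1..N. \<delta> * (e n \<bullet> a n) - a n \<bullet> a n)"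
    unfolding VN_inner_def
  proof (intro arg_cong[where f = "\<lambda>s. 1 / real N * s"] sum.cong[OF refl])
    fix n assume n: "n \<in> {1..N}"
    have eq: "J (A f) (us n) - (sampled J A us f_dag n + \<delta> *\<^sub>R e n) = a n - \<delta> *\<^sub>R e n"
      "J (A (fdiff f_dag f)) (us n) = - a n"
      using us[OF n] by (simp_all add: a_def E_def J_A_fdiff fX truth sampled_def)
    show "(J (A f) (us n) - (sampled J A us f_dag n + \<delta> *\<^sub>R e n)) \<bullet> J (A (fdiff f_dag f)) (us n)
        = \<delta> * (e n \<bullet> a n) - a n \<bullet> a n"
      unfolding eq by (simp add: inner_diff_left)
  qed
  also have "\<dots> = \<delta> * (1 / real N * (\<Sum>n=1..N. e n \<bullet> a n)) - 1 / real N * (\<Sum>n=1..N. a n \<bullet> a n)"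
    by (simp add: sum_subtractf sum_distrib_left right_diff_distrib mult.left_commute)
  finally have data: "VN_inner N (\<lambda>n. J (A f) (us n) - (sampled J A us f_dag n + \<delta> *\<^sub>R e n)) (\<lambda>n. J (A (fdiff f_dag f)) (us n))
      = \<delta> * (1 / real N * (\<Sum>n=1..N. e n \<bullet> a n)) - 1 / real N * (\<Sum>n=1..N. a n \<bullet> a n)" .
  have "grad_R \<psi> p m \<Lambda> f (fdiff f_dag f) = - grad_R \<psi> p m \<Lambda> f E"
  proof -
    have "shear_coeffs \<psi> \<Lambda> (fdiff f_dag f) = (\<lambda>j. - SH E j)"
      by (simp add: E_def shear_coeffs_simps)
    then show ?thesis
      using suminf_minus[OF summable_weighted_spow(2)[OF p(1) SH_in_lp[OF fX] SH_in_lp[OF EX]]]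
      by (simp add: grad_R_eq[OF p(1) SH_in_lp[OF fX] SH_in_lp] EX X_fdiff truth fX)
  qed
  then have vi: "\<alpha> * grad_R \<psi> p m \<Lambda> f E
      \<le> \<delta> * (1 / real N * (\<Sum>n=1..N. e n \<bullet> a n)) - 1 / real N * (\<Sum>n=1..N. a n \<bullet> a n)"
    using minimizer_variational_inequality(2)[OF f truth] unfolding data by simp
  \<comment> \<open>Expansion of |a + (\<alpha>/2) z|^2 \<ge> 0. The term \<alpha>^2 |z|^2 / 4
    becomes, after division by \<alpha>, the deterministic remainder of order \<alpha>.\<close>
  have sq: "0 \<le> a n \<bullet> a n + \<alpha> * (a n \<bullet> J z (us n)) + \<alpha>\<^sup>2 * (sup_norm U (J z))\<^sup>2 / 4" if n: "n \<in> {1..N}" for n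
  proof -
    have "0 \<le> (a n + (\<alpha> / 2) *\<^sub>R J z (us n)) \<bullet> (a n + (\<alpha> / 2) *\<^sub>R J z (us n))"
      by simp
    also have "\<dots> = a n \<bullet> a n + \<alpha> * (a n \<bullet> J z (us n)) + \<alpha>\<^sup>2 * (norm (J z (us n)))\<^sup>2 / 4"
      unfolding power2_norm_eq_inner
      by (simp add: inner_add_left inner_add_right inner_commute power2_eq_square algebra_simps)
    also have "(norm (J z (us n)))\<^sup>2 \<le> (sup_norm U (J z))\<^sup>2"
      using norm_J_le_sup_norm[OF us[OF n]] by (intro power_mono) auto
    finally show ?thesis
      by (simp add: mult_left_mono)
  qed
  have "0 \<le> (\<Sum>n=1..N. a n \<bullet> a n + \<alpha> * (a n \<bullet> J z (us n)) + \<alpha>\<^sup>2 * (sup_norm U (J z))\<^sup>2 / 4)"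
    by (intro sum_nonneg sq)
  also have "\<dots> = (\<Sum>n=1..N. a n \<bullet> a n) + \<alpha> * (\<Sum>n=1..N. a n \<bullet> J z (us n)) + real N * (\<alpha>\<^sup>2 * (sup_norm U (J z))\<^sup>2 / 4)"
    by (simp add: sum.distrib sum_distrib_left)
  finally have "0 \<le> 1 / real N * ((\<Sum>n=1..N. a n \<bullet> a n) + \<alpha> * (\<Sum>n=1..N. a n \<bullet> J z (us n)) + real N * (\<alpha>\<^sup>2 * (sup_norm U (J z))\<^sup>2 / 4))"
    by simp
  then have sq_sum: "0 \<le> 1 / real N * (\<Sum>n=1..N. a n \<bullet> a n) + \<alpha> * (1 / real N * (\<Sum>n=1..N. a n \<bullet> J z (us n))) + \<alpha> * (\<alpha> * (sup_norm U (J z))\<^sup>2 / 4)"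
    using N0 by (simp add: distrib_left power2_eq_square)
  have grad: "grad_R \<psi> p m \<Lambda> f_dag E = (\<integral>v. J (A E) v \<bullet> J z v \<partial>\<mu>)"
    using source[OF EX] by (simp add: A_mu_adjoint_def)
  have "\<alpha> * bregman \<psi> p m \<Lambda> f f_dag = \<alpha> * grad_R \<psi> p m \<Lambda> f E - \<alpha> * (\<integral>v. J (A E) v \<bullet> J z v \<partial>\<mu>)"
    unfolding bregman_def E_def[symmetric] grad by (rule right_diff_distrib)
  also have "\<dots> \<le> \<delta> * (1 / real N * (\<Sum>n=1..N. e n \<bullet> a n)) + \<alpha> * (1 / real N * (\<Sum>n=1..N. a n \<bullet> J z (us n)))
      - \<alpha> * (\<integral>v. J (A E) v \<bullet> J z v \<partial>\<mu>) + \<alpha> * (\<alpha> * (sup_norm U (J z))\<^sup>2 / 4)"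
    using vi sq_sum by linarith
  also have "\<dots> = \<alpha> * (error_functional N (\<delta> / \<alpha>) us e z E + \<alpha> * (sup_norm U (J z))\<^sup>2 / 4)"
    using \<alpha> unfolding error_functional_def a_def by (simp add: algebra_simps)
  finally show ?thesis
    using \<alpha> by (simp add: E_def)
qed

text \<open>Holds for each realization separately. The series over the atoms converges because every
  value is at most a realization-dependent factor B times \<open>sup_norm U (atom j)\<close>, and
  these sup norms are summable by (S2).\<close>

theorem bregman_deterministic_bound:
  assumes \<alpha>: "0 < \<alpha>" and \<theta>: "0 < \<theta>" "\<theta> \<le> 1"
    and f: "is_arg_min (objective \<psi> w p m \<Lambda> J A \<alpha> N us (\<lambda>n. sampled J A us f_dag n + \<delta> *\<^sub>R e n)) (\<lambda>F. F \<in> X) f"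
    and truth: "f_dag \<in> X" "nonneg_ae \<psi> w f_dag"
    and source: "\<And>F. F \<in> X \<Longrightarrow> grad_R \<psi> p m \<Lambda> f_dag F = A_mu_adjoint \<mu> J A (J z) F"
    and S2: "summable (\<lambda>j. m (\<Lambda> j) powr (-q) * sup_norm U (atom j) powr q)"
    and K_def: "K = 4 powr (2 - p) / (p - 1)"
  shows "summable (\<lambda>j. m (\<Lambda> j) powr (-q) * \<bar>error_functional N (\<delta> / \<alpha>) us e z (SHdag (unit_seq j))\<bar> powr q)"
    and "bregman \<psi> p m \<Lambda> f f_dag
     \<le> \<theta>\<^sup>2 * (\<Sum>j. m (\<Lambda> j) powr p * \<bar>SH f_dag j\<bar> powr p)
       + 2 * (2 * K) powr (q / p) * \<theta> powr (2 - q)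
         * (\<Sum>j. m (\<Lambda> j) powr (-q) * \<bar>error_functional N (\<delta> / \<alpha>) us e z (SHdag (unit_seq j))\<bar> powr q)
       + \<alpha> * (sup_norm U (J z))\<^sup>2 / 2"
proof -
  define k where "k j = error_functional N (\<delta> / \<alpha>) us e z (SHdag (unit_seq j))" for j
  define B where "B = \<bar>\<delta> / \<alpha>\<bar> * (1 / real N * (\<Sum>n=1..N. norm (e n))) + 2 * sup_norm U (J z)"
  have B: "0 \<le> B"
    unfolding B_def using sup_norm_J_nonneg by (intro add_nonneg_nonneg mult_nonneg_nonneg sum_nonneg) auto
  have k: "\<bar>k j\<bar> powr q \<le> B powr q * sup_norm U (atom j) powr q" for j
  proof -
    have "\<bar>k j\<bar> \<le> B * sup_norm U (atom j)"
      unfolding k_def B_def by (intro abs_error_functional_le norm_J_le_sup_norm)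
    then have "\<bar>k j\<bar> powr q \<le> (B * sup_norm U (atom j)) powr q"
      using q_gt_2 by (intro powr_mono2) auto
    then show ?thesis
      using B sup_norm_J_nonneg by (simp add: powr_mult)
  qed
  have sum_k: "summable (\<lambda>j. m (\<Lambda> j) powr (-q) * \<bar>k j\<bar> powr q)"
  proof (rule summable_comparison_test'[OF summable_mult[OF S2, of "B powr q"], of 0])
    show "norm (m (\<Lambda> j) powr (-q) * \<bar>k j\<bar> powr q) \<le> B powr q * (m (\<Lambda> j) powr (-q) * sup_norm U (atom j) powr q)" for j
      using mult_left_mono[OF k, of "m (\<Lambda> j) powr (-q)" j] by (simp add: ac_simps)
  qed
  then show "summable (\<lambda>j. m (\<Lambda> j) powr (-q) * \<bar>error_functional N (\<delta> / \<alpha>) us e z (SHdag (unit_seq j))\<bar> powr q)"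
    by (simp add: k_def)
  note fX = minimizer_variational_inequality(1)[OF f truth]
  have "bregman \<psi> p m \<Lambda> f f_dag
     \<le> \<theta>\<^sup>2 * (\<Sum>j. (m \<circ> \<Lambda>) j powr p * \<bar>SH f_dag j\<bar> powr p)
       + 2 * (2 * K) powr (q / p) * \<theta> powr (2 - q) * (\<Sum>j. (m \<circ> \<Lambda>) j powr (-q) * \<bar>k j\<bar> powr q)
       + 2 * (\<alpha> * (sup_norm U (J z))\<^sup>2 / 4)"
  proof (rule bregman_young_bound[OF p q _ SH_in_lp[OF fX] SH_in_lp[OF truth(1)] \<theta> K_def])
    show "(\<lambda>j. (SH f j - SH f_dag j) * k j) sums error_functional N (\<delta> / \<alpha>) us e z (fdiff f f_dag)"
      using error_functional_sums[OF X_fdiff[OF fX truth(1)]] by (simp add: shear_coeffs_simps k_def)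
    show "bregman \<psi> p m \<Lambda> f f_dag
        \<le> error_functional N (\<delta> / \<alpha>) us e z (fdiff f f_dag) + \<alpha> * (sup_norm U (J z))\<^sup>2 / 4"
      by (rule bregman_le_error_functional[OF \<alpha> f truth source])
  qed (use weight_pos sum_k in \<open>auto intro: bregman_eq[OF p(1) SH_in_lp[OF fX] SH_in_lp[OF truth(1)], unfolded comp_def]\<close>)
  then show "bregman \<psi> p m \<Lambda> f f_dag
     \<le> \<theta>\<^sup>2 * (\<Sum>j. m (\<Lambda> j) powr p * \<bar>SH f_dag j\<bar> powr p)
       + 2 * (2 * K) powr (q / p) * \<theta> powr (2 - q)
         * (\<Sum>j. m (\<Lambda> j) powr (-q) * \<bar>error_functional N (\<delta> / \<alpha>) us e z (SHdag (unit_seq j))\<bar> powr q)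
       + \<alpha> * (sup_norm U (J z))\<^sup>2 / 2"
    by (simp add: k_def)
qed

end

end

section \<open>Moment bounds for empirical averages\<close>

lemma exp_le_quadratic: "exp y \<le> 1 + y + y\<^sup>2 * exp \<bar>y\<bar> / 2" for y :: real
proof -
  obtain t where t: "\<bar>t\<bar> \<le> \<bar>y\<bar>" "exp y = (\<Sum>k<2. y ^ k / fact k) + exp t / fact 2 * y ^ 2"
    using Maclaurin_exp_le[of y 2] by blast
  have "exp t * y\<^sup>2 \<le> exp \<bar>y\<bar> * y\<^sup>2"
    using t(1) by (intro mult_right_mono) auto
  then show ?thesis
    using t(2) by (simp add: numeral_2_eq_2 mult.commute)
qed

lemma power2_le_exp: "0 \<le> t \<Longrightarrow> t\<^sup>2 \<le> 2 * exp t" for t :: real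
  using exp_lower_Taylor_quadratic[of t] by simp

text \<open>A Bernstein-type estimate: in the second-order Taylor bound of the exponential the
  linear term integrates to 0, and the remainder is controlled by the exponential moment of the
  envelope \<open>G\<close>. What matters is the factor l^2, which survives taking N-th powers at
  arguments of size 1 / sqrt N.\<close>

lemma (in prob_space) nn_integral_exp_le:
  fixes Y G :: "'a \<Rightarrow> real"
  assumes Y: "integrable M Y" "expectation Y = 0"
    and G: "G \<in> borel_measurable M" "\<And>x. x \<in> space M \<Longrightarrow> \<bar>Y x\<bar> \<le> G x"
    and K: "(\<integral>\<^sup>+x. ennreal (exp (s * G x)) \<partial>M) \<le> ennreal K" "0 \<le> K"
    and s: "0 < s" "\<bar>l\<bar> \<le> s / 2"
  shows "(\<integral>\<^sup>+x. ennreal (exp (l * Y x)) \<partial>M) \<le> ennreal (1 + 8 * K / s\<^sup>2 * l\<^sup>2)"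
proof -
  note [measurable] = G(1)
  have int: "integrable M (\<lambda>x. exp (s * G x))"
    using K by (intro integrableI_bounded) (auto simp: le_less_trans)
  have intK: "expectation (\<lambda>x. exp (s * G x)) \<le> K"
    using K by (subst (asm) nn_integral_eq_integral[OF int]) auto
  \<comment> \<open>The exponential moment is spent in two halves: Y^2 \<le> G^2 \<le> (8 / s^2) exp
    (s G / 2), and exp |l Y| \<le> exp (s G / 2) since |l| \<le> s / 2.\<close>
  define c where "c = 8 * l\<^sup>2 / s\<^sup>2"
  have pt: "exp (l * Y x) \<le> 1 + l * Y x + c * exp (s * G x)" if x: "x \<in> space M" for x
  proof -
    have G0: "0 \<le> G x" using G(2)[OF x] by linarith
    have a: "\<bar>l * Y x\<bar> \<le> s / 2 * G x"
      unfolding abs_mult using s G(2)[OF x] by (intro mult_mono) auto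
    have "(Y x)\<^sup>2 \<le> (G x)\<^sup>2"
      using G(2)[OF x] G0 by (simp add: power2_le_iff_abs_le)
    also have "(G x)\<^sup>2 = 4 / s\<^sup>2 * (s / 2 * G x)\<^sup>2"
      using s by (simp add: power2_eq_square)
    also have "\<dots> \<le> 4 / s\<^sup>2 * (2 * exp (s / 2 * G x))"
      using G0 s by (intro mult_left_mono power2_le_exp) auto
    finally have "l\<^sup>2 * (Y x)\<^sup>2 \<le> l\<^sup>2 * (4 / s\<^sup>2 * (2 * exp (s / 2 * G x)))"
      by (intro mult_left_mono) auto
    then have "(l * Y x)\<^sup>2 * exp \<bar>l * Y x\<bar> \<le> (c * exp (s / 2 * G x)) * exp (s / 2 * G x)"
      using a by (intro mult_mono) (auto simp: c_def power_mult_distrib ac_simps)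
    also have "\<dots> = c * exp (s * G x)"
      by (simp flip: exp_add)
    finally have "(l * Y x)\<^sup>2 * exp \<bar>l * Y x\<bar> \<le> c * exp (s * G x)" .
    moreover have "0 \<le> (l * Y x)\<^sup>2 * exp \<bar>l * Y x\<bar>"
      by simp
    ultimately show ?thesis
      using exp_le_quadratic[of "l * Y x"] by linarith
  qed
  have "(\<integral>\<^sup>+x. ennreal (exp (l * Y x)) \<partial>M) \<le> (\<integral>\<^sup>+x. ennreal (1 + l * Y x + c * exp (s * G x)) \<partial>M)"
    by (intro nn_integral_mono ennreal_leI pt)
  also have "\<dots> = ennreal (expectation (\<lambda>x. 1 + l * Y x + c * exp (s * G x)))"
  proof (rule nn_integral_eq_integral)
    show "AE x in M. 0 \<le> 1 + l * Y x + c * exp (s * G x)"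
      by (intro AE_I2) (rule order.trans[OF _ pt], auto)
  qed (use Y int in auto)
  also have "expectation (\<lambda>x. 1 + l * Y x + c * exp (s * G x)) = 1 + c * expectation (\<lambda>x. exp (s * G x))"
    using Y int by (simp add: prob_space)
  also have "\<dots> \<le> 1 + c * K"
    using intK by (intro add_left_mono mult_left_mono) (auto simp: c_def)
  finally show ?thesis
    by (simp add: c_def ac_simps ennreal_leI)
qed

text \<open>From x \<le> exp x at x = l |t| / q one gets |t|^q \<le> (q / l)^q exp (l |t|), and the
  last exponential is at most the sum of the two one-sided ones.\<close>

lemma nn_integral_abs_powr_le_exp:
  fixes S :: "'a \<Rightarrow> real"
  assumes [measurable]: "S \<in> borel_measurable M" and l: "0 < l" and q: "0 < q" and K: "0 \<le> K"
    and pos: "(\<integral>\<^sup>+x. ennreal (exp (l * S x)) \<partial>M) \<le> ennreal K"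
    and neg: "(\<integral>\<^sup>+x. ennreal (exp (- l * S x)) \<partial>M) \<le> ennreal K"
  shows "(\<integral>\<^sup>+x. ennreal (\<bar>S x\<bar> powr q) \<partial>M) \<le> ennreal ((q / l) powr q * (2 * K))"
proof -
  define c where "c = (q / l) powr q"
  have "\<bar>t\<bar> powr q \<le> c * (exp (l * t) + exp (- l * t))" for t
  proof -
    have "l * \<bar>t\<bar> / q \<le> exp (l * \<bar>t\<bar> / q)"
      using exp_ge_add_one_self[of "l * \<bar>t\<bar> / q"] by linarith
    then have "\<bar>t\<bar> \<le> q / l * exp (l * \<bar>t\<bar> / q)"
      using l q by (simp add: field_simps)
    then have "\<bar>t\<bar> powr q \<le> (q / l * exp (l * \<bar>t\<bar> / q)) powr q"
      using q by (intro powr_mono2) auto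
    also have "\<dots> = c * exp (l * \<bar>t\<bar>)"
      using l q by (subst powr_mult) (auto simp: c_def exp_powr_real)
    also have "exp (l * \<bar>t\<bar>) \<le> exp (l * t) + exp (- l * t)"
      by (auto simp: abs_if add_increasing add_increasing2)
    finally show ?thesis
      by (simp add: c_def mult_left_mono)
  qed
  then have "(\<integral>\<^sup>+x. ennreal (\<bar>S x\<bar> powr q) \<partial>M)
      \<le> (\<integral>\<^sup>+x. ennreal c * (ennreal (exp (l * S x)) + ennreal (exp (- l * S x))) \<partial>M)"
    by (intro nn_integral_mono) (simp add: c_def ennreal_leI flip: ennreal_plus ennreal_mult'')
  also have "\<dots> = ennreal c * ((\<integral>\<^sup>+x. ennreal (exp (l * S x)) \<partial>M) + (\<integral>\<^sup>+x. ennreal (exp (- l * S x)) \<partial>M))"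
    by (simp add: nn_integral_cmult nn_integral_add)
  also have "\<dots> \<le> ennreal c * (ennreal K + ennreal K)"
    by (intro mult_left_mono add_mono pos neg) auto
  also have "\<dots> = ennreal (c * (2 * K))"
    using K by (simp add: c_def flip: ennreal_plus ennreal_mult'')
  finally show ?thesis
    by (simp add: c_def)
qed

text \<open>The sum is normalized by sqrt N. At l / sqrt N with |l| = s / 2 the assumed bound reads
  (1 + 2 K / N)^N \<le> exp (2 K), uniformly in N; the remaining factor 1 / sqrt N of the average
  gives N^(-q/2). The assumption concerns the integral of the product, so both independence patterns
  below, sample points alone and pairs of point and noise, can be fed in.\<close>

lemma nn_integral_average_powr_le:
  fixes Y :: "nat \<Rightarrow> 'a \<Rightarrow> real"
  assumes N: "1 \<le> N" and Y[measurable]: "\<And>n. n \<in> {1..N} \<Longrightarrow> Y n \<in> borel_measurable M"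
    and s: "0 < s" and q: "0 < q" and K: "0 \<le> K" and b: "0 \<le> b"
    and mgf: "\<And>l. \<bar>l\<bar> \<le> s / 2 \<Longrightarrow>
      (\<integral>\<^sup>+x. (\<Prod>n\<in>{1..N}. ennreal (exp (l * Y n x))) \<partial>M) \<le> ennreal (1 + 8 * K / s\<^sup>2 * l\<^sup>2) ^ N"
  shows "(\<integral>\<^sup>+x. ennreal (\<bar>b * (1 / real N * (\<Sum>n=1..N. Y n x))\<bar> powr q) \<partial>M)
     \<le> ennreal ((2 * q / s) powr q * (2 * exp (2 * K)) * (b powr q * real N powr (- (q / 2))))"
proof -
  define S where "S x = (\<Sum>n=1..N. Y n x) / sqrt (real N)" for x
  have [measurable]: "S \<in> borel_measurable M"
    unfolding S_def by measurable
  have N0: "0 < real N" using N by simp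
  have "(\<integral>\<^sup>+x. ennreal (exp (l * S x)) \<partial>M) \<le> ennreal (exp (2 * K))" if l: "\<bar>l\<bar> = s / 2" for l
  proof -
    have "\<bar>l / sqrt (real N)\<bar> \<le> s / 2 / 1"
      unfolding abs_divide l using s N by (intro divide_left_mono) auto
    then have "\<bar>l / sqrt (real N)\<bar> \<le> s / 2" by simp
    from mgf[OF this] have "(\<integral>\<^sup>+x. (\<Prod>n\<in>{1..N}. ennreal (exp (l / sqrt (real N) * Y n x))) \<partial>M)
        \<le> ennreal (1 + 8 * K / s\<^sup>2 * (l / sqrt (real N))\<^sup>2) ^ N" .
    also have "(\<lambda>x. \<Prod>n\<in>{1..N}. ennreal (exp (l / sqrt (real N) * Y n x))) = (\<lambda>x. ennreal (exp (l * S x)))"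
      by (simp add: prod_ennreal S_def sum_divide_distrib sum_distrib_left exp_sum flip: exp_sum)
    also have "8 * K / s\<^sup>2 * (l / sqrt (real N))\<^sup>2 = 2 * K / real N"
    proof -
      have "l\<^sup>2 = (s / 2)\<^sup>2"
        using l by (metis power2_abs)
      then show ?thesis
        using s N0 by (simp add: power_divide power2_eq_square field_simps)
    qed
    also have "ennreal (1 + 2 * K / real N) ^ N \<le> ennreal (exp (2 * K / real N)) ^ N"
      by (intro power_mono ennreal_leI) auto
    also have "\<dots> = ennreal (exp (2 * K))"
      using N0 by (simp add: ennreal_power flip: exp_of_nat_mult)
    finally show ?thesis .
  qed
  from this[of "s / 2"] this[of "- (s / 2)"] s
  have S: "(\<integral>\<^sup>+x. ennreal (\<bar>S x\<bar> powr q) \<partial>M) \<le> ennreal ((q / (s / 2)) powr q * (2 * exp (2 * K)))"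
    by (intro nn_integral_abs_powr_le_exp q) auto
  have eq: "\<bar>b * (1 / real N * (\<Sum>n=1..N. Y n x))\<bar> powr q = b powr q * real N powr (- (q / 2)) * \<bar>S x\<bar> powr q" for x
  proof -
    have "\<bar>b * (1 / real N * (\<Sum>n=1..N. Y n x))\<bar> = b * (\<bar>S x\<bar> / sqrt (real N))"
    proof -
      have "1 / real N * \<bar>\<Sum>n=1..N. Y n x\<bar> = \<bar>\<Sum>n=1..N. Y n x\<bar> / sqrt (real N) / sqrt (real N)"
        using N0 by simp
      then show ?thesis
        using b N0 by (simp only: S_def abs_mult abs_divide) simp
    qed
    also have "\<dots> powr q = b powr q * real N powr (- (q / 2)) * \<bar>S x\<bar> powr q"
    proof -
      have "sqrt (real N) powr q = real N powr (q / 2)"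
        using powr_powr[of "real N" "1 / 2" q] N0 by (simp add: powr_half_sqrt)
      moreover have "(b * (\<bar>S x\<bar> / sqrt (real N))) powr q = b powr q * (\<bar>S x\<bar> powr q / sqrt (real N) powr q)"
        using b N0 by (simp add: powr_mult powr_divide)
      ultimately show ?thesis
        by (simp only: powr_minus divide_inverse ac_simps)
    qed
    finally show ?thesis .
  qed
  have "(\<integral>\<^sup>+x. ennreal (\<bar>b * (1 / real N * (\<Sum>n=1..N. Y n x))\<bar> powr q) \<partial>M)
      = ennreal (b powr q * real N powr (- (q / 2))) * (\<integral>\<^sup>+x. ennreal (\<bar>S x\<bar> powr q) \<partial>M)"
    unfolding eq by (simp add: ennreal_mult' nn_integral_cmult)
  also have "\<dots> \<le> ennreal (b powr q * real N powr (- (q / 2))) * ennreal ((q / (s / 2)) powr q * (2 * exp (2 * K)))"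
    by (intro mult_left_mono S) auto
  also have "\<dots> = ennreal ((2 * q / s) powr q * (2 * exp (2 * K)) * (b powr q * real N powr (- (q / 2))))"
    by (simp add: ac_simps flip: ennreal_mult'')
  finally show ?thesis .
qed

text \<open>After centring and division by b the summands are bounded by 2, so that the constants
  are absolute up to q and all dependence on h sits in b powr q. This homogeneity is what permits
  summation over the atoms.\<close>

lemma (in prob_space) sampling_average_moment:
  fixes h :: "'u \<Rightarrow> real"
  assumes u: "indep_vars (\<lambda>_. \<mu>) u {1..N}" "\<And>n. n \<in> {1..N} \<Longrightarrow> distr M \<mu> (u n) = \<mu>"
    and \<mu>: "prob_space \<mu>" and h[measurable]: "h \<in> borel_measurable \<mu>"
    and b: "\<And>v. v \<in> space \<mu> \<Longrightarrow> \<bar>h v\<bar> \<le> b" and q: "0 < q" and N: "1 \<le> N"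
  shows "(\<integral>\<^sup>+x. ennreal (\<bar>1 / real N * (\<Sum>n=1..N. h (u n x)) - (\<integral>v. h v \<partial>\<mu>)\<bar> powr q) \<partial>M)
     \<le> ennreal ((2 * q) powr q * (2 * exp (2 * exp 2)) * (b powr q * real N powr (- (q / 2))))"
proof -
  interpret \<mu>: prob_space \<mu> by fact
  have [measurable]: "n \<in> {1..N} \<Longrightarrow> u n \<in> measurable M \<mu>" for n
    using u(1) by (auto simp: indep_vars_def)
  have int: "integrable \<mu> h"
    using b by (intro \<mu>.integrable_const_bound[where B = b]) auto
  obtain v0 where v0: "v0 \<in> space \<mu>"
    using \<mu>.not_empty by blast
  have b0: "0 \<le> b"
    using b[OF v0] by linarith
  define I where "I = (\<integral>v. h v \<partial>\<mu>)"
  have I: "\<bar>I\<bar> \<le> b"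
    unfolding I_def abs_le_iff using b int
    by (auto simp: abs_le_iff intro!: \<mu>.integral_le_const simp flip: integral_minus)
  \<comment> \<open>If b = 0, division yields 0, which is consistent: then h and I vanish as well
    and \<open>hY\<close> still holds.\<close>
  define Y where "Y v = (h v - I) / b" for v
  have hY: "h v - I = b * Y v" if v: "v \<in> space \<mu>" for v
    using I b[OF v] by (cases "b = 0") (auto simp: Y_def)
  have [measurable]: "Y \<in> borel_measurable \<mu>"
    unfolding Y_def by measurable
  \<comment> \<open>The envelope is the constant 2 and s = 1, whence the exponential moment exp
    2.\<close>
  have mgf: "(\<integral>\<^sup>+v. ennreal (exp (l * Y v)) \<partial>\<mu>) \<le> ennreal (1 + 8 * exp 2 / 1\<^sup>2 * l\<^sup>2)" if "\<bar>l\<bar> \<le> 1 / 2" for l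
  proof (rule \<mu>.nn_integral_exp_le[where G = "\<lambda>_. 2"])
    show "integrable \<mu> Y" "\<mu>.expectation Y = 0"
      unfolding Y_def using int by (simp_all add: I_def \<mu>.prob_space)
    show "\<bar>Y v\<bar> \<le> 2" if "v \<in> space \<mu>" for v
      using I b[OF that] b0 by (cases "b = 0") (auto simp: Y_def field_simps abs_le_iff)
  qed (use that in \<open>auto simp: \<mu>.emeasure_space_1\<close>)
  have moment: "(\<integral>\<^sup>+x. ennreal (\<bar>b * (1 / real N * (\<Sum>n=1..N. Y (u n x)))\<bar> powr q) \<partial>M)
     \<le> ennreal ((2 * q / 1) powr q * (2 * exp (2 * exp 2)) * (b powr q * real N powr (- (q / 2))))"
  proof (rule nn_integral_average_powr_le[OF N])
    fix l :: real assume l: "\<bar>l\<bar> \<le> 1 / 2"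
    have "(\<integral>\<^sup>+x. (\<Prod>n\<in>{1..N}. ennreal (exp (l * Y (u n x)))) \<partial>M)
        = (\<Prod>n\<in>{1..N}. \<integral>\<^sup>+x. ennreal (exp (l * Y (u n x))) \<partial>M)"
    proof (rule indep_vars_nn_integral)
      show "indep_vars (\<lambda>_. borel) (\<lambda>n x. ennreal (exp (l * Y (u n x)))) {1..N}"
        by (rule indep_vars_compose2[OF u(1)]) measurable
    qed auto
    also have "\<dots> = (\<Prod>n\<in>{1..N}. \<integral>\<^sup>+v. ennreal (exp (l * Y v)) \<partial>\<mu>)"
    proof (rule prod.cong[OF refl])
      fix n assume n: "n \<in> {1..N}"
      have "(\<integral>\<^sup>+v. ennreal (exp (l * Y v)) \<partial>\<mu>) = (\<integral>\<^sup>+v. ennreal (exp (l * Y v)) \<partial>distr M \<mu> (u n))"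
        using u(2)[OF n] by simp
      also have "\<dots> = (\<integral>\<^sup>+x. ennreal (exp (l * Y (u n x))) \<partial>M)"
        using n by (subst nn_integral_distr) auto
      finally show "(\<integral>\<^sup>+x. ennreal (exp (l * Y (u n x))) \<partial>M) = (\<integral>\<^sup>+v. ennreal (exp (l * Y v)) \<partial>\<mu>)" ..
    qed
    also have "\<dots> \<le> ennreal (1 + 8 * exp 2 / 1\<^sup>2 * l\<^sup>2) ^ N"
      using power_mono[OF mgf[OF l], of N] by simp
    finally show "(\<integral>\<^sup>+x. (\<Prod>n\<in>{1..N}. ennreal (exp (l * Y (u n x)))) \<partial>M) \<le> ennreal (1 + 8 * exp 2 / 1\<^sup>2 * l\<^sup>2) ^ N" .
  qed (use q b0 in auto)
  have "b * (1 / real N * (\<Sum>n=1..N. Y (u n x))) = 1 / real N * (\<Sum>n=1..N. h (u n x)) - I"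
    if x: "x \<in> space M" for x
  proof -
    have "u n x \<in> space \<mu>" if "n \<in> {1..N}" for n
      using that x by (auto intro: measurable_space)
    then have "b * (\<Sum>n=1..N. Y (u n x)) = (\<Sum>n=1..N. h (u n x) - I)"
      by (simp add: sum_distrib_left hY)
    also have "\<dots> = (\<Sum>n=1..N. h (u n x)) - real N * I"
      by (simp add: sum_subtractf)
    finally show ?thesis
      using N by (simp add: field_simps)
  qed
  then have eq: "(\<integral>\<^sup>+x. ennreal (\<bar>b * (1 / real N * (\<Sum>n=1..N. Y (u n x)))\<bar> powr q) \<partial>M)
      = (\<integral>\<^sup>+x. ennreal (\<bar>1 / real N * (\<Sum>n=1..N. h (u n x)) - I\<bar> powr q) \<partial>M)"
    by (intro nn_integral_cong) (simp only:)
  show ?thesis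
    using moment unfolding I_def[symmetric] eq by simp
qed

text \<open>Conditioning on the sample points: the joint law of the two vectors is a product, so
  Tonelli applies; for fixed points the inner integral factorizes by independence of the noise, and
  each factor is at most c whatever the point.\<close>

lemma (in prob_space) nn_integral_prod_indep_pairs_le:
  fixes g :: "'u \<Rightarrow> 'e \<Rightarrow> ennreal"
  assumes I: "finite I" "I \<noteq> {}"
    and u[measurable]: "\<And>n. n \<in> I \<Longrightarrow> u n \<in> measurable M \<mu>"
    and e: "indep_vars (\<lambda>_. B) e I" "\<And>n. n \<in> I \<Longrightarrow> distr M B (e n) = \<nu>"
    and \<nu>: "prob_space \<nu>" "sets \<nu> = sets B"
    and indep: "indep_set {(\<lambda>x. \<lambda>n\<in>I. u n x) -` S \<inter> space M | S. S \<in> sets (\<Pi>\<^sub>M n\<in>I. \<mu>)}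
             {(\<lambda>x. \<lambda>n\<in>I. e n x) -` S \<inter> space M | S. S \<in> sets (\<Pi>\<^sub>M n\<in>I. B)}"
    and g[measurable]: "(\<lambda>(v, y). g v y) \<in> borel_measurable (\<mu> \<Otimes>\<^sub>M B)"
    and le: "\<And>v. v \<in> space \<mu> \<Longrightarrow> (\<integral>\<^sup>+y. g v y \<partial>\<nu>) \<le> c"
  shows "(\<integral>\<^sup>+x. (\<Prod>n\<in>I. g (u n x) (e n x)) \<partial>M) \<le> c ^ card I"
proof -
  have e_meas[measurable]: "e n \<in> measurable M B" if "n \<in> I" for n
    using e(1) that by (auto simp: indep_vars_def)
  let ?P = "\<Pi>\<^sub>M n\<in>I. \<mu>" and ?Q = "\<Pi>\<^sub>M n\<in>I. B" and ?Qn = "\<Pi>\<^sub>M n\<in>I. \<nu>"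
  let ?X = "\<lambda>x. \<lambda>n\<in>I. u n x" and ?Y = "\<lambda>x. \<lambda>n\<in>I. e n x"
  have X: "?X \<in> measurable M ?P" and Y: "?Y \<in> measurable M ?Q"
    by (auto intro!: measurable_restrict)
  interpret PX: prob_space "distr M ?P ?X" by (rule prob_space_distr[OF X])
  interpret PY: prob_space "distr M ?Q ?Y" by (rule prob_space_distr[OF Y])
  interpret \<nu>: prob_space \<nu> by fact
  interpret pr: product_sigma_finite "\<lambda>_. \<nu>" by standard
  have distrY: "distr M ?Q ?Y = ?Qn"
  proof -
    have "distr M ?Q ?Y = (\<Pi>\<^sub>M n\<in>I. distr M B (e n))"
      using e(1) I by (subst (asm) indep_vars_iff_distr_eq_PiM') auto
    also have "\<dots> = ?Qn"
      by (intro PiM_cong) (auto simp: e(2))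
    finally show ?thesis .
  qed
  \<comment> \<open>Independence of the two generated families of events is exactly the product
    formula on rectangles, which determines the joint law.\<close>
  have pair: "distr M ?P ?X \<Otimes>\<^sub>M distr M ?Q ?Y = distr M (?P \<Otimes>\<^sub>M ?Q) (\<lambda>x. (?X x, ?Y x))"
  proof (rule pair_measure_eqI)
    fix S T assume S: "S \<in> sets (distr M ?P ?X)" and T: "T \<in> sets (distr M ?Q ?Y)"
    have ST: "S \<times> T \<in> sets (?P \<Otimes>\<^sub>M ?Q)"
      using S T by auto
    have "emeasure (distr M (?P \<Otimes>\<^sub>M ?Q) (\<lambda>x. (?X x, ?Y x))) (S \<times> T)
        = emeasure M ((\<lambda>x. (?X x, ?Y x)) -` (S \<times> T) \<inter> space M)"
      using X Y ST by (intro emeasure_distr measurable_Pair) auto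
    also have "(\<lambda>x. (?X x, ?Y x)) -` (S \<times> T) \<inter> space M = (?X -` S \<inter> space M) \<inter> (?Y -` T \<inter> space M)"
      by auto
    also have "emeasure M \<dots> = ennreal (prob (?X -` S \<inter> space M) * prob (?Y -` T \<inter> space M))"
      unfolding emeasure_eq_measure using S T by (subst indep_setD[OF indep]) auto
    also have "\<dots> = emeasure (distr M ?P ?X) S * emeasure (distr M ?Q ?Y) T"
      using S T X Y by (simp add: emeasure_distr emeasure_eq_measure ennreal_mult')
    finally show "emeasure (distr M ?P ?X) S * emeasure (distr M ?Q ?Y) T
        = emeasure (distr M (?P \<Otimes>\<^sub>M ?Q) (\<lambda>x. (?X x, ?Y x))) (S \<times> T)" ..
  qed (auto intro: PX.sigma_finite_measure_axioms PY.sigma_finite_measure_axioms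
        simp: sets_pair_eq_sets_fst_snd cong: sets_pair_measure_cong)
  let ?G = "\<lambda>z. \<Prod>n\<in>I. g (fst z n) (snd z n)"
  have G[measurable]: "?G \<in> borel_measurable (?P \<Otimes>\<^sub>M ?Q)"
  proof (rule borel_measurable_prod_ennreal)
    fix n assume n: "n \<in> I"
    have "(\<lambda>z. (fst z n, snd z n)) \<in> measurable (?P \<Otimes>\<^sub>M ?Q) (\<mu> \<Otimes>\<^sub>M B)"
      using n by measurable
    from measurable_compose[OF this g] show "(\<lambda>z. g (fst z n) (snd z n)) \<in> borel_measurable (?P \<Otimes>\<^sub>M ?Q)"
      by simp
  qed
  have "(\<integral>\<^sup>+x. (\<Prod>n\<in>I. g (u n x) (e n x)) \<partial>M) = (\<integral>\<^sup>+x. ?G (?X x, ?Y x) \<partial>M)"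
    by simp
  also have "\<dots> = (\<integral>\<^sup>+z. ?G z \<partial>distr M (?P \<Otimes>\<^sub>M ?Q) (\<lambda>x. (?X x, ?Y x)))"
    using X Y by (subst nn_integral_distr) auto
  also have "\<dots> = (\<integral>\<^sup>+z. ?G z \<partial>(distr M ?P ?X \<Otimes>\<^sub>M distr M ?Q ?Y))"
    by (simp only: pair)
  also have "\<dots> = (\<integral>\<^sup>+v. \<integral>\<^sup>+y. ?G (v, y) \<partial>distr M ?Q ?Y \<partial>distr M ?P ?X)"
    by (rule PY.nn_integral_fst[symmetric]) (simp add: measurable_cong_sets[OF sets_pair_measure_cong[OF sets_distr sets_distr] refl] G)
  also have "\<dots> \<le> (\<integral>\<^sup>+v. c ^ card I \<partial>distr M ?P ?X)"
  proof (rule nn_integral_mono)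
    fix v assume "v \<in> space (distr M ?P ?X)"
    then have v: "v n \<in> space \<mu>" if "n \<in> I" for n
      using that by (auto simp: space_PiM)
    have "(\<integral>\<^sup>+y. ?G (v, y) \<partial>distr M ?Q ?Y) = (\<Prod>n\<in>I. \<integral>\<^sup>+y. g (v n) y \<partial>\<nu>)"
      unfolding distrY fst_conv snd_conv
    proof (rule pr.product_nn_integral_prod[OF I(1)])
      fix n assume n: "n \<in> I"
      show "g (v n) \<in> borel_measurable \<nu>"
        unfolding measurable_cong_sets[OF \<nu>(2) refl]
        using measurable_Pair2[OF g v[OF n]] by simp
    qed
    also have "\<dots> \<le> (\<Prod>n\<in>I. c)"
      by (intro prod_mono_ennreal le v)
    finally show "(\<integral>\<^sup>+y. ?G (v, y) \<partial>distr M ?Q ?Y) \<le> c ^ card I"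
      by simp
  qed
  also have "\<dots> = c ^ card I"
    using PX.emeasure_space_1 by (simp del: space_distr)
  finally show ?thesis .
qed

text \<open>Continuous functions on \<open>U\<close> are pointwise limits of functions with countably many values;
  without this the inner product need not be jointly measurable, as \<open>'v\<close> may be nonseparable.\<close>

lemma borel_measurable_inner_continuous:
  fixes a :: "'u::euclidean_space \<Rightarrow> 'v::real_inner"
  assumes a: "continuous_on U a" and \<mu>: "sets \<mu> = sets (restrict_space borel U)"
  shows "(\<lambda>(v, y). y \<bullet> a v) \<in> borel_measurable (\<mu> \<Otimes>\<^sub>M borel)"
proof -
  have sp: "space \<mu> = U"
    using sets_eq_imp_space_eq[OF \<mu>] by (simp add: space_restrict_space)
  have id[measurable]: "(\<lambda>v. v) \<in> measurable \<mu> borel"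
    unfolding measurable_cong_sets[OF \<mu> refl] by (intro measurable_restrict_space1) simp
  obtain T where T: "countable T" "T \<subseteq> U" "U \<subseteq> closure T"
    using separable[of U] .
  define d where "d = from_nat_into T"
  \<comment> \<open>Index of the first point of a countable dense subset of \<open>U\<close> within
    distance 1 / (k + 1) of v. Replacing v by that point gives the approximations with countably
    many values.\<close>
  define i where "i k v = (LEAST n. dist v (d n) < inverse (real (Suc k)))" for k v
  have i: "dist v (d (i k v)) < inverse (real (Suc k))" "d (i k v) \<in> U" if v: "v \<in> U" for k v
  proof -
    from v T(3) have "v \<in> closure T" by blast
    then obtain t where t: "t \<in> T" "dist t v < inverse (real (Suc k))"
      unfolding closure_approachable by (meson inverse_positive_iff_positive of_nat_0_less_iff zero_less_Suc)
    then obtain n where "t = d n"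
      using T(1) by (metis d_def from_nat_into_to_nat_on)
    with t show "dist v (d (i k v)) < inverse (real (Suc k))"
      unfolding i_def by (intro LeastI) (auto simp: dist_commute)
    show "d (i k v) \<in> U"
      using t(1) T(2) from_nat_into[of T] by (auto simp: d_def)
  qed
  show ?thesis
  proof (rule borel_measurable_LIMSEQ_real[where u = "\<lambda>k z. snd z \<bullet> a (d (i k (fst z)))"])
    fix z assume "z \<in> space (\<mu> \<Otimes>\<^sub>M (borel :: 'v measure))"
    then have v: "fst z \<in> U"
      by (auto simp: space_pair_measure sp)
    have "(\<lambda>k. d (i k (fst z))) \<longlonglongrightarrow> fst z"
    proof (rule metric_tendsto_imp_tendsto[OF LIMSEQ_inverse_real_of_nat])
      show "\<forall>\<^sub>F k in sequentially. dist (d (i k (fst z))) (fst z) \<le> dist (inverse (real (Suc k))) 0"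
        using i(1)[OF v] by (intro always_eventually) (auto simp: dist_commute intro: less_imp_le)
    qed
    then have "(\<lambda>k. a (d (i k (fst z)))) \<longlonglongrightarrow> a (fst z)"
      using i(2)[OF v] v by (intro continuous_on_tendsto_compose[OF a]) auto
    then show "(\<lambda>k. snd z \<bullet> a (d (i k (fst z)))) \<longlonglongrightarrow> (case z of (v, y) \<Rightarrow> y \<bullet> a v)"
      by (auto simp: split_beta intro!: tendsto_intros)
  next
    fix k
    have [measurable]: "(\<lambda>v. i k v) \<in> measurable \<mu> (count_space UNIV)"
      unfolding i_def by measurable
    show "(\<lambda>z. snd z \<bullet> a (d (i k (fst z)))) \<in> borel_measurable (\<mu> \<Otimes>\<^sub>M borel)"
    \<comment> \<open>For each fixed index the inner product is taken with one fixed vector, hence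
      depends measurably on the second component; the index itself is measurable and takes countably
      many values.\<close>
    proof (rule measurable_compose_countable[where f = "\<lambda>n z. snd z \<bullet> a (d n)"])
      fix n
      have "(\<lambda>y. y \<bullet> a (d n)) \<in> borel_measurable borel"
        by (intro borel_measurable_continuous_onI continuous_intros)
      from measurable_compose[OF measurable_snd this]
      show "(\<lambda>z. snd z \<bullet> a (d n)) \<in> borel_measurable (\<mu> \<Otimes>\<^sub>M borel)" .
    qed measurable
  qed
qed

text \<open>The factorial in the moment condition cancels the one in the exponential series, leaving
  a geometric series once s \<Sigma> = 1/2.\<close>

lemma noise_law_exp_moment:
  fixes \<nu> :: "'v::real_inner measure"
  assumes "noise_law \<nu>"
  shows "\<exists>s>0. \<exists>K\<ge>0. (\<integral>\<^sup>+e. ennreal (exp (s * norm e)) \<partial>\<nu>) \<le> ennreal K"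
proof -
  from assms obtain \<Sigma> where \<Sigma>: "0 < \<Sigma>"
    and mom: "\<And>l. 2 \<le> l \<Longrightarrow> (\<integral>\<^sup>+e. ennreal (norm e ^ l) \<partial>\<nu>) < ennreal (fact l / 2 * \<Sigma> ^ (l - 2))"
    and \<nu>: "prob_space \<nu>" "sets \<nu> = sets borel"
    by (auto simp: noise_law_def)
  interpret \<nu>: prob_space \<nu> by fact
  have [measurable]: "norm \<in> borel_measurable \<nu>"
    unfolding measurable_cong_sets[OF \<nu>(2) refl] by simp
  define s where "s = 1 / (2 * \<Sigma>)"
  have s: "0 < s" using \<Sigma> by (simp add: s_def)
  \<comment> \<open>The three summands cover the orders l = 0, l = 1 (first moment at most 2, times
    s, against the factor 1/2) and l \<ge> 2 (a contribution of 2 s^2 / 2^l).\<close>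
  define C where "C = 1 + 4 * s + 2 * s\<^sup>2"
  \<comment> \<open>The hypothesis starts at order 2, where it says that the second moment is below
    1; the first moment follows from |e| \<le> 1 + |e|^2.\<close>
  have first: "(\<integral>\<^sup>+e. ennreal (norm e) \<partial>\<nu>) \<le> ennreal 2"
  proof -
    have "norm e \<le> 1 + norm e ^ 2" for e :: 'v
    proof -
      have "2 * norm e \<le> norm e ^ 2 + 1"
        using sum_squares_bound[of "norm e" 1] by simp
      then show ?thesis
        using zero_le_power2[of "norm e"] by linarith
    qed
    then have "(\<integral>\<^sup>+e. ennreal (norm e) \<partial>\<nu>) \<le> (\<integral>\<^sup>+e. 1 + ennreal (norm e ^ 2) \<partial>\<nu>)"
      by (intro nn_integral_mono) (metis ennreal_1 ennreal_leI ennreal_plus zero_le_one zero_le_power2)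
    also have "\<dots> = 1 + (\<integral>\<^sup>+e. ennreal (norm e ^ 2) \<partial>\<nu>)"
      by (subst nn_integral_add) (auto simp: \<nu>.emeasure_space_1)
    also have "\<dots> \<le> 1 + ennreal 1"
      using mom[of 2] by (intro add_left_mono) (auto simp: less_imp_le)
    finally show ?thesis
      by (simp flip: ennreal_numeral)
  qed
  have moment: "(\<integral>\<^sup>+e. ennreal ((s * norm e) ^ l / fact l) \<partial>\<nu>) \<le> ennreal (C * (1 / 2) ^ l)" for l
  proof -
    have eq: "(\<integral>\<^sup>+e. ennreal ((s * norm e) ^ l / fact l) \<partial>\<nu>) = ennreal (s ^ l / fact l) * (\<integral>\<^sup>+e. ennreal (norm e ^ l) \<partial>\<nu>)"
      using s by (subst nn_integral_cmult[symmetric]) (auto simp: power_mult_distrib simp flip: ennreal_mult'')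
    consider "l = 0" | "l = 1" | "2 \<le> l" by linarith
    then show ?thesis
    proof cases
      case 1
      then show ?thesis using s by (simp add: C_def \<nu>.emeasure_space_1)
    next
      case 2
      then have "(\<integral>\<^sup>+e. ennreal ((s * norm e) ^ l / fact l) \<partial>\<nu>) \<le> ennreal s * ennreal 2"
        unfolding eq using first by (simp add: mult_left_mono)
      also have "\<dots> \<le> ennreal (C * (1 / 2) ^ l)"
        using s 2 by (simp add: C_def flip: ennreal_mult'' del: ennreal_numeral)
      finally show ?thesis .
    next
      case 3
      have "(\<integral>\<^sup>+e. ennreal ((s * norm e) ^ l / fact l) \<partial>\<nu>) \<le> ennreal (s ^ l / fact l) * ennreal (fact l / 2 * \<Sigma> ^ (l - 2))"
        unfolding eq using mom[OF 3] by (intro mult_left_mono) (auto simp: less_imp_le)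
      also have "\<dots> = ennreal (s ^ l * \<Sigma> ^ (l - 2) / 2)"
        using s \<Sigma> by (simp flip: ennreal_mult'')
      also have "s ^ l * \<Sigma> ^ (l - 2) / 2 = 2 * s\<^sup>2 * (1 / 2) ^ l"
      proof -
        obtain k where k: "l = k + 2" using 3 by (metis add.commute le_Suc_ex)
        have "s ^ k * \<Sigma> ^ k = (1 / 2) ^ k"
          using \<Sigma> by (simp add: s_def flip: power_mult_distrib)
        then show ?thesis
          by (simp add: k power_add power2_eq_square)
      qed
      also have "ennreal (2 * s\<^sup>2 * (1 / 2) ^ l) \<le> ennreal (C * (1 / 2) ^ l)"
        using s by (intro ennreal_leI mult_right_mono) (auto simp: C_def)
      finally show ?thesis .
    qed
  qed
  have "(\<integral>\<^sup>+e. ennreal (exp (s * norm e)) \<partial>\<nu>) = (\<integral>\<^sup>+e. (\<Sum>l. ennreal ((s * norm e) ^ l / fact l)) \<partial>\<nu>)"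
  proof (rule nn_integral_cong)
    fix e :: 'v
    have "(\<lambda>l. (s * norm e) ^ l / fact l) sums exp (s * norm e)"
      using exp_converges[of "s * norm e"] by (simp add: divide_inverse mult.commute)
    then show "ennreal (exp (s * norm e)) = (\<Sum>l. ennreal ((s * norm e) ^ l / fact l))"
      using s by (intro suminf_ennreal_eq[symmetric]) auto
  qed
  also have "\<dots> = (\<Sum>l. \<integral>\<^sup>+e. ennreal ((s * norm e) ^ l / fact l) \<partial>\<nu>)"
    by (rule nn_integral_suminf) measurable
  also have "\<dots> \<le> (\<Sum>l. ennreal (C * (1 / 2) ^ l))"
    by (intro suminf_le moment) auto
  also have "\<dots> = ennreal (C * 2)"
  proof (rule suminf_ennreal_eq)
    show "(\<lambda>l. C * (1 / 2) ^ l) sums (C * 2)"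
      using geometric_sums[of "1 / 2 :: real"] by (intro sums_mult) simp
  qed (use s in \<open>auto simp: C_def\<close>)
  finally show ?thesis
    using s by (intro exI[of _ s] conjI exI[of _ "C * 2"]) (auto simp: C_def)
qed

text \<open>For a fixed point v the variable (y \<bullet> a v) / b is centred and dominated by the
  norm of y, so its exponential bound depends on the noise law only. The function a enters through b
  powr q alone.\<close>

lemma (in prob_space) noise_average_moment:
  fixes \<nu> :: "'v::real_inner measure" and a :: "'u::euclidean_space \<Rightarrow> 'v"
  assumes N: "1 \<le> N"
    and u: "\<And>n. n \<in> {1..N} \<Longrightarrow> u n \<in> measurable M \<mu>"
    and e: "indep_vars (\<lambda>_. borel) e {1..N}" "\<And>n. n \<in> {1..N} \<Longrightarrow> distr M borel (e n) = \<nu>"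
    and \<nu>: "noise_law \<nu>"
    and indep: "indep_set {(\<lambda>x. \<lambda>n\<in>{1..N}. u n x) -` S \<inter> space M | S. S \<in> sets (\<Pi>\<^sub>M n\<in>{1..N}. \<mu>)}
             {(\<lambda>x. \<lambda>n\<in>{1..N}. e n x) -` S \<inter> space M | S. S \<in> sets (\<Pi>\<^sub>M n\<in>{1..N}. borel)}"
    and a: "continuous_on U a" and \<mu>: "sets \<mu> = sets (restrict_space borel U)"
    and b: "0 \<le> b" "\<And>v. v \<in> U \<Longrightarrow> norm (a v) \<le> b" and q: "0 < q"
    and s: "0 < s" and K: "0 \<le> K" "(\<integral>\<^sup>+y. ennreal (exp (s * norm y)) \<partial>\<nu>) \<le> ennreal K"
  shows "(\<integral>\<^sup>+x. ennreal (\<bar>1 / real N * (\<Sum>n=1..N. e n x \<bullet> a (u n x))\<bar> powr q) \<partial>M)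
     \<le> ennreal ((2 * q / s) powr q * (2 * exp (2 * K)) * (b powr q * real N powr (- (q / 2))))"
proof -
  have \<nu>': "prob_space \<nu>" "sets \<nu> = sets borel" "\<And>v. integrable \<nu> (\<lambda>y. y \<bullet> v)" "\<And>v. (\<integral>y. y \<bullet> v \<partial>\<nu>) = 0"
    using \<nu> by (auto simp: noise_law_def)
  interpret \<nu>: prob_space \<nu> by fact
  have sp: "space \<mu> = U"
    using sets_eq_imp_space_eq[OF \<mu>] by (simp add: space_restrict_space)
  have e_meas[measurable]: "e n \<in> measurable M borel" if "n \<in> {1..N}" for n
    using e(1) that by (auto simp: indep_vars_def)
  note u[measurable]
  note inner_meas[measurable] = borel_measurable_inner_continuous[OF a \<mu>]
  have moment: "(\<integral>\<^sup>+x. ennreal (\<bar>b * (1 / real N * (\<Sum>n=1..N. (e n x \<bullet> a (u n x)) / b))\<bar> powr q) \<partial>M)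
     \<le> ennreal ((2 * q / s) powr q * (2 * exp (2 * K)) * (b powr q * real N powr (- (q / 2))))"
  proof (rule nn_integral_average_powr_le[OF N])
    show "(\<lambda>x. (e n x \<bullet> a (u n x)) / b) \<in> borel_measurable M" if n: "n \<in> {1..N}" for n
    proof -
      have "(\<lambda>x. (u n x, e n x)) \<in> measurable M (\<mu> \<Otimes>\<^sub>M borel)"
        using n by measurable
      from measurable_compose[OF this inner_meas] show ?thesis
        by simp
    qed
    fix l :: real assume l: "\<bar>l\<bar> \<le> s / 2"
    have "(\<integral>\<^sup>+x. (\<Prod>n\<in>{1..N}. ennreal (exp (l * ((e n x \<bullet> a (u n x)) / b)))) \<partial>M)
        \<le> ennreal (1 + 8 * K / s\<^sup>2 * l\<^sup>2) ^ card {1..N}"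
    proof (rule nn_integral_prod_indep_pairs_le[where g = "\<lambda>v y. ennreal (exp (l * ((y \<bullet> a v) / b)))" and B = borel])
      have "(\<lambda>z. ennreal (exp (l * ((case z of (v, y) \<Rightarrow> y \<bullet> a v) / b)))) \<in> borel_measurable (\<mu> \<Otimes>\<^sub>M borel)"
        by measurable
      then show "(\<lambda>(v, y). ennreal (exp (l * ((y \<bullet> a v) / b)))) \<in> borel_measurable (\<mu> \<Otimes>\<^sub>M borel)"
        by (simp add: split_beta')
      fix v assume v: "v \<in> space \<mu>"
      show "(\<integral>\<^sup>+y. ennreal (exp (l * ((y \<bullet> a v) / b))) \<partial>\<nu>) \<le> ennreal (1 + 8 * K / s\<^sup>2 * l\<^sup>2)"
      proof (rule \<nu>.nn_integral_exp_le[where G = norm])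
        show "integrable \<nu> (\<lambda>y. (y \<bullet> a v) / b)" "\<nu>.expectation (\<lambda>y. (y \<bullet> a v) / b) = 0"
          using \<nu>' by auto
        show "norm \<in> borel_measurable \<nu>"
          unfolding measurable_cong_sets[OF \<nu>'(2) refl] by simp
        fix y
        have "\<bar>y \<bullet> a v\<bar> \<le> norm y * norm (a v)"
          by (rule Cauchy_Schwarz_ineq2)
        also have "\<dots> \<le> norm y * b"
          using b(2)[of v] v sp by (intro mult_left_mono) auto
        finally show "\<bar>(y \<bullet> a v) / b\<bar> \<le> norm y"
          using b by (cases "b = 0") (auto simp: field_simps)
      qed (use K s l in auto)
    qed (use N u e \<nu>' indep in auto)
    then show "(\<integral>\<^sup>+x. (\<Prod>n\<in>{1..N}. ennreal (exp (l * ((e n x \<bullet> a (u n x)) / b)))) \<partial>M)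
        \<le> ennreal (1 + 8 * K / s\<^sup>2 * l\<^sup>2) ^ N"
      by simp
  qed (use s q K b in auto)
  \<comment> \<open>Undoes the normalization. For b = 0 the left side is 0, and so is the right side
    because a vanishes on \<open>U\<close>.\<close>
  have "b * (1 / real N * (\<Sum>n=1..N. (e n x \<bullet> a (u n x)) / b)) = 1 / real N * (\<Sum>n=1..N. e n x \<bullet> a (u n x))"
    if x: "x \<in> space M" for x
  proof (cases "b = 0")
    case True
    have "a (u n x) = 0" if "n \<in> {1..N}" for n
      using measurable_space[OF u[OF that] x] b(2)[of "u n x"] True sp by auto
    then show ?thesis
      using True by simp
  next
    case False
    then show ?thesis
      by (simp flip: sum_divide_distrib)
  qed
  then have eq: "(\<integral>\<^sup>+x. ennreal (\<bar>b * (1 / real N * (\<Sum>n=1..N. (e n x \<bullet> a (u n x)) / b))\<bar> powr q) \<partial>M)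
      = (\<integral>\<^sup>+x. ennreal (\<bar>1 / real N * (\<Sum>n=1..N. e n x \<bullet> a (u n x))\<bar> powr q) \<partial>M)"
    by (intro nn_integral_cong) (simp only:)
  show ?thesis
    using moment unfolding eq .
qed

section \<open>The expected error\<close>

context regularized_sampling
begin

context
  fixes \<nu> :: "'v measure" and M :: "'w measure"
    and u :: "nat \<Rightarrow> 'w \<Rightarrow> 'u" and \<epsilon> :: "nat \<Rightarrow> nat \<Rightarrow> 'w \<Rightarrow> 'v"
  assumes noise: "noise_law \<nu>"
    and sampling: "sampling_model M \<mu> \<nu> u \<epsilon>"
    and S2: "summable (\<lambda>j. m (\<Lambda> j) powr (-q) * sup_norm U (atom j) powr q)"
begin

section \<open>Consequences of the sampling model\<close>

lemma sampling_modelD: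
  shows "prob_space M"
    and "prob_space.indep_vars M (\<lambda>_. \<mu>) u {1..}"
    and "1 \<le> n \<Longrightarrow> distr M \<mu> (u n) = \<mu>"
    and "1 \<le> N \<Longrightarrow> prob_space.indep_vars M (\<lambda>_. borel) (\<epsilon> N) {1..N}"
    and "1 \<le> N \<Longrightarrow> n \<in> {1..N} \<Longrightarrow> distr M borel (\<epsilon> N n) = \<nu>"
    and "1 \<le> N \<Longrightarrow> prob_space.indep_set M
             {(\<lambda>x. \<lambda>n\<in>{1..N}. u n x) -` S \<inter> space M | S. S \<in> sets (\<Pi>\<^sub>M n\<in>{1..N}. \<mu>)}
             {(\<lambda>x. \<lambda>n\<in>{1..N}. \<epsilon> N n x) -` S \<inter> space M | S. S \<in> sets (\<Pi>\<^sub>M n\<in>{1..N}. borel)}"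
  using sampling unfolding sampling_model_def by simp_all

lemma measurable_u: "1 \<le> n \<Longrightarrow> u n \<in> measurable M \<mu>"
  using sampling_modelD(2) by (auto simp: prob_space.indep_vars_def[OF sampling_modelD(1)])

lemma measurable_\<epsilon>: "1 \<le> N \<Longrightarrow> n \<in> {1..N} \<Longrightarrow> \<epsilon> N n \<in> measurable M borel"
  using sampling_modelD(4) by (auto simp: prob_space.indep_vars_def[OF sampling_modelD(1)])

lemma u_in_U: "1 \<le> n \<Longrightarrow> x \<in> space M \<Longrightarrow> u n x \<in> U"
  using measurable_space[OF measurable_u] by (simp add: space_mu)

lemma borel_measurable_noise_average:
  assumes "1 \<le> N"
  shows "(\<lambda>x. 1 / real N * (\<Sum>n=1..N. \<epsilon> N n x \<bullet> J z (u n x))) \<in> borel_measurable M"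
proof (intro borel_measurable_times borel_measurable_const borel_measurable_sum)
  fix n assume n: "n \<in> {1..N}"
  have "(\<lambda>x. (u n x, \<epsilon> N n x)) \<in> measurable M (\<mu> \<Otimes>\<^sub>M borel)"
    using n by (intro measurable_Pair measurable_u measurable_\<epsilon> assms) auto
  from measurable_compose[OF this borel_measurable_inner_continuous[OF continuous_on_J mu(2)]]
  show "(\<lambda>x. \<epsilon> N n x \<bullet> J z (u n x)) \<in> borel_measurable M"
    by simp
qed

lemma borel_measurable_sampling_average:
  "(\<lambda>x. 1 / real N * (\<Sum>n=1..N. J z (u n x) \<bullet> J z' (u n x))) \<in> borel_measurable M"
  by (intro borel_measurable_times borel_measurable_const borel_measurable_sum
      measurable_compose[OF measurable_u borel_measurable_inner_J]) auto

text \<open>Noise and quadrature parts are estimated separately and joined by (x + y)^q \<le> 2^q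
  (x^q + y^q). The constant is uniform in F, N and r; the sup norm of the image of F appears to the
  power q, which for an atom is the unweighted factor in (S2).\<close>

lemma expected_error_coefficient:
  "\<exists>C\<ge>0. \<forall>N\<ge>1. \<forall>r\<ge>0. \<forall>F.
     (\<integral>\<^sup>+x. ennreal (\<bar>error_functional N r (\<lambda>n. u n x) (\<lambda>n. \<epsilon> N n x) z F\<bar> powr q) \<partial>M)
       \<le> ennreal (C * (r powr q + 1) * real N powr (- (q / 2)) * sup_norm U (J (A F)) powr q)"
proof -
  interpret prob_space M by (rule sampling_modelD)
  obtain s K where s: "0 < s" and K: "0 \<le> K" "(\<integral>\<^sup>+y. ennreal (exp (s * norm y)) \<partial>\<nu>) \<le> ennreal K"
    using noise_law_exp_moment[OF noise] by blast
  define W where "W = sup_norm U (J z)"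
  define Cn where "Cn = (2 * q / s) powr q * (2 * exp (2 * K))"
  define Cs where "Cs = (2 * q) powr q * (2 * exp (2 * exp 2 :: real))"
  define C where "C = 2 powr q * (Cn + Cs * W powr q)"
  have nn: "0 \<le> Cn" "0 \<le> Cs" "0 \<le> W"
    using sup_norm_J_nonneg by (simp_all add: Cn_def Cs_def W_def)
  have "(\<integral>\<^sup>+x. ennreal (\<bar>error_functional N r (\<lambda>n. u n x) (\<lambda>n. \<epsilon> N n x) z F\<bar> powr q) \<partial>M)
       \<le> ennreal (C * (r powr q + 1) * real N powr (- (q / 2)) * sup_norm U (J (A F)) powr q)"
    if N: "1 \<le> N" and r: "0 \<le> r" for N r F
  proof -
    define b where "b = sup_norm U (J (A F))"
    have b: "0 \<le> b" "\<And>v. v \<in> U \<Longrightarrow> norm (J (A F) v) \<le> b"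
      using sup_norm_J_nonneg norm_J_le_sup_norm by (auto simp: b_def)
    define \<xi> where "\<xi> x = 1 / real N * (\<Sum>n=1..N. \<epsilon> N n x \<bullet> J (A F) (u n x))" for x
    define \<zeta> where "\<zeta> x = 1 / real N * (\<Sum>n=1..N. J (A F) (u n x) \<bullet> J z (u n x))
        - (\<integral>v. J (A F) v \<bullet> J z v \<partial>\<mu>)" for x
    have [measurable]: "\<xi> \<in> borel_measurable M" "\<zeta> \<in> borel_measurable M"
      unfolding \<xi>_def \<zeta>_def
      by (intro borel_measurable_noise_average borel_measurable_diff borel_measurable_sampling_average
          borel_measurable_const N)+
    have \<xi>: "(\<integral>\<^sup>+x. ennreal (\<bar>\<xi> x\<bar> powr q) \<partial>M) \<le> ennreal (Cn * (b powr q * real N powr (- (q / 2))))"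
      unfolding \<xi>_def Cn_def
    proof (rule noise_average_moment[OF N _ sampling_modelD(4,5)[OF N] noise sampling_modelD(6)[OF N] continuous_on_J mu(2) b _ s K])
      show "u n \<in> measurable M \<mu>" if "n \<in> {1..N}" for n
        using that by (intro measurable_u) auto
    qed (use q_gt_2 in auto)
    have \<zeta>: "(\<integral>\<^sup>+x. ennreal (\<bar>\<zeta> x\<bar> powr q) \<partial>M) \<le> ennreal (Cs * ((b * W) powr q * real N powr (- (q / 2))))"
      unfolding \<zeta>_def Cs_def
    proof (rule sampling_average_moment[OF _ _ mu(1) borel_measurable_inner_J])
      show "indep_vars (\<lambda>_. \<mu>) u {1..N}"
        using sampling_modelD(2) by (rule indep_vars_subset) auto
      show "\<bar>J (A F) v \<bullet> J z v\<bar> \<le> b * W" if "v \<in> space \<mu>" for v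
        using that unfolding W_def space_mu by (intro abs_inner_J_le b norm_J_le_sup_norm)
    qed (use q_gt_2 N sampling_modelD(3) in auto)
    have pt: "\<bar>error_functional N r (\<lambda>n. u n x) (\<lambda>n. \<epsilon> N n x) z F\<bar> powr q
        \<le> 2 powr q * r powr q * \<bar>\<xi> x\<bar> powr q + 2 powr q * \<bar>\<zeta> x\<bar> powr q" for x
    proof -
      have "\<bar>error_functional N r (\<lambda>n. u n x) (\<lambda>n. \<epsilon> N n x) z F\<bar> = \<bar>r * \<xi> x + \<zeta> x\<bar>"
        by (simp add: error_functional_def \<xi>_def \<zeta>_def)
      also have "\<dots> powr q \<le> (r * \<bar>\<xi> x\<bar> + \<bar>\<zeta> x\<bar>) powr q"
        using r q_gt_2 abs_triangle_ineq[of "r * \<xi> x" "\<zeta> x"] by (intro powr_mono2) (auto simp: abs_mult)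
      also have "\<dots> \<le> 2 powr q * ((r * \<bar>\<xi> x\<bar>) powr q + \<bar>\<zeta> x\<bar> powr q)"
        using r q_gt_2 by (intro powr_add_le) auto
      also have "(r * \<bar>\<xi> x\<bar>) powr q = r powr q * \<bar>\<xi> x\<bar> powr q"
        using r by (simp add: powr_mult)
      finally show ?thesis
        by (simp add: distrib_left mult.assoc)
    qed
    have "(\<integral>\<^sup>+x. ennreal (\<bar>error_functional N r (\<lambda>n. u n x) (\<lambda>n. \<epsilon> N n x) z F\<bar> powr q) \<partial>M)
        \<le> (\<integral>\<^sup>+x. ennreal (2 powr q * r powr q) * ennreal (\<bar>\<xi> x\<bar> powr q)
             + ennreal (2 powr q) * ennreal (\<bar>\<zeta> x\<bar> powr q) \<partial>M)"
      by (intro nn_integral_mono order.trans[OF ennreal_leI[OF pt]]) (simp add: ennreal_mult'')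
    also have "\<dots> = ennreal (2 powr q * r powr q) * (\<integral>\<^sup>+x. ennreal (\<bar>\<xi> x\<bar> powr q) \<partial>M)
        + ennreal (2 powr q) * (\<integral>\<^sup>+x. ennreal (\<bar>\<zeta> x\<bar> powr q) \<partial>M)"
      by (simp add: nn_integral_add nn_integral_cmult)
    also have "\<dots> \<le> ennreal (2 powr q * r powr q) * ennreal (Cn * (b powr q * real N powr (- (q / 2))))
        + ennreal (2 powr q) * ennreal (Cs * ((b * W) powr q * real N powr (- (q / 2))))"
      by (intro add_mono mult_left_mono \<xi> \<zeta>) auto
    also have "\<dots> = ennreal (2 powr q * r powr q * (Cn * (b powr q * real N powr (- (q / 2))))
        + 2 powr q * (Cs * ((b * W) powr q * real N powr (- (q / 2)))))"
      using nn by (simp flip: ennreal_mult'' ennreal_plus)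
    also have "\<dots> \<le> ennreal (C * (r powr q + 1) * real N powr (- (q / 2)) * b powr q)"
    proof (rule ennreal_leI)
      define P where "P = 2 powr q * (real N powr (- (q / 2)) * b powr q)"
      have P: "0 \<le> P" by (simp add: P_def)
      have "2 powr q * r powr q * (Cn * (b powr q * real N powr (- (q / 2))))
        + 2 powr q * (Cs * ((b * W) powr q * real N powr (- (q / 2)))) = P * (r powr q * Cn + Cs * W powr q)"
        using b nn by (simp add: P_def powr_mult algebra_simps)
      also have "\<dots> \<le> P * ((Cn + Cs * W powr q) * (r powr q + 1))"
        using P nn by (intro mult_left_mono) (simp_all add: algebra_simps)
      finally show "2 powr q * r powr q * (Cn * (b powr q * real N powr (- (q / 2))))
        + 2 powr q * (Cs * ((b * W) powr q * real N powr (- (q / 2))))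
        \<le> C * (r powr q + 1) * real N powr (- (q / 2)) * b powr q"
        by (simp add: P_def C_def ac_simps)
    qed
    finally show ?thesis
      by (simp add: b_def)
  qed
  moreover have "0 \<le> C"
    using nn by (simp add: C_def)
  ultimately show ?thesis
    by blast
qed

lemma borel_measurable_error_functional:
  assumes "1 \<le> N"
  shows "(\<lambda>x. error_functional N r (\<lambda>n. u n x) (\<lambda>n. \<epsilon> N n x) z F) \<in> borel_measurable M"
  unfolding error_functional_def
  by (intro borel_measurable_add borel_measurable_times[OF borel_measurable_const]
      borel_measurable_noise_average borel_measurable_diff borel_measurable_sampling_average
      borel_measurable_const assms)

text \<open>Sum and integral commute by nonnegativity, and the coefficientwise bounds add up to a
  multiple of the series in (S2). Working in \<open>ennreal\<close> postpones the question of
  convergence for each realization.\<close>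

lemma expected_error_series:
  "\<exists>C\<ge>0. \<forall>N\<ge>1. \<forall>r\<ge>0.
     (\<integral>\<^sup>+x. (\<Sum>j. ennreal (m (\<Lambda> j) powr (-q)
          * \<bar>error_functional N r (\<lambda>n. u n x) (\<lambda>n. \<epsilon> N n x) z (SHdag (unit_seq j))\<bar> powr q)) \<partial>M)
       \<le> ennreal (C * (r powr q + 1) * real N powr (- (q / 2)))"
proof -
  obtain C where C: "0 \<le> C" "\<And>N r F. 1 \<le> N \<Longrightarrow> 0 \<le> r \<Longrightarrow>
     (\<integral>\<^sup>+x. ennreal (\<bar>error_functional N r (\<lambda>n. u n x) (\<lambda>n. \<epsilon> N n x) z F\<bar> powr q) \<partial>M)
       \<le> ennreal (C * (r powr q + 1) * real N powr (- (q / 2)) * sup_norm U (J (A F)) powr q)"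
    using expected_error_coefficient[of z] by auto
  define S where "S = (\<Sum>j. m (\<Lambda> j) powr (-q) * sup_norm U (atom j) powr q)"
  have S: "0 \<le> S"
    unfolding S_def by (intro suminf_nonneg S2) auto
  have "(\<integral>\<^sup>+x. (\<Sum>j. ennreal (m (\<Lambda> j) powr (-q)
          * \<bar>error_functional N r (\<lambda>n. u n x) (\<lambda>n. \<epsilon> N n x) z (SHdag (unit_seq j))\<bar> powr q)) \<partial>M)
       \<le> ennreal (C * S * (r powr q + 1) * real N powr (- (q / 2)))"
    if N: "1 \<le> N" and r: "0 \<le> r" for N r
  proof -
    note [measurable] = borel_measurable_error_functional[OF N]
    define P where "P = C * (r powr q + 1) * real N powr (- (q / 2))"
    have P: "0 \<le> P"
      using C by (simp add: P_def)
    have "(\<integral>\<^sup>+x. (\<Sum>j. ennreal (m (\<Lambda> j) powr (-q)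
          * \<bar>error_functional N r (\<lambda>n. u n x) (\<lambda>n. \<epsilon> N n x) z (SHdag (unit_seq j))\<bar> powr q)) \<partial>M)
       = (\<Sum>j. \<integral>\<^sup>+x. ennreal (m (\<Lambda> j) powr (-q)
          * \<bar>error_functional N r (\<lambda>n. u n x) (\<lambda>n. \<epsilon> N n x) z (SHdag (unit_seq j))\<bar> powr q) \<partial>M)"
      by (rule nn_integral_suminf) measurable
    also have "\<dots> = (\<Sum>j. ennreal (m (\<Lambda> j) powr (-q)) * (\<integral>\<^sup>+x. ennreal
          (\<bar>error_functional N r (\<lambda>n. u n x) (\<lambda>n. \<epsilon> N n x) z (SHdag (unit_seq j))\<bar> powr q) \<partial>M))"
      by (subst nn_integral_cmult[symmetric]) (auto simp: ennreal_mult'')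
    also have "\<dots> \<le> (\<Sum>j. ennreal (P * (m (\<Lambda> j) powr (-q) * sup_norm U (atom j) powr q)))"
    proof (intro suminf_le)
      fix j
      have "ennreal (m (\<Lambda> j) powr (-q)) * (\<integral>\<^sup>+x. ennreal
          (\<bar>error_functional N r (\<lambda>n. u n x) (\<lambda>n. \<epsilon> N n x) z (SHdag (unit_seq j))\<bar> powr q) \<partial>M)
          \<le> ennreal (m (\<Lambda> j) powr (-q)) * ennreal (P * sup_norm U (atom j) powr q)"
        unfolding P_def using C(2)[OF N r] by (intro mult_left_mono) auto
      also have "\<dots> = ennreal (P * (m (\<Lambda> j) powr (-q) * sup_norm U (atom j) powr q))"
        using P by (simp add: ac_simps flip: ennreal_mult'')
      finally show "ennreal (m (\<Lambda> j) powr (-q)) * (\<integral>\<^sup>+x. ennreal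
          (\<bar>error_functional N r (\<lambda>n. u n x) (\<lambda>n. \<epsilon> N n x) z (SHdag (unit_seq j))\<bar> powr q) \<partial>M)
          \<le> ennreal (P * (m (\<Lambda> j) powr (-q) * sup_norm U (atom j) powr q))" .
    qed auto
    also have "\<dots> = ennreal (P * S)"
      unfolding S_def using P by (intro suminf_ennreal_eq sums_mult summable_sums S2) auto
    finally show ?thesis
      by (simp add: P_def ac_simps)
  qed
  then show ?thesis
    using C S by (intro exI[of _ "C * S"]) auto
qed

text \<open>The common core of both regimes. The first condition with L controls the source
  remainder; the second says (\<delta>/\<alpha>)^2 / N \<le> L \<rho> and controls the noise; the
  third controls the quadrature error. The expected series is then at most of order \<rho>^(q/2),
  which cancels against \<rho>^(1 - q/2) and leaves \<rho>.\<close>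

theorem expected_bregman_bound:
  assumes truth: "f_dag \<in> X" "nonneg_ae \<psi> w f_dag"
    and source: "\<And>F. F \<in> X \<Longrightarrow> grad_R \<psi> p m \<Lambda> f_dag F = A_mu_adjoint \<mu> J A (J z) F"
    and L: "0 \<le> L"
  shows "\<exists>C>0. \<forall>N \<delta> \<alpha> \<rho> f. 1 \<le> N \<longrightarrow> 0 < \<delta> \<longrightarrow> 0 < \<alpha> \<longrightarrow> 0 < \<rho> \<longrightarrow> \<rho> \<le> 1 \<longrightarrow> \<alpha> \<le> L * \<rho>
     \<longrightarrow> \<delta>\<^sup>2 / real N \<le> L * \<alpha>\<^sup>2 * \<rho> \<longrightarrow> 1 / real N \<le> L * \<rho>
     \<longrightarrow> is_estimator \<psi> w p m \<Lambda> J A f_dag M u \<epsilon> \<delta> \<alpha> N f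
     \<longrightarrow> (\<integral>\<^sup>+x. ennreal (bregman \<psi> p m \<Lambda> (f x) f_dag) \<partial>M) \<le> ennreal (C * \<rho>)"
proof -
  interpret prob_space M by (rule sampling_modelD)
  obtain C0 where C0: "0 \<le> C0" "\<And>N r. 1 \<le> N \<Longrightarrow> 0 \<le> r \<Longrightarrow>
     (\<integral>\<^sup>+x. (\<Sum>j. ennreal (m (\<Lambda> j) powr (-q)
          * \<bar>error_functional N r (\<lambda>n. u n x) (\<lambda>n. \<epsilon> N n x) z (SHdag (unit_seq j))\<bar> powr q)) \<partial>M)
       \<le> ennreal (C0 * (r powr q + 1) * real N powr (- (q / 2)))"
    using expected_error_series[of z] by auto
  define K where "K = 4 powr (2 - p) / (p - 1)"
  define K2 where "K2 = 2 * (2 * K) powr (q / p)"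
  define B where "B = (\<Sum>j. m (\<Lambda> j) powr p * \<bar>SH f_dag j\<bar> powr p)"
  define W where "W = sup_norm U (J z)"
  have B: "0 \<le> B"
    unfolding B_def using SH_in_lp[OF truth(1)] by (intro suminf_nonneg) (auto simp: lp_def)
  have K2: "0 \<le> K2"
    by (simp add: K2_def)
  define C where "C = B + L * W\<^sup>2 / 2 + K2 * (C0 * (2 * L powr (q / 2))) + 1"
  have "0 < C"
    using B L C0(1) K2 unfolding C_def by (intro add_nonneg_pos add_nonneg_nonneg) auto
  moreover have "(\<integral>\<^sup>+x. ennreal (bregman \<psi> p m \<Lambda> (f x) f_dag) \<partial>M) \<le> ennreal (C * \<rho>)"
    if N: "1 \<le> N" and \<delta>: "0 < \<delta>" and \<alpha>: "0 < \<alpha>" and \<rho>: "0 < \<rho>" "\<rho> \<le> 1" and h: "\<alpha> \<le> L * \<rho>"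
      "\<delta>\<^sup>2 / real N \<le> L * \<alpha>\<^sup>2 * \<rho>" "1 / real N \<le> L * \<rho>"
      and f: "is_estimator \<psi> w p m \<Lambda> J A f_dag M u \<epsilon> \<delta> \<alpha> N f" for N \<delta> \<alpha> \<rho> f
  proof -
    define r where "r = \<delta> / \<alpha>"
    have r: "0 < r" using \<delta> \<alpha> by (simp add: r_def)
    have N0: "0 < real N" using N by simp
    define k where "k x j = \<bar>error_functional N r (\<lambda>n. u n x) (\<lambda>n. \<epsilon> N n x) z (SHdag (unit_seq j))\<bar>" for x j
    define H where "H x = (\<Sum>j. ennreal (m (\<Lambda> j) powr (-q) * k x j powr q))" for x
    have [measurable]: "H \<in> borel_measurable M"
    proof -
      note [measurable] = borel_measurable_error_functional[OF N]
      show ?thesis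
        unfolding H_def k_def by measurable
    qed
    define c where "c = \<rho> * B + \<alpha> * W\<^sup>2 / 2"
    define d where "d = K2 * \<rho> powr (1 - q / 2)"
    have c: "0 \<le> c" and d: "0 \<le> d"
      using \<rho> B \<alpha> K2 by (auto simp: c_def d_def)
    have pt: "ennreal (bregman \<psi> p m \<Lambda> (f x) f_dag) \<le> ennreal c + ennreal d * H x"
      if x: "x \<in> space M" and min: "is_arg_min (objective \<psi> w p m \<Lambda> J A \<alpha> N (\<lambda>n. u n x)
           (\<lambda>n. sampled J A (\<lambda>n. u n x) f_dag n + \<delta> *\<^sub>R \<epsilon> N n x)) (\<lambda>F. F \<in> X) (f x)" for x
    proof -
      have us: "u n x \<in> U" if "n \<in> {1..N}" for n
        using that x by (intro u_in_U) auto
      \<comment> \<open>With this choice \<theta>^2 = \<rho> and \<theta>^(2 - q) = \<rho>^(1 -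
        q/2).\<close>
      have \<theta>: "0 < sqrt \<rho>" "sqrt \<rho> \<le> 1"
        using \<rho> by auto
      note bound = bregman_deterministic_bound[OF N us \<alpha> \<theta> min truth source S2 K_def, folded r_def, folded k_def]
      have "sqrt \<rho> powr (2 - q) = \<rho> powr (1 - q / 2)"
        using \<rho> powr_powr[of \<rho> "1 / 2" "2 - q"] by (simp add: powr_half_sqrt diff_divide_distrib)
      then have "bregman \<psi> p m \<Lambda> (f x) f_dag \<le> c + d * (\<Sum>j. m (\<Lambda> j) powr (-q) * k x j powr q)"
        using bound(2) \<rho> by (simp add: c_def d_def K2_def B_def W_def)
      also have "ennreal \<dots> = ennreal c + ennreal d * ennreal (\<Sum>j. m (\<Lambda> j) powr (-q) * k x j powr q)"
        using c d bound(1) by (subst ennreal_plus) (auto intro!: mult_nonneg_nonneg suminf_nonneg simp: ennreal_mult')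
      also have "ennreal (\<Sum>j. m (\<Lambda> j) powr (-q) * k x j powr q) = H x"
        unfolding H_def using bound(1) by (intro suminf_ennreal2[symmetric]) auto
      finally show ?thesis
        by (simp add: ennreal_leI)
    qed
    have HN: "real N powr (- (q / 2)) \<le> (L * \<rho>) powr (q / 2)"
    proof -
      have "real N powr (- (q / 2)) = (1 / real N) powr (q / 2)"
        using N0 by (simp add: powr_divide powr_minus_divide)
      also have "\<dots> \<le> (L * \<rho>) powr (q / 2)"
        using h(3) q_gt_2 by (intro powr_mono2) auto
      finally show ?thesis .
    qed
    have Hr: "r powr q * real N powr (- (q / 2)) \<le> (L * \<rho>) powr (q / 2)"
    proof -
      have "r powr q * real N powr (- (q / 2)) = (r\<^sup>2 / real N) powr (q / 2)"
        using N0 r powr_powr[of r 2 "q / 2"] by (simp add: powr_divide powr_minus_divide)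
      also have "\<dots> \<le> (L * \<rho>) powr (q / 2)"
        using h(2) q_gt_2 \<alpha> N0 by (intro powr_mono2) (auto simp: r_def field_simps)
      finally show ?thesis .
    qed
    \<comment> \<open>The minimizer is chosen for almost every outcome, possibly in a nonmeasurable
      way. Monotonicity of the integral still applies, and the dominating function is
      measurable.\<close>
    have "(\<integral>\<^sup>+x. ennreal (bregman \<psi> p m \<Lambda> (f x) f_dag) \<partial>M) \<le> (\<integral>\<^sup>+x. ennreal c + ennreal d * H x \<partial>M)"
    proof (rule nn_integral_mono_AE)
      show "AE x in M. ennreal (bregman \<psi> p m \<Lambda> (f x) f_dag) \<le> ennreal c + ennreal d * H x"
        using f[unfolded is_estimator_def] AE_space by eventually_elim (rule pt)
    qed
    also have "\<dots> = ennreal c + ennreal d * (\<integral>\<^sup>+x. H x \<partial>M)"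
      by (simp add: nn_integral_add nn_integral_cmult emeasure_space_1)
    also have "(\<integral>\<^sup>+x. H x \<partial>M) \<le> ennreal (C0 * (r powr q + 1) * real N powr (- (q / 2)))"
      unfolding H_def k_def using r by (intro C0 N) auto
    also have "C0 * (r powr q + 1) * real N powr (- (q / 2)) \<le> C0 * (2 * (L powr (q / 2) * \<rho> powr (q / 2)))"
    proof -
      have "(r powr q + 1) * real N powr (- (q / 2)) \<le> 2 * (L * \<rho>) powr (q / 2)"
        using HN Hr by (simp add: distrib_right)
      then show ?thesis
        using C0(1) L \<rho> by (simp add: powr_mult mult.assoc mult_left_mono)
    qed
    also have "ennreal c + ennreal d * ennreal (C0 * (2 * (L powr (q / 2) * \<rho> powr (q / 2))))
        = ennreal (c + d * (C0 * (2 * (L powr (q / 2) * \<rho> powr (q / 2)))))"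
      using c d C0(1) by (subst ennreal_plus) (auto simp: ennreal_mult')
    also have "\<dots> \<le> ennreal (C * \<rho>)"
    proof (rule ennreal_leI)
      have "\<rho> powr (1 - q / 2) * \<rho> powr (q / 2) = \<rho>"
        using \<rho> by (simp flip: powr_add)
      then have "d * (C0 * (2 * (L powr (q / 2) * \<rho> powr (q / 2)))) = K2 * (C0 * (2 * L powr (q / 2))) * \<rho>"
        by (simp add: d_def algebra_simps)
      moreover have "\<alpha> * W\<^sup>2 / 2 \<le> L * \<rho> * W\<^sup>2 / 2"
        using h(1) by (simp add: mult_right_mono)
      moreover have "C * \<rho> = \<rho> * B + L * \<rho> * W\<^sup>2 / 2 + K2 * (C0 * (2 * L powr (q / 2))) * \<rho> + \<rho>"
        by (simp add: C_def algebra_simps)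
      ultimately show "c + d * (C0 * (2 * (L powr (q / 2) * \<rho> powr (q / 2)))) \<le> C * \<rho>"
        using \<rho> unfolding c_def by linarith
    qed
    finally show ?thesis
      by (simp add: add_left_mono mult_left_mono ennreal_leI)
  qed
  ultimately show ?thesis
    by blast
qed

end

end

text \<open>Both rates instantiate \<open>expected_bregman_bound\<close>, with \<rho> the claimed
  rate. The factors \<open>c\<^sub>1\<close> and \<open>c\<^sub>2\<close> express that \<alpha> is
  equivalent to the rate, and C is chosen before the sequences \<delta>, \<alpha> and f, so it is
  independent of them.\<close>

theorem theorem4p4:
  fixes p q :: real
    and \<psi> :: "plane \<Rightarrow> real"
    and \<omega> :: "real \<Rightarrow> real \<Rightarrow> real"
    and w m :: "shear_param \<Rightarrow> real"
    and \<Lambda> :: "nat \<Rightarrow> shear_param"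
    and SHdag :: "(nat \<Rightarrow> real) \<Rightarrow> functional"
    and U :: "'u::euclidean_space set"
    and J :: "'z::banach \<Rightarrow> 'u \<Rightarrow> 'v::{real_inner,complete_space}"
    and A :: "functional \<Rightarrow> 'z"
    and \<mu> :: "'u measure" and \<nu> :: "'v measure"
    and M :: "'w measure"
    and u :: "nat \<Rightarrow> 'w \<Rightarrow> 'u" and \<epsilon> :: "nat \<Rightarrow> nat \<Rightarrow> 'w \<Rightarrow> 'v"
    and f_dag :: functional
  assumes p: "1 < p" "p < 2" and q: "1 / p + 1 / q = 1"
    and weights: "w = (\<lambda>(a, s, t). \<omega> a s)" "locally_integrable_weight w" "moderate_weight w m"
    and psi: "\<psi> \<in> L2_plane" "admissible_shearlet \<psi>" "compactly_supported \<psi>" "\<psi> \<in> H1 \<psi> w"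
    and Lambda: "inj \<Lambda>" "range \<Lambda> \<subseteq> shear_group" "\<forall>g\<in>range \<Lambda>. g isolated_in range \<Lambda>"
    and frame: "banach_frame \<psi> w p m \<Lambda>"
    and SHdag: "bounded_linear_from_lp p (m \<circ> \<Lambda>) (X_space \<psi> w p m) (X_norm \<psi> p m \<Lambda>) SHdag"
      "\<And>F. F \<in> X_space \<psi> w p m \<Longrightarrow> SHdag (shear_coeffs \<psi> \<Lambda> F) = F"
    and U: "U \<in> sets lebesgue"
    and Z: "embedded_in_L2_and_C U J"
    and A: "forward_operator (X_space \<psi> w p m) (X_norm \<psi> p m \<Lambda>) U J A"
    and A1: "\<exists>\<kappa>\<le>1. \<forall>v\<in>U. \<forall>F\<in>X_space \<psi> w p m. norm (J (A F) v) \<le> \<kappa> * X_norm \<psi> p m \<Lambda> F"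
    and A2: "\<forall>F\<in>X_space \<psi> w p m. J (A F) \<in> borel_measurable (restrict_space borel U)"
    and mu: "prob_space \<mu>" "sets \<mu> = sets (restrict_space borel U)"
    and noise: "noise_law \<nu>"
    and sampling: "sampling_model M \<mu> \<nu> u \<epsilon>"
    and truth: "f_dag \<in> X_space \<psi> w p m" "nonneg_ae \<psi> w f_dag"
    and S1: "\<exists>z. \<forall>F\<in>X_space \<psi> w p m. grad_R \<psi> p m \<Lambda> f_dag F = A_mu_adjoint \<mu> J A (J z) F"
    and S2: "summable (\<lambda>j. m (\<Lambda> j) powr (-q) * sup_norm U (J (A (SHdag (unit_seq j)))) powr q)"
  shows
    "(\<forall>c\<^sub>1 c\<^sub>2. 0 < c\<^sub>1 \<and> c\<^sub>1 \<le> c\<^sub>2 \<longrightarrow> (\<exists>C>0. \<forall>\<delta> \<alpha> f.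
        (\<forall>N\<ge>1. 0 < \<delta> N)
      \<and> filterlim (\<lambda>N. \<delta> N * real N) at_top sequentially
      \<and> (\<lambda>N. (\<delta> N)\<^sup>2 / real N) \<longlonglongrightarrow> 0
      \<and> (\<forall>N\<ge>1. c\<^sub>1 * ((\<delta> N)\<^sup>2 / real N) powr (1/3) \<le> \<alpha> N
              \<and> \<alpha> N \<le> c\<^sub>2 * ((\<delta> N)\<^sup>2 / real N) powr (1/3))
      \<and> (\<forall>N\<ge>1. is_estimator \<psi> w p m \<Lambda> J A f_dag M u \<epsilon> (\<delta> N) (\<alpha> N) N (f N))
      \<longrightarrow> (\<forall>\<^sub>F N in sequentially.
            (\<integral>\<^sup>+x. ennreal (bregman \<psi> p m \<Lambda> (f N x) f_dag) \<partial>M)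
              \<le> ennreal (C * ((\<delta> N)\<^sup>2 / real N) powr (1/3)))))
   \<and> (\<forall>c\<^sub>1 c\<^sub>2 B. 0 < c\<^sub>1 \<and> c\<^sub>1 \<le> c\<^sub>2 \<longrightarrow> (\<exists>C>0. \<forall>\<delta> \<alpha> f.
        (\<forall>N\<ge>1. 0 < \<delta> N)
      \<and> (\<forall>N\<ge>1. \<delta> N * real N \<le> B)
      \<and> (\<forall>N\<ge>1. c\<^sub>1 * (1 / real N) \<le> \<alpha> N \<and> \<alpha> N \<le> c\<^sub>2 * (1 / real N))
      \<and> (\<forall>N\<ge>1. is_estimator \<psi> w p m \<Lambda> J A f_dag M u \<epsilon> (\<delta> N) (\<alpha> N) N (f N))
      \<longrightarrow> (\<forall>N\<ge>1.
            (\<integral>\<^sup>+x. ennreal (bregman \<psi> p m \<Lambda> (f N x) f_dag) \<partial>M)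
              \<le> ennreal (C * (1 / real N)))))"
proof -
  obtain z where z: "\<And>F. F \<in> X_space \<psi> w p m \<Longrightarrow> grad_R \<psi> p m \<Lambda> f_dag F = A_mu_adjoint \<mu> J A (J z) F"
    using S1 by blast
  have weight_pos: "0 < m (\<Lambda> j)" for j
    using weights(3) Lambda(2) by (auto simp: moderate_weight_def is_weight_def)
  interpret regularized_sampling p q \<psi> w m \<Lambda> SHdag U J A \<mu>
    by (rule regularized_sampling.intro) (fact p q weight_pos frame SHdag Z A mu)+
  note bound = expected_bregman_bound[OF noise sampling S2 truth z]
  show ?thesis
  proof (intro conjI allI impI)
    fix c\<^sub>1 c\<^sub>2 :: real
    assume c: "0 < c\<^sub>1 \<and> c\<^sub>1 \<le> c\<^sub>2"
    \<comment> \<open>One summand for each side condition: \<open>c\<^sub>2\<close> for \<alpha>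
      \<le> L \<rho>, the inverse square of \<open>c\<^sub>1\<close> for the noise condition, and 1
      for 1/N \<le> L \<rho>.\<close>
    define L where "L = c\<^sub>2 + 1 / c\<^sub>1\<^sup>2 + 1"
    have L: "0 \<le> L" "c\<^sub>2 \<le> L" "1 / c\<^sub>1\<^sup>2 \<le> L" "1 \<le> L"
      using c by (auto simp: L_def)
    obtain C where C: "0 < C" "\<And>N \<delta> \<alpha> \<rho> f. 1 \<le> N \<Longrightarrow> 0 < \<delta> \<Longrightarrow> 0 < \<alpha> \<Longrightarrow> 0 < \<rho> \<Longrightarrow> \<rho> \<le> 1 \<Longrightarrow> \<alpha> \<le> L * \<rho>
     \<Longrightarrow> \<delta>\<^sup>2 / real N \<le> L * \<alpha>\<^sup>2 * \<rho> \<Longrightarrow> 1 / real N \<le> L * \<rho>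
     \<Longrightarrow> is_estimator \<psi> w p m \<Lambda> J A f_dag M u \<epsilon> \<delta> \<alpha> N f
     \<Longrightarrow> (\<integral>\<^sup>+x. ennreal (bregman \<psi> p m \<Lambda> (f x) f_dag) \<partial>M) \<le> ennreal (C * \<rho>)"
      using bound[OF _ L(1)] by blast
    have "\<forall>\<^sub>F N in sequentially. (\<integral>\<^sup>+x. ennreal (bregman \<psi> p m \<Lambda> (f N x) f_dag) \<partial>M)
        \<le> ennreal (C * ((\<delta> N)\<^sup>2 / real N) powr (1/3))"
      if \<delta>: "\<And>N. 1 \<le> N \<Longrightarrow> 0 < \<delta> N"
        and large: "filterlim (\<lambda>N. \<delta> N * real N) at_top sequentially"
        and small: "(\<lambda>N. (\<delta> N)\<^sup>2 / real N) \<longlonglongrightarrow> 0"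
        and \<alpha>: "\<And>N. 1 \<le> N \<Longrightarrow> c\<^sub>1 * ((\<delta> N)\<^sup>2 / real N) powr (1/3) \<le> \<alpha> N
              \<and> \<alpha> N \<le> c\<^sub>2 * ((\<delta> N)\<^sup>2 / real N) powr (1/3)"
        and f: "\<And>N. 1 \<le> N \<Longrightarrow> is_estimator \<psi> w p m \<Lambda> J A f_dag M u \<epsilon> (\<delta> N) (\<alpha> N) N (f N)"
      for \<delta> \<alpha> :: "nat \<Rightarrow> real" and f
    proof -
      \<comment> \<open>The two limits are used only through this inequality, which yields 1/N \<le>
        \<rho>, and the next one, which yields \<rho> \<le> 1.\<close>
      have "\<forall>\<^sub>F N in sequentially. 1 \<le> \<delta> N * real N"
        using large by (simp add: filterlim_at_top)
      moreover have "\<forall>\<^sub>F N in sequentially. (\<delta> N)\<^sup>2 / real N < 1"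
        using small by (rule order_tendstoD) simp
      moreover have "\<forall>\<^sub>F N in sequentially. 1 \<le> (N::nat)"
        by (rule eventually_ge_at_top)
      ultimately show ?thesis
      proof eventually_elim
        case (elim N)
        define \<rho> where "\<rho> = ((\<delta> N)\<^sup>2 / real N) powr (1/3)"
        have \<delta>N: "0 < \<delta> N" and N: "0 < real N"
          using \<delta>[OF elim(3)] elim(3) by auto
        then have \<rho>: "0 < \<rho>"
          by (simp add: \<rho>_def)
        have \<rho>1: "\<rho> \<le> 1"
          unfolding \<rho>_def using elim(2) N by (intro powr_le1) auto
        have cube: "\<rho>\<^sup>2 * \<rho> = (\<delta> N)\<^sup>2 / real N"
        proof -
          have "\<rho>\<^sup>2 * \<rho> = \<rho> powr 3"
            using \<rho> by (simp add: powr_numeral power2_eq_square power3_eq_cube)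
          also have "\<dots> = (\<delta> N)\<^sup>2 / real N"
            using \<delta>N N by (simp add: \<rho>_def powr_powr)
          finally show ?thesis .
        qed
        have \<alpha>N: "c\<^sub>1 * \<rho> \<le> \<alpha> N" "\<alpha> N \<le> c\<^sub>2 * \<rho>"
          using \<alpha>[OF elim(3)] by (auto simp: \<rho>_def)
        have inverse_le: "1 / real N \<le> \<rho>"
        proof -
          \<comment> \<open>Dividing 1 \<le> (\<delta> N)^2, with the product of noise level and
            sample size squared, by the cube of the sample size compares N^(-3) with
            \<rho>^3.\<close>
          have "1 ^ 2 \<le> (\<delta> N * real N) ^ 2"
            using elim(1) by (intro power_mono) auto
          then have "(1 / real N) ^ 3 \<le> (\<delta> N)\<^sup>2 / real N"
            using N by (simp add: field_simps power2_eq_square power3_eq_cube)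
          then have "((1 / real N) ^ 3) powr (1/3) \<le> \<rho>"
            unfolding \<rho>_def by (intro powr_mono2) auto
          moreover have "((1 / real N) ^ 3) powr (1/3) = 1 / real N"
            using N powr_powr[of "1 / real N" 3 "1/3"] by simp
          ultimately show ?thesis by simp
        qed
        have "(\<delta> N)\<^sup>2 / real N \<le> L * (\<alpha> N)\<^sup>2 * \<rho>"
        proof -
          have "(c\<^sub>1 * \<rho>)\<^sup>2 \<le> (\<alpha> N)\<^sup>2"
            using \<alpha>N(1) c \<rho> by (intro power_mono) auto
          then have "\<rho>\<^sup>2 \<le> 1 / c\<^sub>1\<^sup>2 * (\<alpha> N)\<^sup>2"
            using c by (simp add: power_mult_distrib field_simps)
          also have "\<dots> \<le> L * (\<alpha> N)\<^sup>2"
            by (intro mult_right_mono L) auto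
          finally show ?thesis
            unfolding cube[symmetric] using \<rho> by (simp add: mult_right_mono)
        qed
        moreover have "\<alpha> N \<le> L * \<rho>" "1 / real N \<le> L * \<rho>"
          using \<alpha>N(2) inverse_le mult_right_mono[OF L(2) less_imp_le[OF \<rho>]]
            mult_right_mono[OF L(4) less_imp_le[OF \<rho>]]
          by linarith+
        moreover have "0 < \<alpha> N"
          using \<alpha>N(1) c \<rho> by (smt (verit) mult_pos_pos)
        ultimately show ?case
          unfolding \<rho>_def[symmetric] using elim(3) \<delta>N \<rho> \<rho>1 f by (intro C(2)) auto
      qed
    qed
    then show "\<exists>C>0. \<forall>\<delta> \<alpha> f.
        (\<forall>N\<ge>1. 0 < \<delta> N)
      \<and> filterlim (\<lambda>N. \<delta> N * real N) at_top sequentially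
      \<and> (\<lambda>N. (\<delta> N)\<^sup>2 / real N) \<longlonglongrightarrow> 0
      \<and> (\<forall>N\<ge>1. c\<^sub>1 * ((\<delta> N)\<^sup>2 / real N) powr (1/3) \<le> \<alpha> N
              \<and> \<alpha> N \<le> c\<^sub>2 * ((\<delta> N)\<^sup>2 / real N) powr (1/3))
      \<and> (\<forall>N\<ge>1. is_estimator \<psi> w p m \<Lambda> J A f_dag M u \<epsilon> (\<delta> N) (\<alpha> N) N (f N))
      \<longrightarrow> (\<forall>\<^sub>F N in sequentially.
            (\<integral>\<^sup>+x. ennreal (bregman \<psi> p m \<Lambda> (f N x) f_dag) \<partial>M)
              \<le> ennreal (C * ((\<delta> N)\<^sup>2 / real N) powr (1/3)))"
      using C(1) by (intro exI[of _ C] conjI allI impI) auto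
  next
    fix c\<^sub>1 c\<^sub>2 B :: real
    assume c: "0 < c\<^sub>1 \<and> c\<^sub>1 \<le> c\<^sub>2"
    \<comment> \<open>Now \<rho> = 1/N, so the bound on \<delta> N says \<delta> \<le> B \<rho>,
      hence \<delta>^2 \<le> B^2 \<rho>^2; dividing by the square of \<open>c\<^sub>1\<close> turns
      \<rho>^2 into \<alpha>^2. As \<rho> \<le> 1 for every N \<ge> 1, the rate holds without
      passing to large N.\<close>
    define L where "L = c\<^sub>2 + B\<^sup>2 / c\<^sub>1\<^sup>2 + 1"
    have L: "0 \<le> L" "c\<^sub>2 \<le> L" "B\<^sup>2 / c\<^sub>1\<^sup>2 \<le> L" "1 \<le> L"
      using c by (auto simp: L_def)
    obtain C where C: "0 < C" "\<And>N \<delta> \<alpha> \<rho> f. 1 \<le> N \<Longrightarrow> 0 < \<delta> \<Longrightarrow> 0 < \<alpha> \<Longrightarrow> 0 < \<rho> \<Longrightarrow> \<rho> \<le> 1 \<Longrightarrow> \<alpha> \<le> L * \<rho>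
     \<Longrightarrow> \<delta>\<^sup>2 / real N \<le> L * \<alpha>\<^sup>2 * \<rho> \<Longrightarrow> 1 / real N \<le> L * \<rho>
     \<Longrightarrow> is_estimator \<psi> w p m \<Lambda> J A f_dag M u \<epsilon> \<delta> \<alpha> N f
     \<Longrightarrow> (\<integral>\<^sup>+x. ennreal (bregman \<psi> p m \<Lambda> (f x) f_dag) \<partial>M) \<le> ennreal (C * \<rho>)"
      using bound[OF _ L(1)] by blast
    have rate: "(\<integral>\<^sup>+x. ennreal (bregman \<psi> p m \<Lambda> (f N x) f_dag) \<partial>M) \<le> ennreal (C * (1 / real N))"
      if N: "1 \<le> N" and \<delta>: "0 < \<delta> N" "\<delta> N * real N \<le> B"
        and \<alpha>: "c\<^sub>1 * (1 / real N) \<le> \<alpha> N" "\<alpha> N \<le> c\<^sub>2 * (1 / real N)"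
        and f: "is_estimator \<psi> w p m \<Lambda> J A f_dag M u \<epsilon> (\<delta> N) (\<alpha> N) N (f N)"
      for N and \<delta> \<alpha> :: "nat \<Rightarrow> real" and f
    proof -
      define \<rho> where "\<rho> = 1 / real N"
      have \<rho>: "0 < \<rho>" "\<rho> \<le> 1"
        using N by (auto simp: \<rho>_def)
      have "\<delta> N \<le> B * \<rho>"
        using \<delta> N by (simp add: \<rho>_def field_simps)
      then have "(\<delta> N)\<^sup>2 \<le> (B * \<rho>)\<^sup>2"
        using \<delta> by (intro power_mono) auto
      also have "\<dots> = B\<^sup>2 / c\<^sub>1\<^sup>2 * (c\<^sub>1 * \<rho>)\<^sup>2"
        using c by (simp add: power_mult_distrib)
      also have "\<dots> \<le> L * (\<alpha> N)\<^sup>2"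
        using \<alpha>(1) c \<rho> L by (intro mult_mono power_mono) (auto simp: \<rho>_def)
      finally have "(\<delta> N)\<^sup>2 * \<rho> \<le> L * (\<alpha> N)\<^sup>2 * \<rho>"
        using \<rho> by (intro mult_right_mono) auto
      then have "(\<delta> N)\<^sup>2 / real N \<le> L * (\<alpha> N)\<^sup>2 * \<rho>"
        by (simp add: \<rho>_def)
      moreover have "\<alpha> N \<le> L * \<rho>" "1 * \<rho> \<le> L * \<rho>"
        using \<alpha>(2) mult_right_mono[OF L(2) less_imp_le[OF \<rho>(1)]] mult_right_mono[OF L(4) less_imp_le[OF \<rho>(1)]]
        unfolding \<rho>_def by linarith+
      moreover have "0 < \<alpha> N"
        using \<alpha>(1) c \<rho> unfolding \<rho>_def by (smt (verit) mult_pos_pos)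
      ultimately show ?thesis
        unfolding \<rho>_def[symmetric] using N \<delta> \<rho> f by (intro C(2)) (auto simp: \<rho>_def)
    qed
    show "\<exists>C>0. \<forall>\<delta> \<alpha> f.
        (\<forall>N\<ge>1. 0 < \<delta> N)
      \<and> (\<forall>N\<ge>1. \<delta> N * real N \<le> B)
      \<and> (\<forall>N\<ge>1. c\<^sub>1 * (1 / real N) \<le> \<alpha> N \<and> \<alpha> N \<le> c\<^sub>2 * (1 / real N))
      \<and> (\<forall>N\<ge>1. is_estimator \<psi> w p m \<Lambda> J A f_dag M u \<epsilon> (\<delta> N) (\<alpha> N) N (f N))
      \<longrightarrow> (\<forall>N\<ge>1.
            (\<integral>\<^sup>+x. ennreal (bregman \<psi> p m \<Lambda> (f N x) f_dag) \<partial>M)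
              \<le> ennreal (C * (1 / real N)))"
      by (intro exI[of _ C] conjI[OF C(1)] allI impI) (elim conjE, rule rate; blast)
  qed
qed

end
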